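(* Let $s\ge 2$ be an integer and let $T_t$ be a tree of order $t$. If either (i) $\ell(T_t)\ge s+1$, or (ii) $t>7(s-2)$, then $$r_{pot}(K_s,T_t)=t+s-2.$$
   Context: All graphs are finite and simple. A sequence of nonnegative integers $\pi=(d_1,\dots,d_n)$ (written in nonincreasing order) is graphic if some graph of order $n$ has degree sequence $\pi$; such a graph is a realization of $\pi$. For a graph $H$, a graphic sequence $\pi$ is potentially $H$-graphic if some realization of $\pi$ contains $H$ as a subgraph. For an $N$-term graphic sequence $\pi=(d_1,\dots,d_N)$, its complementary sequence is $\overline{\pi}=(N-1-d_N,\dots,N-1-d_1)$. For graphs $H_1,H_2$, the potential-Ramsey number $r_{pot}(H_1,H_2)$ is the minimum integer $N$ such that for every $N$-term graphic sequence $\pi$, either $\pi$ is potentially $H_1$-graphic or $\overline{\pi}$ is potentially $H_2$-graphic. $K_s$ denotes the complete graph on $s$ vertices, and $\ell(T)$ denotes the number of leaves (vertices of degree $1$) of a tree $T$. *)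

theory Defs
  imports Main
begin

type_synonym 'a graph = "'a set \<times> ('a \<Rightarrow> 'a \<Rightarrow> bool)"

definition simple_graph :: "'a graph \<Rightarrow> bool" where
  "simple_graph G \<longleftrightarrow> finite (fst G) \<and>
     (\<forall>u v. snd G u v \<longrightarrow> u \<in> fst G \<and> v \<in> fst G \<and> u \<noteq> v \<and> snd G v u)"

definition gdegree :: "'a graph \<Rightarrow> 'a \<Rightarrow> nat" where
  "gdegree G v = card {u \<in> fst G. snd G v u}"

definition connected_graph :: "'a graph \<Rightarrow> bool" where
  "connected_graph G \<longleftrightarrow> fst G \<noteq> {} \<and>
     (\<forall>u\<in>fst G. \<forall>v\<in>fst G. (snd G)\<^sup>*\<^sup>* u v)"

definition has_cycle :: "'a graph \<Rightarrow> bool" where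
  "has_cycle G \<longleftrightarrow> (\<exists>vs. length vs \<ge> 3 \<and> distinct vs \<and> set vs \<subseteq> fst G \<and>
     (\<forall>i. Suc i < length vs \<longrightarrow> snd G (vs ! i) (vs ! Suc i)) \<and>
     snd G (last vs) (hd vs))"

definition is_tree :: "'a graph \<Rightarrow> bool" where
  "is_tree G \<longleftrightarrow> simple_graph G \<and> connected_graph G \<and> \<not> has_cycle G"

definition leaves :: "'a graph \<Rightarrow> nat" where
  "leaves G = card {v \<in> fst G. gdegree G v = 1}"

definition complete_graph :: "nat \<Rightarrow> nat graph" where
  "complete_graph s = ({..<s}, \<lambda>i j. i < s \<and> j < s \<and> i \<noteq> j)"

definition contains_subgraph :: "'b graph \<Rightarrow> 'a graph \<Rightarrow> bool" where
  "contains_subgraph G H \<longleftrightarrow> (\<exists>f. inj_on f (fst H) \<and> f ` fst H \<subseteq> fst G \<and>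
     (\<forall>u\<in>fst H. \<forall>v\<in>fst H. snd H u v \<longrightarrow> snd G (f u) (f v)))"

definition realization :: "(nat \<Rightarrow> nat \<Rightarrow> bool) \<Rightarrow> nat list \<Rightarrow> bool" where
  "realization E d \<longleftrightarrow> simple_graph ({..<length d}, E) \<and>
     (\<forall>i<length d. gdegree ({..<length d}, E) i = d ! i)"

definition graphic :: "nat list \<Rightarrow> bool" where
  "graphic d \<longleftrightarrow> sorted (rev d) \<and> (\<exists>E. realization E d)"

definition potentially_graphic :: "'a graph \<Rightarrow> nat list \<Rightarrow> bool" where
  "potentially_graphic H d \<longleftrightarrow> graphic d \<and>
     (\<exists>E. realization E d \<and> contains_subgraph ({..<length d}, E) H)"

definition complementary_seq :: "nat list \<Rightarrow> nat list" where
  "complementary_seq d = rev (map (\<lambda>x. length d - 1 - x) d)"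

definition r_pot :: "'a graph \<Rightarrow> 'b graph \<Rightarrow> nat" where
  "r_pot H1 H2 = (LEAST N. \<forall>d. length d = N \<and> graphic d \<longrightarrow>
      potentially_graphic H1 d \<or> potentially_graphic H2 (complementary_seq d))"

end

theory Submission imports Defs
begin

text \<open>
  Write \<open>\<ell>\<close> for the number of leaves. The lower bound comes from the join of a complete graph on at
  most \<open>s - 2\<close> vertices with an independent set. For the upper bound let \<open>G\<close> realize \<open>\<pi>\<close> and suppose that
  no graph with the degrees of \<open>G\<close> contains \<open>K\<^sub>s\<close>. The key fact is that then at most \<open>2s - 1\<close> vertices have
  degree at least \<open>s - 1\<close>. The other vertices are called low; they have degree at least \<open>t - 1\<close> in the
  complement, so that once the non-leaves of \<open>T\<close> are placed, those with a leaf neighbour on low vertices,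
  the leaves can be added greedily.

  By laying off vertices of minimum degree to the vertices of highest degree, any forest on \<open>t - s - 1\<close>
  vertices embeds into the complement on low vertices only. If \<open>\<ell> \<ge> s + 1\<close> this covers all non-leaves; if
  \<open>s - 2 \<le> \<ell> \<le> s\<close> at most three vertices of degree two remain, and these can be placed by counting.
  If \<open>\<ell> \<le> s - 3\<close> and \<open>t > 7(s - 2)\<close>, induction on \<open>s\<close> bounds the maximum degree by \<open>2s - 3\<close> whenever there
  are too many high vertices; an independent set of vertices of degree two is placed on high vertices, the
  remaining non-leaves on low ones, and conflicting edges are removed by swaps as in the Sauer--Spencer
  packing theorem.
\<close>

section \<open>Graphs with the same degrees\<close>

text \<open>Write \<open>N = t + s - 2\<close>. A low vertex has degree at most
  \<open>s - 2\<close>, hence at least \<open>N - 1 - (s - 2) = t - 1\<close> in the complement,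
  enough to attach a leaf whatever else is occupied. The key fact leaves at least
  \<open>N - (2s - 1) = t - s - 1\<close> low vertices, which explains the size of the forests
  handled and the condition of \<open>s + 1\<close> leaves. The obstacle in the key fact: a clique
  of order \<open>s - 1\<close> found after deleting a vertex \<open>v\<close> of maximum degree
  need not be movable into the neighbourhood of \<open>v\<close>. Failure means that many vertices
  share a degree \<open>c\<close>, and for such flat sequences an extremal choice yields the clique
  directly. The same analysis gives the bound \<open>2s - 3\<close>: if the maximum degree is at
  least \<open>2(s - 1)\<close>, failure would produce \<open>2s\<close> vertices of degree at least
  \<open>s - 1\<close>, against the key fact. With \<open>k = s - 2\<close> there are at least
  \<open>t - k - 3\<close> low vertices, and a swap has at most \<open>4k + l\<close> bad targets,
  where \<open>l\<close>, the number of leaves, is at most \<open>k - 1\<close>; the condition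
  \<open>t > 7k\<close> makes the first number the larger one.\<close>

definition nb :: "('v \<Rightarrow> 'v \<Rightarrow> bool) \<Rightarrow> 'v \<Rightarrow> 'v set" where
  "nb E v = {u. E v u}"

definition dg :: "('v \<Rightarrow> 'v \<Rightarrow> bool) \<Rightarrow> 'v \<Rightarrow> nat" where
  "dg E v = card (nb E v)"

definition same_deg :: "'v set \<Rightarrow> ('v \<Rightarrow> 'v \<Rightarrow> bool) \<Rightarrow> ('v \<Rightarrow> 'v \<Rightarrow> bool) \<Rightarrow> bool" where
  "same_deg V E E' \<longleftrightarrow> simple_graph (V, E') \<and> (\<forall>v\<in>V. dg E' v = dg E v)"

definition ins :: "('v \<Rightarrow> 'v \<Rightarrow> bool) \<Rightarrow> 'v \<Rightarrow> 'v \<Rightarrow> 'v \<Rightarrow> 'v \<Rightarrow> bool" where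
  "ins E a b = (\<lambda>u v. E u v \<or> (u = a \<and> v = b) \<or> (u = b \<and> v = a))"

definition del :: "('v \<Rightarrow> 'v \<Rightarrow> bool) \<Rightarrow> 'v \<Rightarrow> 'v \<Rightarrow> 'v \<Rightarrow> 'v \<Rightarrow> bool" where
  "del E a b = (\<lambda>u v. E u v \<and> \<not> (u = a \<and> v = b) \<and> \<not> (u = b \<and> v = a))"

lemma in_nb [simp]: "u \<in> nb E v \<longleftrightarrow> E v u"
  by (simp add: nb_def)

lemma simple_finite: "simple_graph (V, E) \<Longrightarrow> finite V"
  by (simp add: simple_graph_def)

lemma simple_sym: "simple_graph (V, E) \<Longrightarrow> E u v \<Longrightarrow> E v u"
  unfolding simple_graph_def fst_conv snd_conv by blast

lemma simple_irrefl: "simple_graph (V, E) \<Longrightarrow> \<not> E u u"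
  unfolding simple_graph_def fst_conv snd_conv by blast

lemma simple_in1: "simple_graph (V, E) \<Longrightarrow> E u v \<Longrightarrow> u \<in> V"
  unfolding simple_graph_def fst_conv snd_conv by blast

lemma simple_in2: "simple_graph (V, E) \<Longrightarrow> E u v \<Longrightarrow> v \<in> V"
  unfolding simple_graph_def fst_conv snd_conv by blast

lemma simpleI:
  "finite V \<Longrightarrow> (\<And>u v. E u v \<Longrightarrow> u \<in> V \<and> v \<in> V \<and> u \<noteq> v \<and> E v u) \<Longrightarrow> simple_graph (V, E)"
  by (simp add: simple_graph_def)

lemma nb_sub: "simple_graph (V, E) \<Longrightarrow> nb E v \<subseteq> V - {v}"
  using simple_in2 simple_irrefl by fastforce

lemma finite_nb: "simple_graph (V, E) \<Longrightarrow> finite (nb E v)"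
  using nb_sub simple_finite finite_subset by (metis finite_Diff)

lemma dg_bound: assumes "simple_graph (V, E)" "v \<in> V" shows "dg E v < card V"
proof -
  have "card (nb E v) \<le> card (V - {v})"
    using nb_sub[OF assms(1)] simple_finite[OF assms(1)] by (simp add: card_mono)
  also have "\<dots> < card V"
    using assms simple_finite[OF assms(1)] by (rule_tac card_Diff1_less) auto
  finally show ?thesis by (simp add: dg_def)
qed

lemma gdegree_dg: "simple_graph (V, E) \<Longrightarrow> gdegree (V, E) v = dg E v"
  unfolding gdegree_def dg_def nb_def by (rule arg_cong[where f = card]) (auto dest: simple_in2)

lemma same_deg_refl: "simple_graph (V, E) \<Longrightarrow> same_deg V E E"
  by (simp add: same_deg_def)

lemma same_deg_trans: "same_deg V E E1 \<Longrightarrow> same_deg V E1 E2 \<Longrightarrow> same_deg V E E2"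
  by (simp add: same_deg_def)

lemma same_deg_simple: "same_deg V E E1 \<Longrightarrow> simple_graph (V, E1)"
  by (simp add: same_deg_def)

lemma same_deg_dg: "same_deg V E E1 \<Longrightarrow> v \<in> V \<Longrightarrow> dg E1 v = dg E v"
  by (simp add: same_deg_def)

lemma simple_ins: "simple_graph (V, E) \<Longrightarrow> a \<in> V \<Longrightarrow> b \<in> V \<Longrightarrow> a \<noteq> b \<Longrightarrow> simple_graph (V, ins E a b)"
  unfolding simple_graph_def ins_def fst_conv snd_conv by blast

lemma simple_del: "simple_graph (V, E) \<Longrightarrow> simple_graph (V, del E a b)"
  unfolding simple_graph_def del_def fst_conv snd_conv by blast

lemma dg_ins:
  assumes "simple_graph (V, E)" "\<not> E a b" "a \<noteq> b"
  shows "dg (ins E a b) v = dg E v + (if v = a \<or> v = b then 1 else 0)"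
proof -
  have nba: "\<not> E b a" using assms simple_sym by fast
  have "nb (ins E a b) v = (if v = a then insert b (nb E v) else if v = b then insert a (nb E v) else nb E v)"
    using assms(3) by (auto simp: nb_def ins_def)
  then show ?thesis
    using assms nba finite_nb[OF assms(1)] by (auto simp: dg_def)
qed

lemma dg_del:
  assumes "simple_graph (V, E)" "E a b"
  shows "dg E v = dg (del E a b) v + (if v = a \<or> v = b then 1 else 0)"
proof -
  have ab: "a \<noteq> b" using assms simple_irrefl by fast
  have E: "ins (del E a b) a b = E"
    using assms simple_sym[OF assms(1)] by (auto simp: ins_def del_def fun_eq_iff)
  have "\<not> del E a b a b" by (simp add: del_def)
  from dg_ins[OF simple_del[OF assms(1)] this ab, of v] show ?thesis by (simp add: E)
qed

section \<open>Two-switches and laying off a vertex\<close>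

definition switch where
  "switch E a b c d = ins (ins (del (del E a b) c d) a c) b d"

lemma switch_same_deg:
  assumes s: "simple_graph (V, E)" and e: "E a b" "E c d" "\<not> E a c" "\<not> E b d" "a \<noteq> c" "b \<noteq> d"
  shows "same_deg V E (switch E a b c d)"
proof -
  have ne: "a \<noteq> b" "c \<noteq> d" "a \<noteq> d" "b \<noteq> c" 
    using s e simple_irrefl simple_sym by fast+
  have V: "a \<in> V" "b \<in> V" "c \<in> V" "d \<in> V"
    using s e simple_in1 simple_in2 by fast+
  let ?E1 = "del E a b" and ?E2 = "del (del E a b) c d" and ?E3 = "ins (del (del E a b) c d) a c"
  have s1: "simple_graph (V, ?E1)" and s2: "simple_graph (V, ?E2)" and s3: "simple_graph (V, ?E3)"
    using s V e by (auto intro!: simple_del simple_ins)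
  have s4: "simple_graph (V, switch E a b c d)"
    unfolding switch_def using s3 V e by (auto intro: simple_ins)
  have "?E1 c d" using e ne by (auto simp: del_def)
  moreover have "\<not> ?E2 a c" using e by (auto simp: del_def)
  moreover have "\<not> ?E3 b d" using e ne by (auto simp: del_def ins_def)
  ultimately have "dg (switch E a b c d) v = dg E v" for v
    unfolding switch_def
    using dg_ins[OF s3 _ e(6), of v] dg_ins[OF s2 _ e(5), of v] dg_del[OF s1, of c d v] dg_del[OF s e(1), of v] ne e
    by (auto split: if_splits)
  then show ?thesis using s4 by (simp add: same_deg_def)
qed

lemma ex_top_subset:
  fixes g :: "'v \<Rightarrow> nat"
  assumes "finite X" "n \<le> card X"
  shows "\<exists>S\<subseteq>X. card S = n \<and> (\<forall>x\<in>S. \<forall>y\<in>X-S. g y \<le> g x)"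
  using assms(2)
proof (induction n)
  case 0 then show ?case by (intro exI[of _ "{}"]) auto
next
  case (Suc n)
  then obtain S where S: "S \<subseteq> X" "card S = n" "\<forall>x\<in>S. \<forall>y\<in>X-S. g y \<le> g x" by auto
  have fin: "finite (X - S)" "finite S" using assms S finite_subset by auto
  have "card (X - S) > 0" using S(1,2) Suc.prems fin by (simp add: card_Diff_subset)
  then have "X - S \<noteq> {}" by fastforce
  then have "Max (g ` (X - S)) \<in> g ` (X - S)" using Max_in[of "g ` (X - S)"] fin by blast
  then obtain x where x: "x \<in> X - S" "g x = Max (g ` (X - S))" by auto
  then have "\<forall>y\<in>X-S. g y \<le> g x" using fin by simp
  then show ?case using S x fin by (intro exI[of _ "insert x S"]) auto
qed

text \<open>The Havel--Hakimi theorem for an arbitrary vertex.\<close>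

lemma lay_off:
  assumes "simple_graph (V, E)" "w \<in> V" "S \<subseteq> V - {w}" "card S = dg E w"
    and top: "\<forall>x\<in>S. \<forall>y\<in>V-{w}-S. dg E y \<le> dg E x"
  shows "\<exists>E'. same_deg V E E' \<and> nb E' w = S"
  using assms(1,4) top
proof (induction "card (S - nb E w)" arbitrary: E rule: less_induct)
  case less
  have finS: "finite S" using assms(3) simple_finite[OF assms(1)] finite_subset by blast
  have finn: "\<And>x. finite (nb E x)" using finite_nb less.prems(1) by fast
  show ?case
  proof (cases "S - nb E w = {}")
    case True
    then have "nb E w = S" using less.prems(2) finn by (metis Diff_eq_empty_iff card_subset_eq dg_def)
    then show ?thesis using same_deg_refl less.prems(1) by blast
  next
    case False
    then obtain x where x: "x \<in> S" "\<not> E w x" unfolding nb_def by blast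
    have "nb E w - S \<noteq> {}"
    proof
      assume "nb E w - S = {}"
      then have "nb E w \<subseteq> S" by blast
      then have "nb E w = S" using finS less.prems(2) by (simp add: card_subset_eq dg_def)
      then show False using x unfolding nb_def by blast
    qed
    then obtain y where y: "E w y" "y \<notin> S" unfolding nb_def by blast
    have yV: "y \<in> V" "y \<noteq> w" using y less.prems(1) simple_in2 simple_irrefl by fast+
    have xw: "x \<noteq> w" using x assms(3) by auto
    have le: "dg E y \<le> dg E x" using less.prems(3) x y yV by auto
    \<comment> \<open>\<open>w\<close> is a neighbour of \<open>y\<close> but not of
      \<open>x\<close>, and the degree of \<open>x\<close> is no smaller. So \<open>x\<close> has a
      neighbour \<open>z\<close> that \<open>y\<close> lacks, and switching \<open>w y\<close>,
      \<open>x z\<close> into \<open>w x\<close>, \<open>y z\<close> brings \<open>x\<close> into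
      the neighbourhood of \<open>w\<close>.\<close>
    have "\<not> nb E x - {y} \<subseteq> nb E y - {x}"
    proof
      assume a: "nb E x - {y} \<subseteq> nb E y - {x}"
      have w: "w \<in> nb E y - {x}" "w \<notin> nb E x - {y}" using y x less.prems(1) simple_sym xw by fastforce+
      have "card (nb E x - {y}) < card (nb E y - {x})"
        using a w finn by (metis psubsetI psubset_card_mono finite_Diff)
      moreover have "(y \<in> nb E x) = (x \<in> nb E y)" using less.prems(1) simple_sym by fastforce
      ultimately show False using le finn by (simp add: dg_def card_Diff_singleton_if split: if_splits)
    qed
    then obtain z where z: "E x z" "z \<noteq> y" "\<not> E y z \<or> z = x" unfolding nb_def by blast
    have zx: "z \<noteq> x" using z simple_irrefl less.prems(1) by fast
    have zw: "z \<noteq> w" using z x simple_sym less.prems(1) by fast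
    let ?E = "switch E w y x z"
    have sd: "same_deg V E ?E"
      by (rule switch_same_deg) (use less.prems z x y zx xw in auto)
    have nbw: "nb ?E w = insert x (nb E w - {y})"
      using xw zw yV y zx x by (auto simp: switch_def ins_def del_def nb_def)
    have "S - nb ?E w \<subset> S - nb E w" using nbw x y by auto
    then have "card (S - nb ?E w) < card (S - nb E w)" using finS by (simp add: psubset_card_mono)
    moreover have "card S = dg ?E w" using same_deg_dg[OF sd assms(2)] less.prems by simp
    moreover have "\<forall>x\<in>S. \<forall>y\<in>V-{w}-S. dg ?E y \<le> dg ?E x"
      using same_deg_dg[OF sd] less.prems(3) assms(3) by (metis Diff_iff subsetD)
    ultimately obtain E' where "same_deg V ?E E'" "nb E' w = S"
      using less.hyps same_deg_simple[OF sd] by blast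
    then show ?thesis using same_deg_trans[OF sd] by blast
  qed
qed

section \<open>Exchanging private neighbours and relocating embedded patterns\<close>

lemma exchange_neighbours:
  assumes s: "simple_graph (V, E)" and ij: "i \<in> V" "j \<in> V" "i \<noteq> j"
    and D: "D \<subseteq> nb E i - nb E j - {j}" and D0: "D0 \<subseteq> nb E j - nb E i - {i}" and c: "card D = card D0"
  obtains E' where "same_deg V E E'" "nb E' i = (nb E i - D) \<union> D0" "nb E' j = (nb E j - D0) \<union> D"
    "\<And>u v. u \<notin> {i,j} \<Longrightarrow> v \<notin> {i,j} \<Longrightarrow> E' u v = E u v"
proof -
  define X where "X = D \<union> D0"
  have X: "i \<notin> X" "j \<notin> X" "X \<subseteq> V" using D D0 nb_sub[OF s, of i] nb_sub[OF s, of j] unfolding X_def by blast+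
  have sym: "\<And>u v. E u v = E v u" using s simple_sym by fast
  \<comment> \<open>The roles of \<open>i\<close> and \<open>j\<close> are transposed in the
    adjacencies of the vertices of \<open>X\<close> only. Each of these has exactly one of
    \<open>i\<close>, \<open>j\<close> as a neighbour and keeps its degree; \<open>i\<close> and
    \<open>j\<close> trade equal numbers.\<close>
  define E' where "E' = (\<lambda>u v. if u \<in> X \<and> v = i then E u j else if u \<in> X \<and> v = j then E u i
     else if v \<in> X \<and> u = i then E j v else if v \<in> X \<and> u = j then E i v else E u v)"
  have s': "simple_graph (V, E')"
    unfolding simple_graph_def fst_conv snd_conv
  proof (intro conjI allI impI)
    show "finite V" using s simple_finite by blast
    fix u v assume e: "E' u v"
    show "u \<in> V" using e X ij simple_in1[OF s] by (auto simp: E'_def split: if_splits)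
    show "v \<in> V" using e X ij simple_in2[OF s] by (auto simp: E'_def split: if_splits)
    show "u \<noteq> v" using e X ij simple_irrefl[OF s] by (auto simp: E'_def split: if_splits)
    show "E' v u" using e X ij sym by (auto simp: E'_def split: if_splits)
  qed
  have i: "nb E' i = (nb E i - D) \<union> D0"
    using X D D0 ij sym by (auto simp: E'_def nb_def X_def)
  have j: "nb E' j = (nb E j - D0) \<union> D"
    using X D D0 ij sym by (auto simp: E'_def nb_def X_def)
  have off: "E' u v = E u v" if "u \<notin> {i,j}" "v \<notin> {i,j}" for u v
    using that by (auto simp: E'_def)
  have fin: "finite (nb E x)" for x using s finite_nb by fast
  have fD: "finite D" "finite D0" using D D0 fin finite_subset by (metis Diff_subset subset_trans)+
  have dD: "D \<inter> D0 = {}" using D D0 by auto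
  have di: "dg E' i = dg E i"
  proof -
    have "card ((nb E i - D) \<union> D0) = card (nb E i - D) + card D0"
      using D D0 fin fD by (intro card_Un_disjoint) auto
    moreover have "card (nb E i - D) = card (nb E i) - card D"
      using D fD by (intro card_Diff_subset) auto
    moreover have "card D \<le> card (nb E i)" using D fin by (intro card_mono) auto
    ultimately show ?thesis using c i unfolding dg_def by simp
  qed
  have dj: "dg E' j = dg E j"
  proof -
    have "card ((nb E j - D0) \<union> D) = card (nb E j - D0) + card D"
      using D D0 fin fD by (intro card_Un_disjoint) auto
    moreover have "card (nb E j - D0) = card (nb E j) - card D0"
      using D0 fD by (intro card_Diff_subset) auto
    moreover have "card D0 \<le> card (nb E j)" using D0 fin by (intro card_mono) auto
    ultimately show ?thesis using c j unfolding dg_def by simp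
  qed
  have "dg E' x = dg E x" if "x \<notin> {i,j}" for x
  proof (cases "x \<in> X")
    case False
    then have "nb E' x = nb E x" using that by (auto simp: nb_def E'_def)
    then show ?thesis by (simp add: dg_def)
  next
    case True
    define \<sigma> where "\<sigma> = (\<lambda>u. if u = i then j else if u = j then i else u)"
    have \<sigma>\<sigma>: "\<sigma> (\<sigma> u) = u" for u using ij(3) by (simp add: \<sigma>_def)
    have "nb E' x = \<sigma> ` nb E x"
    proof (rule set_eqI)
      fix u
      have "(u \<in> \<sigma> ` nb E x) = (\<sigma> u \<in> nb E x)"
        using \<sigma>\<sigma> by (metis imageE imageI)
      also have "\<dots> = (u \<in> nb E' x)" using True that ij(3) by (auto simp: nb_def E'_def \<sigma>_def)
      finally show "(u \<in> nb E' x) = (u \<in> \<sigma> ` nb E x)" by simp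
    qed
    moreover have "inj_on \<sigma> (nb E x)" using ij(3) by (auto simp: inj_on_def \<sigma>_def split: if_splits)
    ultimately show ?thesis by (simp add: dg_def card_image)
  qed
  then have "dg E' x = dg E x" for x using di dj by (cases "x \<in> {i,j}") auto
  then have "same_deg V E E'" using s' by (auto simp: same_deg_def)
  then show ?thesis using i j off that by blast
qed

lemma private_neighbours_le:
  assumes s: "simple_graph (V, E)" and "dg E i \<le> dg E j"
  shows "card (nb E i - nb E j - {j}) \<le> card (nb E j - nb E i - {i})"
proof -
  have fin: "finite (nb E x)" for x using s finite_nb by fast
  have sym: "(j \<in> nb E i) = (i \<in> nb E j)" using s simple_sym by fastforce
  have irr: "i \<notin> nb E i" "j \<notin> nb E j" using simple_irrefl[OF s] by auto
  have "nb E i = (nb E i - nb E j - {j}) \<union> (nb E i \<inter> nb E j) \<union> (if E i j then {j} else {})" by auto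
  moreover have "card \<dots> = card (nb E i - nb E j - {j}) + card (nb E i \<inter> nb E j) + (if E i j then 1 else 0)"
    using fin irr by (subst card_Un_disjoint; auto)+
  moreover have "nb E j = (nb E j - nb E i - {i}) \<union> (nb E i \<inter> nb E j) \<union> (if E i j then {i} else {})" using sym by auto
  moreover have "card \<dots> = card (nb E j - nb E i - {i}) + card (nb E i \<inter> nb E j) + (if E i j then 1 else 0)"
    using fin irr by (subst card_Un_disjoint; auto)+
  ultimately show ?thesis using assms(2) by (simp add: dg_def)
qed

text \<open>For \<open>b = True\<close> the map \<open>f\<close> embeds the pattern \<open>Q\<close> into the graph, for \<open>b = False\<close> into its complement.\<close>

definition emb :: "bool \<Rightarrow> 'v set \<Rightarrow> ('v \<Rightarrow> 'v \<Rightarrow> bool) \<Rightarrow> 'a set \<Rightarrow> ('a \<Rightarrow> 'a \<Rightarrow> bool) \<Rightarrow> ('a \<Rightarrow> 'v) \<Rightarrow> bool" where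
  "emb b V E A Q f \<longleftrightarrow> inj_on f A \<and> f ` A \<subseteq> V \<and> (\<forall>x\<in>A. \<forall>y\<in>A. x \<noteq> y \<longrightarrow> Q x y \<longrightarrow> E (f x) (f y) = b)"

text \<open>\<open>j\<close> takes over the role of \<open>f a\<close>. For \<open>b = True\<close>
  it receives all private neighbours of \<open>f a\<close> in return for as many of its own; for
  \<open>b = False\<close> it hands its own private neighbours to \<open>f a\<close>, so that it
  inherits all non-neighbours. The degree comparison ensures that the partner has enough to
  trade.\<close>

lemma relocate1:
  assumes s: "simple_graph (V, E)" and e: "emb b V E A Q f" and a: "a \<in> A" and j: "j \<in> V" "j \<notin> f ` A"
    and le: "if b then dg E (f a) \<le> dg E j else dg E j \<le> dg E (f a)"
  obtains E' where "same_deg V E E'" "emb b V E' A Q (f(a := j))"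
proof -
  let ?i = "f a"
  have i: "?i \<in> V" "?i \<noteq> j" using e a j by (auto simp: emb_def)
  have fin: "finite (nb E x)" for x using s finite_nb by fast
  obtain E' where E': "same_deg V E E'" "\<And>u v. u \<notin> {?i,j} \<Longrightarrow> v \<notin> {?i,j} \<Longrightarrow> E' u v = E u v"
    and k: "\<And>u. u \<notin> {?i,j} \<Longrightarrow> E ?i u = b \<Longrightarrow> E' j u = b"
  proof (cases b)
    case True
    let ?D = "nb E ?i - nb E j - {j}"
    have "card ?D \<le> card (nb E j - nb E ?i - {?i})"
      using private_neighbours_le[OF s] le True by auto
    then obtain D0 where D0: "D0 \<subseteq> nb E j - nb E ?i - {?i}" "card D0 = card ?D"
      using obtain_subset_with_card_n by metis
    obtain E' where F: "same_deg V E E'" "nb E' j = (nb E j - D0) \<union> ?D"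
      "\<And>u v. u \<notin> {?i,j} \<Longrightarrow> v \<notin> {?i,j} \<Longrightarrow> E' u v = E u v"
      using exchange_neighbours[OF s i(1) j(1) i(2) order_refl D0(1)] D0(2) by metis
    from F(2) D0(1) have k: "E ?i u \<Longrightarrow> u \<notin> {?i,j} \<Longrightarrow> E' j u" for u
      unfolding nb_def by blast
    show ?thesis by (rule that[OF F(1,3)]) (use k True in auto)
  next
    case False
    let ?D = "nb E j - nb E ?i - {?i}"
    have "card ?D \<le> card (nb E ?i - nb E j - {j})"
      using private_neighbours_le[OF s] le False by auto
    then obtain D0 where D0: "D0 \<subseteq> nb E ?i - nb E j - {j}" "card D0 = card ?D"
      using obtain_subset_with_card_n by metis
    obtain E' where F: "same_deg V E E'" "nb E' j = (nb E j - ?D) \<union> D0"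
      "\<And>u v. u \<notin> {?i,j} \<Longrightarrow> v \<notin> {?i,j} \<Longrightarrow> E' u v = E u v"
      using exchange_neighbours[OF s i(1) j(1) i(2) D0(1) order_refl] D0(2) by metis
    from F(2) D0(1) have k: "\<not> E ?i u \<Longrightarrow> u \<notin> {?i,j} \<Longrightarrow> \<not> E' j u" for u
      unfolding nb_def by blast
    show ?thesis by (rule that[OF F(1,3)]) (use k False in auto)
  qed
  have s': "simple_graph (V, E')" using E'(1) same_deg_simple by blast
  have sym: "E u v = E v u" "E' u v = E' v u" for u v using s s' simple_sym by fast+
  have inj: "inj_on (f(a := j)) A" using e j by (auto simp: emb_def inj_on_def)
  have "emb b V E' A Q (f(a := j))"
    unfolding emb_def
  proof (intro conjI ballI impI)
    show "inj_on (f(a := j)) A" by (rule inj)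
    show "(f(a := j)) ` A \<subseteq> V" using e j by (auto simp: emb_def)
    fix x y assume xy: "x \<in> A" "y \<in> A" "x \<noteq> y" "Q x y"
    have E: "E (f x) (f y) = b" using e xy by (auto simp: emb_def)
    have ne: "f x \<noteq> f y" "f x \<noteq> j" "f y \<noteq> j" using e xy j by (auto simp: emb_def inj_on_def)
    consider "x = a" | "y = a" | "x \<noteq> a" "y \<noteq> a" by blast
    then show "E' ((f(a := j)) x) ((f(a := j)) y) = b"
    proof cases
      case 1 then show ?thesis using k[of "f y"] E ne xy by simp
    next
      case 2
      then have "E' j (f x) = b" using k[of "f x"] E ne sym xy by auto
      then show ?thesis using 2 xy sym by simp
    next
      case 3
      have "f x \<noteq> f a" "f y \<noteq> f a" using 3 xy a e by (auto simp: emb_def inj_on_def)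
      then show ?thesis using 3 E'(2)[of "f x" "f y"] ne E by simp
    qed
  qed
  then show ?thesis using E'(1) that by blast
qed

text \<open>\<open>S\<close> contains the desired positions and \<open>Z\<close> the tolerated ones.
  As \<open>card A \<le> card S\<close>, an image outside \<open>S\<close> implies a free vertex of
  \<open>S\<close>, and \<open>relocate1\<close> moves the image there.\<close>

lemma relocate:
  assumes "simple_graph (V, E)" "emb b V E A Q f" "finite A" "f ` A \<subseteq> S \<union> Z" "S \<union> Z \<subseteq> V" "card A \<le> card S"
    and "\<forall>y\<in>Z. \<forall>x\<in>S. if b then dg E y \<le> dg E x else dg E x \<le> dg E y"
  shows "\<exists>E' f'. same_deg V E E' \<and> emb b V E' A Q f' \<and> f' ` A \<subseteq> S"
  using assms(1,2,4,7)
proof (induction "card (f ` A - S)" arbitrary: E f rule: less_induct)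
  case less
  show ?case
  proof (cases "f ` A \<subseteq> S")
    case True then show ?thesis using same_deg_refl[OF less.prems(1)] less.prems(2) by blast
  next
    case False
    then obtain a where a: "a \<in> A" "f a \<notin> S" by auto
    have finS: "finite S" using assms(5) simple_finite[OF less.prems(1)] finite_subset by blast
    have "\<not> S \<subseteq> f ` A"
    proof
      assume "S \<subseteq> f ` A"
      then have "S \<subset> f ` A" using a by blast
      then have "card S < card (f ` A)" using assms(3) by (simp add: psubset_card_mono)
      then show False using assms(6) card_image_le[OF assms(3), of f] by simp
    qed
    then obtain j where j: "j \<in> S" "j \<notin> f ` A" by blast
    have "if b then dg E (f a) \<le> dg E j else dg E j \<le> dg E (f a)"
      using less.prems(3,4) a j by blast
    then obtain E' where E': "same_deg V E E'" "emb b V E' A Q (f(a := j))"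
      using relocate1[OF less.prems(1,2) a(1), of j] j assms(5) by blast
    have "(f(a := j)) ` A - S \<subset> f ` A - S"
    proof
      show "(f(a := j)) ` A - S \<subseteq> f ` A - S" using j by auto
      have "f a \<notin> (f(a := j)) ` A"
        using less.prems(2) a j by (auto simp: emb_def inj_on_def)
      then show "(f(a := j)) ` A - S \<noteq> f ` A - S" using a by blast
    qed
    then have "card ((f(a := j)) ` A - S) < card (f ` A - S)" using assms(3) by (simp add: psubset_card_mono)
    moreover have "(f(a := j)) ` A \<subseteq> S \<union> Z" using less.prems(3) j by auto
    moreover have "\<forall>y\<in>Z. \<forall>x\<in>S. if b then dg E' y \<le> dg E' x else dg E' x \<le> dg E' y"
    proof (intro ballI)
      fix x y assume "x \<in> S" "y \<in> Z"
      moreover from this have "x \<in> V" "y \<in> V" using assms(5) by auto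
      ultimately show "if b then dg E' y \<le> dg E' x else dg E' x \<le> dg E' y"
        using less.prems(4) same_deg_dg[OF E'(1)] by simp
    qed
    ultimately obtain E'' f' where "same_deg V E' E''" "emb b V E'' A Q f'" "f' ` A \<subseteq> S"
      using less.hyps[of "f(a := j)" E'] E' same_deg_simple by blast
    then show ?thesis using same_deg_trans[OF E'(1)] by blast
  qed
qed

section \<open>Deleting a vertex and putting it back\<close>

definition del_vertex :: "('v \<Rightarrow> 'v \<Rightarrow> bool) \<Rightarrow> 'v \<Rightarrow> 'v \<Rightarrow> 'v \<Rightarrow> bool" where
  "del_vertex E w = (\<lambda>u v. E u v \<and> u \<noteq> w \<and> v \<noteq> w)"

definition add_vertex :: "('v \<Rightarrow> 'v \<Rightarrow> bool) \<Rightarrow> 'v \<Rightarrow> 'v set \<Rightarrow> 'v \<Rightarrow> 'v \<Rightarrow> bool" where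
  "add_vertex E w S = (\<lambda>u v. E u v \<or> (u = w \<and> v \<in> S) \<or> (v = w \<and> u \<in> S))"

lemma simple_del_vertex:
  assumes s: "simple_graph (V, E)"
  shows "simple_graph (V - {w}, del_vertex E w)"
proof (rule simpleI)
  show "finite (V - {w})" using simple_finite[OF s] by simp
  fix u v assume "del_vertex E w u v"
  then have "E u v" "u \<noteq> w" "v \<noteq> w" by (auto simp: del_vertex_def)
  then show "u \<in> V - {w} \<and> v \<in> V - {w} \<and> u \<noteq> v \<and> del_vertex E w v u"
    using simple_in1[OF s, of u v] simple_in2[OF s, of u v] simple_irrefl[OF s, of u] simple_sym[OF s, of u v]
    by (auto simp: del_vertex_def)
qed

lemma dg_del_vertex:
  assumes s: "simple_graph (V, E)" and "x \<noteq> w"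
  shows "dg E x = dg (del_vertex E w) x + (if x \<in> nb E w then 1 else 0)"
proof -
  have sym: "(x \<in> nb E w) = (w \<in> nb E x)" using simple_sym[OF s] by auto
  have "nb (del_vertex E w) x = nb E x - {w}" using assms(2) by (auto simp: del_vertex_def nb_def)
  moreover have "card (nb E x) = Suc (card (nb E x - {w}))" if "w \<in> nb E x"
    using card.remove[OF finite_nb[OF s] that] by simp
  ultimately show ?thesis using sym by (cases "w \<in> nb E x") (simp_all add: dg_def del: in_nb)
qed

text \<open>Joining \<open>w\<close> to its old neighbourhood changes the degrees by the same
  amounts whichever graph stands on \<open>V - {w}\<close>. This is what lets inductions delete a
  vertex although the graph on the rest may be replaced.\<close>

lemma same_deg_add_vertex:
  assumes s: "simple_graph (V, E)" and w: "w \<in> V" and e: "same_deg (V - {w}) (del_vertex E w) E'"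
  shows "same_deg V E (add_vertex E' w (nb E w))"
proof -
  have s': "simple_graph (V - {w}, E')" using e same_deg_simple by blast
  let ?F = "add_vertex E' w (nb E w)"
  have wS: "w \<notin> nb E w" using simple_irrefl[OF s] by auto
  have nw: "nb E' w = {}" using simple_in1[OF s'] by (auto simp: nb_def)
  have nw2: "\<not> E' x w" for x using simple_in2[OF s'] by auto
  have "simple_graph (V, ?F)"
  proof (rule simpleI)
    show "finite V" using simple_finite[OF s] .
    fix u v assume "?F u v"
    then consider "E' u v" | "u = w" "E w v" | "v = w" "E w u" by (auto simp: add_vertex_def)
    then show "u \<in> V \<and> v \<in> V \<and> u \<noteq> v \<and> ?F v u"
    proof cases
      case 1
      then show ?thesis
        using simple_in1[OF s', of u v] simple_in2[OF s', of u v] simple_irrefl[OF s', of u] simple_sym[OF s', of u v]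
        by (auto simp: add_vertex_def)
    next
      case 2 then show ?thesis using w simple_in2[OF s, of w v] simple_irrefl[OF s, of w] by (auto simp: add_vertex_def)
    next
      case 3 then show ?thesis using w simple_in2[OF s, of w u] simple_irrefl[OF s, of w] by (auto simp: add_vertex_def)
    qed
  qed
  moreover have "dg ?F v = dg E v" if v: "v \<in> V" for v
  proof (cases "v = w")
    case True
    have "nb ?F w = nb E w" using nw wS by (auto simp: add_vertex_def nb_def)
    then show ?thesis using True by (simp add: dg_def)
  next
    case False
    have "nb ?F v = nb E' v \<union> (if v \<in> nb E w then {w} else {})"
      using False by (auto simp: add_vertex_def nb_def)
    then have "dg ?F v = dg E' v + (if v \<in> nb E w then 1 else 0)"
      using nw2[of v] finite_nb[OF s', of v] by (simp add: dg_def)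
    also have "\<dots> = dg E v"
      using same_deg_dg[OF e, of v] v False dg_del_vertex[OF s False] by simp
    finally show ?thesis .
  qed
  ultimately show ?thesis by (simp add: same_deg_def)
qed

section \<open>Cliques in graphs with given degrees\<close>

definition pot_clique :: "'v set \<Rightarrow> ('v \<Rightarrow> 'v \<Rightarrow> bool) \<Rightarrow> nat \<Rightarrow> bool" where
  "pot_clique V E s \<longleftrightarrow> (\<exists>E' K. same_deg V E E' \<and> K \<subseteq> V \<and> card K = s \<and> (\<forall>x\<in>K. \<forall>y\<in>K. x \<noteq> y \<longrightarrow> E' x y))"

lemma pot_clique_same_deg:
  assumes "same_deg V E E1" "pot_clique V E1 s"
  shows "pot_clique V E s"
proof -
  obtain E' K where "same_deg V E1 E'" "K \<subseteq> V" "card K = s" "\<forall>x\<in>K. \<forall>y\<in>K. x \<noteq> y \<longrightarrow> E' x y"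
    using assms(2) unfolding pot_clique_def by blast
  then show ?thesis using same_deg_trans[OF assms(1)] unfolding pot_clique_def by blast
qed

lemma pot_clique_del_vertex:
  assumes s: "simple_graph (V, E)" and w: "w \<in> V" and p: "pot_clique (V - {w}) (del_vertex E w) m"
  shows "pot_clique V E m"
proof -
  obtain E' K where K: "same_deg (V - {w}) (del_vertex E w) E'" "K \<subseteq> V - {w}" "card K = m"
    "\<forall>x\<in>K. \<forall>y\<in>K. x \<noteq> y \<longrightarrow> E' x y" using p unfolding pot_clique_def by blast
  have "\<forall>x\<in>K. \<forall>y\<in>K. x \<noteq> y \<longrightarrow> add_vertex E' w (nb E w) x y" using K(4) by (simp add: add_vertex_def)
  then show ?thesis unfolding pot_clique_def using same_deg_add_vertex[OF s w K(1)] K(2,3) by blast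
qed

lemma pot_clique_add_apex:
  assumes s: "simple_graph (V, E)" and v: "v \<in> V" and e: "same_deg (V - {v}) (del_vertex E v) E'"
    and K: "K \<subseteq> nb E v" "\<forall>x\<in>K. \<forall>y\<in>K. x \<noteq> y \<longrightarrow> E' x y"
  shows "pot_clique V E (Suc (card K))"
proof -
  have "finite K" using K(1) finite_nb[OF s] finite_subset by blast
  moreover have KV: "K \<subseteq> V - {v}" using K(1) nb_sub[OF s] by blast
  ultimately have "card (insert v K) = Suc (card K)" by (auto simp: card_insert_if)
  moreover have "insert v K \<subseteq> V" using KV v by blast
  moreover have "\<forall>x\<in>insert v K. \<forall>y\<in>insert v K. x \<noteq> y \<longrightarrow> add_vertex E' v (nb E v) x y"
    using K by (auto simp: add_vertex_def)
  ultimately show ?thesis unfolding pot_clique_def using same_deg_add_vertex[OF s v e] by blast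
qed

text \<open>A clique found after deleting a vertex of maximum degree, laid off to the top, can be moved
  into the neighbourhood of that vertex, unless many vertices share the degree \<open>c\<close>.\<close>

lemma extend_clique:
  assumes s: "simple_graph (V, E)" and v: "v \<in> V" and mx: "\<forall>x\<in>V. dg E x \<le> dg E v"
    and top: "\<forall>x\<in>nb E v. \<forall>y\<in>V-{v}-nb E v. dg E y \<le> dg E x"
    and p: "pot_clique (V - {v}) (del_vertex E v) m"
  shows "pot_clique V E (Suc m) \<or>
    (\<exists>c. card {x\<in>V. c < dg E x} \<le> m \<and> dg E v + 2 \<le> card {x\<in>V. c \<le> dg E x})"
proof -
  define S where "S = nb E v"
  define U where "U = V - {v} - S"
  have finV: "finite V" using s simple_finite by blast
  have SV: "S \<subseteq> V - {v}" using nb_sub[OF s] by (simp add: S_def)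
  have finS: "finite S" "finite U" using SV finV finite_subset unfolding U_def by auto
  obtain E' K where K: "same_deg (V - {v}) (del_vertex E v) E'" "K \<subseteq> V - {v}" "card K = m"
    "\<forall>x\<in>K. \<forall>y\<in>K. x \<noteq> y \<longrightarrow> E' x y" using p unfolding pot_clique_def by blast
  show ?thesis
  proof (cases "U = {}")
    case True
    then have "K \<subseteq> nb E v" using K(2) by (auto simp: U_def S_def simp del: in_nb)
    then show ?thesis using pot_clique_add_apex[OF s v K(1) _ K(4)] K(3) by blast
  next
    case False
    \<comment> \<open>\<open>c\<close> is the largest degree among the non-neighbours of
      \<open>v\<close>. After the deletion of \<open>v\<close> the members of \<open>S0\<close> have
      degree at least \<open>c\<close> and all others at most \<open>c\<close>, so a clique of order
      \<open>m\<close> can be relocated into \<open>S0\<close> if that is large enough.\<close>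
    define c where "c = Max (dg E ` U)"
    have "c \<in> dg E ` U" unfolding c_def using False finS by (intro Max_in) auto
    then obtain u where u: "u \<in> U" "dg E u = c" by auto
    have cU: "dg E y \<le> c" if "y \<in> U" for y using that finS unfolding c_def by simp
    define S0 where "S0 = {x\<in>S. c < dg E x}"
    have d1: "dg E x = Suc (dg (del_vertex E v) x)" if "x \<in> S" for x
      using dg_del_vertex[OF s, of x v] that SV by (auto simp: S_def simp del: in_nb)
    have d2: "dg E x = dg (del_vertex E v) x" if "x \<in> U" for x
      using dg_del_vertex[OF s, of x v] that by (auto simp: U_def S_def simp del: in_nb)
    show ?thesis
    proof (cases "m \<le> card S0")
      case True
      have e: "emb True (V - {v}) E' K (\<noteq>) id" using K by (auto simp: emb_def)
      have finK: "finite K" using K(2) finV finite_subset by blast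
      have "\<exists>E3 f. same_deg (V - {v}) E' E3 \<and> emb True (V - {v}) E3 K (\<noteq>) f \<and> f ` K \<subseteq> S0"
      proof (rule relocate[where Z = "V - {v} - S0", OF same_deg_simple[OF K(1)] e finK])
        show "id ` K \<subseteq> S0 \<union> (V - {v} - S0)" using K(2) by auto
        show "S0 \<union> (V - {v} - S0) \<subseteq> V - {v}" using SV by (auto simp: S0_def)
        show "card K \<le> card S0" using True K(3) by simp
        have "dg E' y \<le> dg E' x" if "x \<in> S0" "y \<in> V - {v} - S0" for x y
        proof -
          have "x \<in> S" using that by (simp add: S0_def)
          moreover have "x \<in> V - {v}" "c < dg E x" using that(1) SV by (auto simp: S0_def)
          ultimately have "c \<le> dg E' x" using d1[of x] same_deg_dg[OF K(1), of x] by simp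
          moreover have "dg E' y \<le> c"
          proof (cases "y \<in> S")
            case True
            then have "dg E y \<le> c" using that by (auto simp: S0_def)
            then show ?thesis using d1[OF True] same_deg_dg[OF K(1), of y] that(2) by simp
          next
            case False
            then have "y \<in> U" using that by (auto simp: U_def)
            then show ?thesis using d2[of y] cU[of y] same_deg_dg[OF K(1), of y] that(2) by simp
          qed
          ultimately show ?thesis by simp
        qed
        then show "\<forall>y\<in>V - {v} - S0. \<forall>x\<in>S0. if True then dg E' y \<le> dg E' x else dg E' x \<le> dg E' y" by simp
      qed
      then obtain E3 f where E3: "same_deg (V - {v}) E' E3" "emb True (V - {v}) E3 K (\<noteq>) f" "f ` K \<subseteq> S0" by blast
      have "f ` K \<subseteq> nb E v" using E3(3) by (auto simp: S0_def S_def)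
      moreover have "\<forall>x\<in>f ` K. \<forall>y\<in>f ` K. x \<noteq> y \<longrightarrow> E3 x y" using E3(2) by (auto simp: emb_def)
      moreover have "card (f ` K) = m" using E3(2) K(3) by (simp add: emb_def card_image)
      ultimately show ?thesis using pot_clique_add_apex[OF s v same_deg_trans[OF K(1) E3(1)]] by metis
    next
      case False
      \<comment> \<open>Now \<open>S0\<close> has fewer than \<open>m\<close> members, while
        \<open>v\<close>, its neighbours and the non-neighbour \<open>u\<close> all have degree at
        least \<open>c\<close>: these are \<open>dg E v + 2\<close> vertices.\<close>
      have "{x\<in>V. c < dg E x} \<subseteq> insert v S0"
        using cU by (fastforce simp: U_def S0_def)
      then have "card {x\<in>V. c < dg E x} \<le> card (insert v S0)"
        using finS by (intro card_mono) (auto simp: S0_def)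
      also have "\<dots> \<le> Suc (card S0)" using finS by (simp add: S0_def card_insert_if)
      finally have 1: "card {x\<in>V. c < dg E x} \<le> m" using False by simp
      have "insert v (insert u S) \<subseteq> {x\<in>V. c \<le> dg E x}"
        using u v mx top SV by (auto simp: U_def S_def simp del: in_nb)
      then have "card (insert v (insert u S)) \<le> card {x\<in>V. c \<le> dg E x}"
        using finV by (intro card_mono) auto
      moreover have "card (insert v (insert u S)) = dg E v + 2"
        using u SV finS by (auto simp: U_def card_insert_if dg_def S_def simp del: in_nb)
      ultimately show ?thesis using 1 by auto
    qed
  qed
qed

section \<open>Degree sequences with many equal degrees\<close>

lemma nb_subset_dg_le:
  assumes s: "simple_graph (V, F)" and "nb F i - {j} \<subseteq> nb F j"
  shows "dg F i \<le> dg F j"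
proof -
  have fin: "finite (nb F x)" for x using s finite_nb by fast
  have "nb F i - {j} \<subseteq> nb F j - {i}" using assms(2) simple_irrefl[OF s, of i] by auto
  then have "card (nb F i - {j}) \<le> card (nb F j - {i})" using fin by (intro card_mono) auto
  moreover have "(j \<in> nb F i) = (i \<in> nb F j)" using simple_sym[OF s] by auto
  ultimately show ?thesis 
    using card_Suc_Diff1[OF fin, of j i] card_Suc_Diff1[OF fin, of i j] 
    by (cases "j \<in> nb F i") (simp_all add: dg_def del: in_nb)
qed

lemma double_count:
  assumes "simple_graph (V, F)" "finite A" "finite B"
  shows "(\<Sum>r\<in>A. card (nb F r \<inter> B)) = (\<Sum>p\<in>B. card (nb F p \<inter> A))"
proof -
  have c: "card (nb F r \<inter> X) = (\<Sum>p\<in>X. if F r p then 1 else 0)" if "finite X" for r X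
    using that by (simp add: sum.If_cases nb_def Int_commute Collect_conj_eq)
  have "F r p = F p r" for r p using assms(1) simple_sym by fast
  then show ?thesis using assms(2,3) by (simp add: c sum.swap[of _ A B])
qed

lemma move_edge:
  assumes s: "simple_graph (V, F)" and e: "F i n" "\<not> F k n" "k \<noteq> n" "k \<noteq> i" and k: "k \<in> V"
  shows "simple_graph (V, ins (del F i n) k n)"
    and "dg (ins (del F i n) k n) r + (if r = i then 1 else 0) = dg F r + (if r = k then 1 else 0)"
proof -
  have n: "n \<in> V" "n \<noteq> i" using simple_in2[OF s e(1)] simple_irrefl[OF s, of n] e by auto
  have s1: "simple_graph (V, del F i n)" using simple_del[OF s] .
  show "simple_graph (V, ins (del F i n) k n)" using simple_ins[OF s1 k n(1) e(3)] .
  have "\<not> del F i n k n" using e by (simp add: del_def)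
  from dg_ins[OF s1 this e(3), of r] dg_del[OF s e(1), of r]
  show "dg (ins (del F i n) k n) r + (if r = i then 1 else 0) = dg F r + (if r = k then 1 else 0)"
    using n e(3,4) by (auto split: if_splits)
qed

text \<open>Here \<open>H\<close> is to become the clique. Among the graphs with the prescribed degrees on \<open>H\<close>, the prescribed
  degree sum on the rest \<open>R\<close>, and \<open>H\<close> complete, choose one whose degrees on \<open>R\<close> deviate least. A vertex
  with surplus degree has all its neighbours in common with every vertex of deficient degree, so its
  prescribed degree is at most \<open>c - 2\<close>. As the surplus can be transferred, this leads to a contradiction
  with the many vertices of degree exactly \<open>c\<close>.\<close>

locale flat_degrees =
  fixes V H :: "'v set" and E :: "'v \<Rightarrow> 'v \<Rightarrow> bool" and s c D :: nat
  assumes simple: "simple_graph (V, E)" and HV: "H \<subseteq> V" and cH: "card H = s"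
    and cs: "s \<le> c + 1"
    and maxdeg: "\<And>x. x \<in> V \<Longrightarrow> dg E x \<le> D"
    and high: "\<And>p. p \<in> H \<Longrightarrow> c \<le> dg E p"
    and low: "\<And>r. r \<in> V - H \<Longrightarrow> dg E r \<le> c"
    and many: "D + 2 \<le> card {r\<in>V-H. dg E r = c} + s"
    and cases: "(card V = 2 * s \<and> (\<forall>x\<in>V. s \<le> dg E x + 1)) \<or>
      (c + 1 = s \<and> s \<le> card {r\<in>V-H. dg E r = c})"
begin

abbreviation "R \<equiv> V - H"
abbreviation "R0 \<equiv> {r\<in>V-H. dg E r = c}"

text \<open>The degrees on \<open>R\<close> are relaxed to their sum. This freedom allows
  \<open>H\<close> to be made complete first; \<open>disc\<close> below measures what must then be
  repaired.\<close>

definition admissible where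
  "admissible F \<longleftrightarrow> simple_graph (V, F) \<and> (\<forall>p\<in>H. dg F p = dg E p) \<and> (\<Sum>r\<in>R. dg F r) = (\<Sum>r\<in>R. dg E r)"

lemma fin: "finite V" "finite H" "finite R" "finite R0"
  using simple_finite[OF simple] finite_subset[OF HV] by auto

lemma s_le_R: "s \<le> card R"
proof -
  have "card R = card V - s" using fin HV cH by (simp add: card_Diff_subset)
  moreover have "card R0 \<le> card R" using fin by (intro card_mono) auto
  ultimately show ?thesis using cases by auto
qed

lemma outside_neighbours:
  assumes "admissible F" "p \<in> H" "B \<subseteq> H" "nb F p \<inter> H \<subseteq> B"
  shows "dg E p \<le> card (nb F p \<inter> R) + card B"
proof -
  have s': "simple_graph (V, F)" using assms by (simp add: admissible_def)
  have "nb F p = (nb F p \<inter> R) \<union> (nb F p \<inter> H)" using nb_sub[OF s', of p] by blast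
  then have "card (nb F p) \<le> card (nb F p \<inter> R) + card (nb F p \<inter> H)" by (metis card_Un_le)
  also have "card (nb F p \<inter> H) \<le> card B" using assms(3,4) fin finite_subset by (intro card_mono) auto
  finally show ?thesis using assms by (simp add: admissible_def dg_def)
qed

text \<open>Take an admissible graph with fewest missing pairs in \<open>H\<close>. If
  \<open>u v\<close> is missing, \<open>u\<close> and \<open>v\<close> have neighbours
  \<open>x\<close> and \<open>y\<close> in \<open>R\<close>; deleting \<open>u x\<close>,
  \<open>v y\<close> and inserting \<open>u v\<close> together with a missing pair of
  \<open>R\<close> preserves the degrees on \<open>H\<close> and the degree sum on
  \<open>R\<close>.\<close>

lemma admissible_clique:
  obtains F where "admissible F" "\<forall>x\<in>H. \<forall>y\<in>H. x \<noteq> y \<longrightarrow> F x y"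
proof -
  define mis where "mis = (\<lambda>F. {(x,y)\<in>H\<times>H. x \<noteq> y \<and> \<not> F x y})"
  have "admissible E" using simple by (simp add: admissible_def)
  then obtain F where F: "admissible F" "\<And>F'. admissible F' \<Longrightarrow> card (mis F) \<le> card (mis F')"
    using ex_has_least_nat[of admissible E "\<lambda>F. card (mis F)"] by blast
  have s': "simple_graph (V, F)" using F by (simp add: admissible_def)
  have finmis: "finite (mis F)" unfolding mis_def by (rule finite_subset[of _ "H \<times> H"]) (use fin in auto)
  have "F u v" if uv: "u \<in> H" "v \<in> H" "u \<noteq> v" for u v
  proof (rule ccontr)
    assume no: "\<not> F u v"
    have nov: "\<not> F v u" using no simple_sym[OF s'] by fast
    have cB: "card (H - {u,v}) = s - 2" using uv cH fin by (simp add: card_Diff_subset)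
    have s2: "2 \<le> s" using uv cH fin card_mono[of H "{u,v}"] by auto
    have ubound: "dg E u \<le> card (nb F u \<inter> R) + (s - 2)"
    proof -
      have "nb F u \<inter> H \<subseteq> H - {u,v}" using no simple_irrefl[OF s', of u] by auto
      from outside_neighbours[OF F(1) uv(1) Diff_subset this] show ?thesis using cB by simp
    qed
    have vbound: "dg E v \<le> card (nb F v \<inter> R) + (s - 2)"
    proof -
      have "nb F v \<inter> H \<subseteq> H - {u,v}" using nov simple_irrefl[OF s', of v] by auto
      from outside_neighbours[OF F(1) uv(2) Diff_subset this] show ?thesis using cB by simp
    qed
    have "card (nb F u \<inter> R) > 0" "card (nb F v \<inter> R) > 0" using ubound vbound high[OF uv(1)] high[OF uv(2)] cs s2 by auto
    then have "nb F u \<inter> R \<noteq> {}" "nb F v \<inter> R \<noteq> {}" by fastforce+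
    then obtain x y where xy: "F u x" "x \<in> R" "F v y" "y \<in> R" unfolding nb_def by blast
    \<comment> \<open>If \<open>R\<close> were complete, its degree sum would be
      \<open>card R * (card R - 1)\<close> plus the number of edges to \<open>H\<close>. That number
      is at least \<open>s * (c + 1 - s) + 1\<close>, the last unit coming from the pair missing at
      \<open>u\<close>, whereas the degree sum is at most \<open>card R * c\<close>.\<close>
    have "\<exists>z\<in>R. \<exists>z'\<in>R. z \<noteq> z' \<and> \<not> F z z'"
    proof (rule ccontr)
      assume nn: "\<not> ?thesis"
      have cl: "F z z'" if "z \<in> R" "z' \<in> R" "z \<noteq> z'" for z z' using that nn by blast
      have dgr: "card R - 1 + card (nb F r \<inter> H) \<le> dg F r" if r: "r \<in> R" for r
      proof -
        have "(R - {r}) \<union> (nb F r \<inter> H) \<subseteq> nb F r" using cl[OF r] by fastforce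
        then have "card ((R - {r}) \<union> (nb F r \<inter> H)) \<le> dg F r"
          unfolding dg_def using finite_nb[OF s'] by (intro card_mono) auto
        moreover have "card ((R - {r}) \<union> (nb F r \<inter> H)) = card (R - {r}) + card (nb F r \<inter> H)"
          using fin by (intro card_Un_disjoint) auto
        moreover have "card (R - {r}) = card R - 1" using r fin by simp
        ultimately show ?thesis by simp
      qed
      have "card R * (card R - 1) + (\<Sum>r\<in>R. card (nb F r \<inter> H)) = (\<Sum>r\<in>R. card R - 1 + card (nb F r \<inter> H))"
        by (simp add: sum.distrib)
      also have "\<dots> \<le> (\<Sum>r\<in>R. dg F r)" using dgr by (intro sum_mono) auto
      also have "\<dots> = (\<Sum>r\<in>R. dg E r)" using F by (simp add: admissible_def)
      also have "\<dots> \<le> card R * c" using sum_bounded_above[of R "dg E" c] low by simp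
      finally have A: "card R * (card R - 1) + (\<Sum>p\<in>H. card (nb F p \<inter> R)) \<le> card R * c"
        using double_count[OF s' fin(3,2)] by simp
      have pb: "c + 1 - s + (if p = u then 1 else 0) \<le> card (nb F p \<inter> R)" if p: "p \<in> H" for p
      proof (cases "p = u")
        case True then show ?thesis using ubound high[OF uv(1)] s2 cs by simp
      next
        case False
        have "dg E p \<le> card (nb F p \<inter> R) + card (H - {p})"
          by (rule outside_neighbours[OF F(1) p]) (use simple_irrefl[OF s', of p] in auto)
        moreover have "card (H - {p}) = s - 1" using p cH fin by simp
        ultimately show ?thesis using False high[OF p] s2 by simp
      qed
      have "s * (c + 1 - s) + 1 = (\<Sum>p\<in>H. c + 1 - s + (if p = u then 1 else 0))"
        using uv fin cH by (simp add: sum.distrib)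
      also have "\<dots> \<le> (\<Sum>p\<in>H. card (nb F p \<inter> R))" using pb by (intro sum_mono) auto
      finally have B: "card R * (card R - 1) + s * (c + 1 - s) + 1 \<le> card R * c" using A by linarith
      show False using cases
      proof
        assume a: "card V = 2 * s \<and> (\<forall>x\<in>V. s \<le> dg E x + 1)"
        then have "card R = s" using fin HV cH by (simp add: card_Diff_subset)
        then have "s * (s - 1 + (c + 1 - s)) + 1 \<le> s * c" using B by (simp add: distrib_left)
        moreover have "s - 1 + (c + 1 - s) = c" using cs s2 by simp
        ultimately show False by simp
      next
        assume a: "c + 1 = s \<and> s \<le> card R0"
        then have "c \<le> card R - 1" using s_le_R by linarith
        then have "card R * c \<le> card R * (card R - 1)" by (rule mult_le_mono2)
        then show False using B by linarith
      qed
    qed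
    then obtain z z' where z: "z \<in> R" "z' \<in> R" "z \<noteq> z'" "\<not> F z z'" by blast
    define F1 where "F1 = del F u x"
    define F2 where "F2 = del F1 v y"
    define F3 where "F3 = ins F2 u v"
    define F4 where "F4 = ins F3 z z'"
    have ne: "u \<noteq> x" "v \<noteq> y" "u \<noteq> y" "v \<noteq> x" "u \<noteq> z" "u \<noteq> z'" "v \<noteq> z" "v \<noteq> z'" using uv xy z by auto
    have s1: "simple_graph (V, F1)" "simple_graph (V, F2)" unfolding F1_def F2_def by (intro simple_del s')+
    have s3: "simple_graph (V, F3)" unfolding F3_def using s1(2) uv HV by (intro simple_ins) auto
    have s4: "simple_graph (V, F4)" unfolding F4_def using s3 z by (intro simple_ins) auto
    have e1: "F1 v y" using xy ne uv by (auto simp: F1_def del_def)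
    have e2: "\<not> F2 u v" using no by (auto simp: F1_def F2_def del_def)
    have e3: "\<not> F3 z z'" using z ne by (auto simp: F1_def F2_def F3_def del_def ins_def)
    have d: "dg F4 r + (if r = u \<or> r = x then 1 else 0) + (if r = v \<or> r = y then 1 else 0)
      = dg F r + (if r = u \<or> r = v then 1 else 0) + (if r = z \<or> r = z' then 1 else 0)" for r
      using dg_del[OF s' xy(1), of r] dg_del[OF s1(1) e1, of r] dg_ins[OF s1(2) e2 uv(3), of r] dg_ins[OF s3 e3 z(3), of r]
      by (simp add: F4_def F3_def F2_def F1_def)
    have dH: "dg F4 p = dg E p" if "p \<in> H" for p
    proof -
      have "p \<noteq> x" "p \<noteq> y" "p \<noteq> z" "p \<noteq> z'" using that xy z by auto
      then have "dg F4 p = dg F p" using d[of p] uv(3) by (auto split: if_splits)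
      then show ?thesis using that F by (simp add: admissible_def)
    qed
    have "(\<Sum>r\<in>R. dg F4 r + (if r = x then 1 else 0) + (if r = y then 1 else 0)) =
      (\<Sum>r\<in>R. dg F r + (if r = z then 1 else 0) + (if r = z' then 1 else 0))"
    proof (rule sum.cong[OF refl])
      fix r assume "r \<in> R"
      then have "r \<noteq> u" "r \<noteq> v" using uv by auto
      then show "dg F4 r + (if r = x then 1 else 0) + (if r = y then 1 else 0) =
         dg F r + (if r = z then 1 else 0) + (if r = z' then 1 else 0)" using d[of r] z(3) by (auto split: if_splits)
    qed
    then have "(\<Sum>r\<in>R. dg F4 r) = (\<Sum>r\<in>R. dg F r)"
      using fin(3) xy z by (simp add: sum.distrib)
    then have "admissible F4" using F s4 dH by (simp add: admissible_def)
    moreover have "mis F4 \<subset> mis F"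
    proof
      show "mis F4 \<subseteq> mis F" using xy by (auto simp: mis_def F4_def F3_def F2_def F1_def ins_def del_def)
      have "(u,v) \<in> mis F" "(u,v) \<notin> mis F4" using uv no by (auto simp: mis_def F4_def F3_def ins_def)
      then show "mis F4 \<noteq> mis F" by blast
    qed
    then have "card (mis F4) < card (mis F)" using finmis by (simp add: psubset_card_mono)
    ultimately show False using F(2) by fastforce
  qed
  then show ?thesis using that F(1) by blast
qed

text \<open>One of the two truncated differences vanishes, so each summand is an absolute
  deviation.\<close>

definition disc where
  "disc F = (\<Sum>r\<in>R. (dg F r - dg E r) + (dg E r - dg F r))"

text \<open>The clause \<open>disc F \<noteq> 0\<close> makes this a minimal counterexample, to be
  refuted in \<open>not_optimal\<close>.\<close>

definition optimal where
  "optimal F \<longleftrightarrow> admissible F \<and> (\<forall>x\<in>H. \<forall>y\<in>H. x \<noteq> y \<longrightarrow> F x y) \<and> disc F \<noteq> 0 \<and>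
     (\<forall>F'. admissible F' \<longrightarrow> (\<forall>x\<in>H. \<forall>y\<in>H. x \<noteq> y \<longrightarrow> F' x y) \<longrightarrow> disc F \<le> disc F')"

lemma optimal_simple: "optimal F \<Longrightarrow> simple_graph (V, F)"
  by (simp add: optimal_def admissible_def)

lemma optimal_equal_disc:
  assumes "optimal F" "admissible F'" "\<forall>x\<in>H. \<forall>y\<in>H. x \<noteq> y \<longrightarrow> F' x y" "disc F' \<le> disc F"
  shows "optimal F'"
proof -
  have "disc F \<le> disc F'" using assms(1-3) by (simp add: optimal_def)
  then have "disc F' = disc F" using assms(4) by simp
  then show ?thesis using assms(1-3) by (simp add: optimal_def)
qed

lemma surplus_deficit:
  assumes "optimal F"
  obtains i j where "i \<in> R" "dg E i < dg F i" "j \<in> R" "dg F j < dg E j"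
proof -
  have eq: "(\<Sum>r\<in>R. dg F r) = (\<Sum>r\<in>R. dg E r)" using assms by (simp add: optimal_def admissible_def)
  have ne: "\<exists>r\<in>R. dg F r \<noteq> dg E r"
  proof (rule ccontr)
    assume "\<not> ?thesis"
    then have "disc F = 0" by (simp add: disc_def)
    then show False using assms by (simp add: optimal_def)
  qed
  have "\<exists>i\<in>R. dg E i < dg F i"
  proof (rule ccontr)
    assume a: "\<not> ?thesis"
    then have "\<forall>r\<in>R. dg F r \<le> dg E r" by (meson not_le)
    moreover have "\<exists>r\<in>R. dg F r < dg E r" using ne a by (meson linorder_neqE_nat)
    ultimately have "(\<Sum>r\<in>R. dg F r) < (\<Sum>r\<in>R. dg E r)" using fin(3) by (intro sum_strict_mono_ex1) auto
    then show False using eq by simp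
  qed
  moreover have "\<exists>j\<in>R. dg F j < dg E j"
  proof (rule ccontr)
    assume a: "\<not> ?thesis"
    then have "\<forall>r\<in>R. dg E r \<le> dg F r" by (meson not_le)
    moreover have "\<exists>r\<in>R. dg E r < dg F r" using ne a by (meson linorder_neqE_nat)
    ultimately have "(\<Sum>r\<in>R. dg E r) < (\<Sum>r\<in>R. dg F r)" using fin(3) by (intro sum_strict_mono_ex1) auto
    then show False using eq by simp
  qed
  ultimately show ?thesis using that by blast
qed

text \<open>Handing an edge of a surplus vertex \<open>i\<close> to \<open>k\<close> lowers the
  deviation at \<open>i\<close> by one and raises it at \<open>k\<close> by at most one. A deficit
  at \<open>k\<close> would make the total drop by two, against minimality.\<close>

lemma transfer:
  assumes F: "optimal F" and ik: "i \<in> R" "k \<in> R" "i \<noteq> k" and n: "F i n" "\<not> F k n" "n \<noteq> k"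
    and i: "dg E i < dg F i"
  defines "F' \<equiv> ins (del F i n) k n"
  shows "optimal F'" "dg E k \<le> dg F k" "dg F' k = dg F k + 1"
proof -
  have s': "simple_graph (V, F)" using F optimal_simple by blast
  have kV: "k \<in> V" using ik by simp
  note me = move_edge[OF s' n(1,2) n(3)[symmetric] ik(3)[symmetric] kV, folded F'_def]
  have m: "simple_graph (V, F')" "dg F' r + (if r = i then 1 else 0) = dg F r + (if r = k then 1 else 0)" for r
    by (rule me)+
  have H: "dg F' p = dg F p" if "p \<in> H" for p using m(2)[of p] that ik by (auto split: if_splits)
  have "(\<Sum>r\<in>R. dg F' r + (if r = i then 1 else 0)) = (\<Sum>r\<in>R. dg F r + (if r = k then 1 else 0))"
    using m(2) by simp
  then have "(\<Sum>r\<in>R. dg F' r) = (\<Sum>r\<in>R. dg F r)" using fin(3) ik by (simp add: sum.distrib)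
  then have adm: "admissible F'" using F m(1) H by (auto simp: optimal_def admissible_def)
  have cl: "\<forall>x\<in>H. \<forall>y\<in>H. x \<noteq> y \<longrightarrow> F' x y"
    using F ik by (auto simp: optimal_def F'_def ins_def del_def)
  let ?t = "\<lambda>F r. (dg F r - dg E r) + (dg E r - dg F r)"
  have "(\<Sum>r\<in>R. ?t F' r + (if r = i then 1 else 0)) \<le> (\<Sum>r\<in>R. ?t F r + (if r = k then 1 else 0))"
  proof (rule sum_mono)
    fix r
    show "?t F' r + (if r = i then 1 else 0) \<le> ?t F r + (if r = k then 1 else 0)"
      using m(2)[of r] i ik(3) by (auto split: if_splits)
  qed
  then have le: "disc F' \<le> disc F" using fin(3) ik by (simp add: sum.distrib disc_def)
  show "optimal F'" using optimal_equal_disc[OF F adm cl le] .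
  show "dg F' k = dg F k + 1" using m(2)[of k] ik by auto
  show "dg E k \<le> dg F k"
  proof (rule ccontr)
    assume a: "\<not> ?thesis"
    have "(\<Sum>r\<in>R. ?t F' r + (if r = i then 1 else 0) + (if r = k then 1 else 0)) \<le> (\<Sum>r\<in>R. ?t F r)"
    proof (rule sum_mono)
      fix r
      show "?t F' r + (if r = i then 1 else 0) + (if r = k then 1 else 0) \<le> ?t F r"
        using m(2)[of r] i ik(3) a by (auto split: if_splits)
    qed
    then have "disc F' + 2 \<le> disc F" using fin(3) ik by (simp add: sum.distrib disc_def)
    moreover have "disc F \<le> disc F'" using F adm cl by (simp add: optimal_def)
    ultimately show False by simp
  qed
qed

text \<open>By \<open>transfer\<close> a deficient \<open>j\<close> is adjacent to all other
  neighbours of \<open>i\<close>. Hence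
  \<open>dg E i < dg F i \<le> dg F j < dg E j \<le> c\<close>, and the two strict steps give the
  gap of two.\<close>

lemma surplus_low:
  assumes F: "optimal F" and i: "i \<in> R" "dg E i < dg F i"
  shows "dg E i + 2 \<le> c"
proof -
  obtain j where j: "j \<in> R" "dg F j < dg E j" using surplus_deficit[OF F] by metis
  have ij: "i \<noteq> j" using i j by auto
  have "nb F i - {j} \<subseteq> nb F j"
  proof
    fix n assume "n \<in> nb F i - {j}"
    then show "n \<in> nb F j" using transfer(2)[OF F i(1) j(1) ij _ _ _ i(2), of n] j by auto
  qed
  then have "dg F i \<le> dg F j" using nb_subset_dg_le[OF optimal_simple[OF F]] by blast
  then show ?thesis using i j low[OF j(1)] by linarith
qed

text \<open>Otherwise the edge \<open>i n\<close> could be transferred to \<open>k\<close>, giving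
  an optimal graph with a surplus at a vertex of prescribed degree \<open>c\<close>, which
  \<open>surplus_low\<close> forbids.\<close>

lemma surplus_neighbours:
  assumes F: "optimal F" and i: "i \<in> R" "dg E i < dg F i" and k: "k \<in> R0" and n: "F i n" "n \<noteq> k"
  shows "F k n"
proof (rule ccontr)
  assume nk: "\<not> F k n"
  have kc: "k \<in> R" "dg E k = c" using k by auto
  have ik: "i \<noteq> k" using surplus_low[OF F i] kc by auto
  note t = transfer[OF F i(1) kc(1) ik n(1) nk n(2) i(2)]
  show False using surplus_low[OF t(1) kc(1)] t(2,3) kc by simp
qed

lemma not_optimal: "\<not> optimal F"
proof
  assume F: "optimal F"
  have s': "simple_graph (V, F)" using optimal_simple[OF F] .
  have adm: "admissible F" and cl: "\<forall>x\<in>H. \<forall>y\<in>H. x \<noteq> y \<longrightarrow> F x y" using F by (auto simp: optimal_def)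
  \<comment> \<open>A neighbour \<open>p\<close> in \<open>H\<close> would be adjacent to
    \<open>i\<close>, to all of \<open>R0\<close> and to the rest of \<open>H\<close>, so its degree
    would be at least \<open>card R0 + s\<close>, which exceeds \<open>D\<close> by
    \<open>many\<close>.\<close>
  have inside: "nb F i \<subseteq> R" if i: "i \<in> R" "dg E i < dg F i" for i
  proof (rule ccontr)
    assume "\<not> ?thesis"
    then obtain p where p: "F i p" "p \<notin> R" unfolding nb_def by blast
    then have pH: "p \<in> H" using simple_in2[OF s' p(1)] by auto
    have "k \<in> nb F p \<inter> R" if k: "k \<in> R0" for k
    proof -
      have "k \<noteq> p" using k pH by auto
      then have "F k p" using surplus_neighbours[OF F i k p(1)] by blast
      then show ?thesis using simple_sym[OF s', of k p] k by auto
    qed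
    moreover have "i \<in> nb F p \<inter> R" using i(1) simple_sym[OF s' p(1)] by simp
    ultimately have "insert i R0 \<subseteq> nb F p \<inter> R" by blast
    then have "card (insert i R0) \<le> card (nb F p \<inter> R)" using fin by (intro card_mono) auto
    moreover have "i \<notin> R0" using surplus_low[OF F i] by auto
    ultimately have 1: "card R0 + 1 \<le> card (nb F p \<inter> R)" using fin(4) by simp
    have "(nb F p \<inter> R) \<union> (H - {p}) \<subseteq> nb F p" using cl pH by fastforce
    then have "card ((nb F p \<inter> R) \<union> (H - {p})) \<le> dg F p"
      unfolding dg_def using finite_nb[OF s'] by (intro card_mono) auto
    moreover have "card ((nb F p \<inter> R) \<union> (H - {p})) = card (nb F p \<inter> R) + card (H - {p})"
      using fin by (intro card_Un_disjoint) auto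
    moreover have "card (H - {p}) = s - 1" "s \<ge> 1" using pH fin cH card_gt_0_iff[of H] by auto
    moreover have "dg F p \<le> D" using adm pH maxdeg[of p] HV by (auto simp: admissible_def)
    ultimately show False using 1 many by linarith
  qed
  obtain i where i: "i \<in> R" "dg E i < dg F i" using surplus_deficit[OF F] by metis
  show False using cases
  proof
    \<comment> \<open>All neighbours of \<open>i\<close> lie among the \<open>s\<close> vertices of
      \<open>R\<close>, so its degree is at most \<open>s - 1\<close>, which is no surplus.\<close>
    assume a: "card V = 2 * s \<and> (\<forall>x\<in>V. s \<le> dg E x + 1)"
    then have "card R = s" using fin HV cH by (simp add: card_Diff_subset)
    moreover have "nb F i \<subseteq> R - {i}" using inside[OF i] simple_irrefl[OF s', of i] by auto
    then have "dg F i \<le> card (R - {i})" unfolding dg_def using fin by (intro card_mono) auto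
    moreover have "s \<le> dg E i + 1" using a i by blast
    ultimately show False using i fin card_gt_0_iff[of R] by auto
  next
    assume a: "c + 1 = s \<and> s \<le> card R0"
    \<comment> \<open>Here \<open>c = s - 1\<close>. A neighbour \<open>n\<close> of
      \<open>i\<close> has degree at least \<open>card R0 \<ge> s\<close>, hence a surplus as well.
      Then \<open>R0\<close> is complete, as otherwise the edge \<open>i n\<close> could be traded
      for a missing pair \<open>k k'\<close>. A vertex of \<open>R0\<close> is also adjacent to
      \<open>n\<close>, so it has degree at least \<open>s > c\<close>, a surplus that
      \<open>surplus_low\<close> excludes.\<close>
    have "nb F i \<noteq> {}" using i by (auto simp: dg_def)
    then obtain n where n: "F i n" by (auto simp: nb_def)
    have nR: "n \<in> R" using inside[OF i] n by auto
    have iR0: "i \<notin> R0" using surplus_low[OF F i] by auto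
    have ni: "n \<noteq> i" using n simple_irrefl[OF s'] by fast
    have nk: "F k n" if "k \<in> R0" "k \<noteq> n" for k using surplus_neighbours[OF F i that(1) n] that by simp
    have "F n k" if "k \<in> R0" "k \<noteq> n" for k using nk[OF that] simple_sym[OF s', of k n] by blast
    then have "insert i (R0 - {n}) \<subseteq> nb F n" using simple_sym[OF s' n] by fastforce
    then have "card (insert i (R0 - {n})) \<le> dg F n" unfolding dg_def using finite_nb[OF s'] by (intro card_mono) auto
    moreover have "card (insert i (R0 - {n})) \<ge> card R0"
    proof -
      have "card (insert i (R0 - {n})) = Suc (card (R0 - {n}))"
        using fin(4) iR0 by (intro card_insert_disjoint) blast+
      then show ?thesis using card_Diff1_le[of R0 n] card_Diff_singleton_if[of R0 n] by (auto split: if_splits)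
    qed
    ultimately have "dg E n < dg F n" using a low[OF nR] by linarith
    note n2 = nR this
    have nR0: "n \<notin> R0" using surplus_low[OF F n2] by auto
    have clR0: "F k k'" if kk: "k \<in> R0" "k' \<in> R0" "k \<noteq> k'" for k k'
    proof (rule ccontr)
      assume no: "\<not> F k k'"
      define F1 where "F1 = del F i n"
      define F2 where "F2 = ins F1 k k'"
      have d: "i \<noteq> k" "i \<noteq> k'" "n \<noteq> k" "n \<noteq> k'" using kk iR0 nR0 by auto
      have s1: "simple_graph (V, F1)" unfolding F1_def using simple_del[OF s'] .
      have s2: "simple_graph (V, F2)" unfolding F2_def using s1 kk by (intro simple_ins) auto
      have e1: "\<not> F1 k k'" using no by (simp add: F1_def del_def)
      have m: "dg F2 r + (if r = i then 1 else 0) + (if r = n then 1 else 0) =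
          dg F r + (if r = k then 1 else 0) + (if r = k' then 1 else 0)" for r
        using dg_del[OF s' n, of r] dg_ins[OF s1 e1 kk(3), of r] ni kk(3) by (auto simp: F1_def F2_def split: if_splits)
      have H: "dg F2 p = dg F p" if "p \<in> H" for p using m[of p] that i nR kk by (auto split: if_splits)
      have "(\<Sum>r\<in>R. dg F2 r + (if r = i then 1 else 0) + (if r = n then 1 else 0)) =
        (\<Sum>r\<in>R. dg F r + (if r = k then 1 else 0) + (if r = k' then 1 else 0))"
        using m by simp
      then have "(\<Sum>r\<in>R. dg F2 r) = (\<Sum>r\<in>R. dg F r)" using fin(3) i nR kk by (simp add: sum.distrib)
      then have adm2: "admissible F2" using adm s2 H by (auto simp: admissible_def)
      have cl2: "\<forall>x\<in>H. \<forall>y\<in>H. x \<noteq> y \<longrightarrow> F2 x y"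
        using cl i nR by (auto simp: F2_def F1_def ins_def del_def)
      let ?t = "\<lambda>F r. (dg F r - dg E r) + (dg E r - dg F r)"
      have "(\<Sum>r\<in>R. ?t F2 r + (if r = i then 1 else 0) + (if r = n then 1 else 0)) \<le>
         (\<Sum>r\<in>R. ?t F r + (if r = k then 1 else 0) + (if r = k' then 1 else 0))"
      proof (rule sum_mono)
        fix r
        show "?t F2 r + (if r = i then 1 else 0) + (if r = n then 1 else 0) \<le>
          ?t F r + (if r = k then 1 else 0) + (if r = k' then 1 else 0)"
          using m[of r] i n2 d ni kk(3) by (auto split: if_splits)
      qed
      then have le: "disc F2 \<le> disc F" using fin(3) i nR kk by (simp add: sum.distrib disc_def)
      have o2: "optimal F2" using optimal_equal_disc[OF F adm2 cl2 le] .
      have k2: "dg F2 k = dg F k + 1" using m[of k] d kk(3) by auto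
      \<comment> \<open>Either the new edge gives \<open>k\<close> a surplus in an optimal graph, or
        it reduces a deficit of \<open>k\<close> and the discrepancy drops.\<close>
      show False
      proof (cases "c \<le> dg F k")
        case True
        then show False using surplus_low[OF o2, of k] kk k2 by auto
      next
        case False
        have "(\<Sum>r\<in>R. ?t F2 r + (if r = i then 1 else 0) + (if r = n then 1 else 0) + (if r = k then 1 else 0)) \<le>
           (\<Sum>r\<in>R. ?t F r + (if r = k' then 1 else 0))"
        proof (rule sum_mono)
          fix r
          have "dg E k = c" using kk by auto
          then show "?t F2 r + (if r = i then 1 else 0) + (if r = n then 1 else 0) + (if r = k then 1 else 0) \<le>
            ?t F r + (if r = k' then 1 else 0)"
            using m[of r] i n2 d ni kk(3) False by (auto split: if_splits)
        qed
        then have "disc F2 < disc F" using fin(3) i nR kk by (simp add: sum.distrib disc_def)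
        moreover have "disc F \<le> disc F2" using F adm2 cl2 by (simp add: optimal_def)
        ultimately show False by simp
      qed
    qed
    have "R0 \<noteq> {}"
    proof
      assume "R0 = {}"
      then have "card R0 = 0" by (simp only: card.empty)
      then show False using a by linarith
    qed
    then obtain k where k: "k \<in> R0" by blast
    have "x \<in> nb F k" if "x \<in> R0 - {k}" for x using clR0[OF k, of x] that unfolding nb_def by blast
    moreover have "n \<in> nb F k" using nk[OF k] k nR0 unfolding nb_def by blast
    ultimately have "insert n (R0 - {k}) \<subseteq> nb F k" by blast
    then have "card (insert n (R0 - {k})) \<le> dg F k" unfolding dg_def using finite_nb[OF s'] by (intro card_mono) auto
    moreover have "card (insert n (R0 - {k})) = Suc (card (R0 - {k}))"
      using fin(4) nR0 by (intro card_insert_disjoint) blast+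
    moreover have "card R0 = Suc (card (R0 - {k}))" using card.remove[OF fin(4) k] .
    moreover have "dg E k = c" using k by blast
    ultimately have "dg E k < dg F k" using a by linarith
    then show False using surplus_low[OF F, of k] k by auto
  qed
qed

lemma clique: "pot_clique V E s"
proof -
  let ?P = "\<lambda>F. admissible F \<and> (\<forall>x\<in>H. \<forall>y\<in>H. x \<noteq> y \<longrightarrow> F x y)"
  obtain F0 where "?P F0" using admissible_clique by blast
  then obtain F where F: "?P F" "\<And>F'. ?P F' \<Longrightarrow> disc F \<le> disc F'"
    using ex_has_least_nat[of ?P F0 disc] by blast
  then have "disc F = 0" using not_optimal[of F] by (auto simp: optimal_def)
  then have "\<forall>r\<in>R. dg F r = dg E r" using fin(3) by (simp add: disc_def) (metis diff_is_0_eq le_antisym)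
  then have "same_deg V E F" using F(1) by (auto simp: same_deg_def admissible_def)
  then show ?thesis unfolding pot_clique_def using F(1) HV cH by blast
qed

end

section \<open>The bound on the number of high vertices\<close>

lemma lay_off_vertex:
  assumes s: "simple_graph (V, E)" and w: "w \<in> V"
  obtains E1 where "same_deg V E E1" "\<forall>x\<in>nb E1 w. \<forall>y\<in>V-{w}-nb E1 w. dg E y \<le> dg E x"
proof -
  have fin: "finite V" using simple_finite[OF s] .
  have "dg E w \<le> card (V - {w})" using dg_bound[OF s w] w fin by simp
  then obtain S where S: "S \<subseteq> V - {w}" "card S = dg E w" "\<forall>x\<in>S. \<forall>y\<in>V-{w}-S. dg E y \<le> dg E x"
    using ex_top_subset[of "V - {w}" "dg E w" "dg E"] fin by auto
  obtain E1 where "same_deg V E E1" "nb E1 w = S" using lay_off[OF s w S] by blast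
  then show ?thesis using that S(3) by blast
qed

lemma ex_max_dg:
  assumes "finite V" "V \<noteq> {}"
  obtains v where "v \<in> V" "\<forall>x\<in>V. dg E x \<le> dg E v"
proof -
  have "Max (dg E ` V) \<in> dg E ` V" using assms by (intro Max_in) auto
  then obtain v where "v \<in> V" "dg E v = Max (dg E ` V)" by auto
  then show ?thesis using that assms(1) by simp
qed

lemma ex_min_dg:
  assumes "finite V" "V \<noteq> {}"
  obtains v where "v \<in> V" "\<forall>x\<in>V. dg E v \<le> dg E x"
proof -
  have "Min (dg E ` V) \<in> dg E ` V" using assms by (intro Min_in) auto
  then obtain v where "v \<in> V" "dg E v = Min (dg E ` V)" by auto
  then show ?thesis using that assms(1) by simp
qed

text \<open>Supplies \<open>H\<close> for \<open>flat_degrees\<close>: all vertices of degree above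
  \<open>c\<close>, filled up to \<open>m + 1\<close> with vertices of degree \<open>c\<close>. The
  other vertices of degree \<open>c\<close> then form the large set \<open>R0\<close>.\<close>

lemma pot_clique_flat:
  assumes s: "simple_graph (V, E)" and D: "\<And>x. x \<in> V \<Longrightarrow> dg E x \<le> D" and mc: "m \<le> c"
    and c: "card {x\<in>V. c < dg E x} \<le> m" "D + 2 \<le> card {x\<in>V. c \<le> dg E x}" 
    and M: "2 * m + 2 \<le> card {v\<in>V. m \<le> dg E v}"
    and or: "card V = 2 * m + 2 \<or> m = c"
  shows "pot_clique V E (Suc m)"
proof -
  have fin: "finite V" using simple_finite[OF s] .
  have "{x\<in>V. c \<le> dg E x} \<noteq> {}"
  proof
    assume "{x\<in>V. c \<le> dg E x} = {}"
    then have "card {x\<in>V. c \<le> dg E x} = 0" by (simp only: card.empty)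
    then show False using c(2) by linarith
  qed
  then obtain y where "y \<in> V" "c \<le> dg E y" by blast
  then have "c \<le> D" using D[of y] by simp
  then have "Suc m \<le> card {x\<in>V. c \<le> dg E x}" using c(2) mc by simp
  moreover have "{x\<in>V. c < dg E x} \<subseteq> {x\<in>V. c \<le> dg E x}" by auto
  ultimately obtain H where H: "{x\<in>V. c < dg E x} \<subseteq> H" "H \<subseteq> {x\<in>V. c \<le> dg E x}" "card H = Suc m"
    using exists_subset_between[of "{x\<in>V. c < dg E x}" "Suc m" "{x\<in>V. c \<le> dg E x}"] c(1) fin by auto
  have low: "dg E r \<le> c" if "r \<in> V - H" for r
  proof (rule ccontr)
    assume "\<not> dg E r \<le> c"
    then show False using that H(1) by auto
  qed
  have "{r\<in>V-H. dg E r = c} = {x\<in>V. c \<le> dg E x} - H" using low by fastforce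
  moreover have "finite H" using H(2) fin finite_subset by fastforce
  ultimately have R0: "card {r\<in>V-H. dg E r = c} = card {x\<in>V. c \<le> dg E x} - Suc m"
    using H(2,3) by (simp add: card_Diff_subset)
  interpret flat_degrees V H E "Suc m" c D
  proof
    show "simple_graph (V, E)" by (rule s)
    show "H \<subseteq> V" using H(2) by auto
    show "card H = Suc m" by (rule H(3))
    show "Suc m \<le> c + 1" using mc by simp
    show "\<And>x. x \<in> V \<Longrightarrow> dg E x \<le> D" by (rule D)
    show "\<And>p. p \<in> H \<Longrightarrow> c \<le> dg E p" using H(2) by auto
    show "\<And>r. r \<in> V - H \<Longrightarrow> dg E r \<le> c" by (rule low)
    show "D + 2 \<le> card {r\<in>V-H. dg E r = c} + Suc m" using R0 c(2) by simp
    show "card V = 2 * Suc m \<and> (\<forall>x\<in>V. Suc m \<le> dg E x + 1) \<or>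
      c + 1 = Suc m \<and> Suc m \<le> card {r\<in>V-H. dg E r = c}"
      using or
    proof
      assume a: "card V = 2 * m + 2"
      have "{v\<in>V. m \<le> dg E v} = V"
        by (rule card_subset_eq) (use fin M a card_mono[OF fin, of "{v\<in>V. m \<le> dg E v}"] in auto)
      then show ?thesis using a by auto
    next
      assume "m = c"
      then show ?thesis using R0 M by auto
    qed
  qed
  show ?thesis by (rule clique)
qed

text \<open>Induction on \<open>s\<close>: delete a vertex of maximum degree. When the resulting clique cannot be extended,
  delete a vertex of minimum degree, or apply the flat case.\<close>

theorem pot_clique_many_high:
  assumes "simple_graph (V, E)" "2 * s \<le> card {v\<in>V. s \<le> dg E v + 1}"
  shows "pot_clique V E s"
  using assms
proof (induction s arbitrary: V E)
  case 0
  then show ?case unfolding pot_clique_def using same_deg_refl by (intro exI[of _ E] exI[of _ "{}"]) auto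
next
  case (Suc m)
  note outer = Suc.IH
  from Suc.prems show ?case
  proof (induction "card V" arbitrary: V E rule: less_induct)
    case less
    have s: "simple_graph (V, E)" by fact
    have fin: "finite V" using simple_finite[OF s] .
    have M: "2 * m + 2 \<le> card {v\<in>V. m \<le> dg E v}" using less.prems(2) by simp
    then have "{v\<in>V. m \<le> dg E v} \<noteq> {}" by (metis add_is_0 card.empty le_zero_eq numeral_eq_Suc old.nat.distinct(1))
    then have "V \<noteq> {}" by blast
    then obtain v where v: "v \<in> V" "\<forall>x\<in>V. dg E x \<le> dg E v" using ex_max_dg[OF fin] by blast
    obtain E1 where E1: "same_deg V E E1" "\<forall>x\<in>nb E1 v. \<forall>y\<in>V-{v}-nb E1 v. dg E y \<le> dg E x"
      using lay_off_vertex[OF s v(1)] by blast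
    have s1: "simple_graph (V, E1)" using same_deg_simple[OF E1(1)] .
    have nbV: "nb E1 v \<subseteq> V - {v}" using nb_sub[OF s1] .
    have p: "pot_clique (V - {v}) (del_vertex E1 v) m"
    proof (rule outer[OF simple_del_vertex[OF s1]])
      have "{x\<in>V. m \<le> dg E x} - {v} \<subseteq> {x\<in>V - {v}. m \<le> dg (del_vertex E1 v) x + 1}"
      proof
        fix x assume "x \<in> {x\<in>V. m \<le> dg E x} - {v}"
        then show "x \<in> {x\<in>V - {v}. m \<le> dg (del_vertex E1 v) x + 1}"
          using dg_del_vertex[OF s1, of x v] same_deg_dg[OF E1(1), of x] by (auto split: if_splits)
      qed
      then have "card ({x\<in>V. m \<le> dg E x} - {v}) \<le> card {x\<in>V - {v}. m \<le> dg (del_vertex E1 v) x + 1}"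
        using fin by (intro card_mono) auto
      then show "2 * m \<le> card {x\<in>V - {v}. m \<le> dg (del_vertex E1 v) x + 1}"
        using M card_Diff_singleton_if[of "{x\<in>V. m \<le> dg E x}" v] by (simp split: if_splits)
    qed
    have "pot_clique V E1 (Suc m) \<or>
      (\<exists>c. card {x\<in>V. c < dg E1 x} \<le> m \<and> dg E1 v + 2 \<le> card {x\<in>V. c \<le> dg E1 x})"
    proof (rule extend_clique[OF s1 v(1) _ _ p])
      show "\<forall>x\<in>V. dg E1 x \<le> dg E1 v" using v same_deg_dg[OF E1(1)] by simp
      have "dg E1 x = dg E x" if "x \<in> V" for x using same_deg_dg[OF E1(1) that] .
      then show "\<forall>x\<in>nb E1 v. \<forall>y\<in>V - {v} - nb E1 v. dg E1 y \<le> dg E1 x" using E1(2) nbV by (metis Diff_iff subsetD)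
    qed
    then consider "pot_clique V E1 (Suc m)" |
      c where "card {x\<in>V. c < dg E1 x} \<le> m" "dg E1 v + 2 \<le> card {x\<in>V. c \<le> dg E1 x}" by blast
    then show ?case
    proof cases
      case 1 then show ?thesis using pot_clique_same_deg[OF E1(1)] by blast
    next
      case (2 c)
      have sets: "{x\<in>V. c < dg E1 x} = {x\<in>V. c < dg E x}" "{x\<in>V. c \<le> dg E1 x} = {x\<in>V. c \<le> dg E x}"
        using same_deg_dg[OF E1(1)] by auto
      have c: "card {x\<in>V. c < dg E x} \<le> m" "dg E v + 2 \<le> card {x\<in>V. c \<le> dg E x}"
        using 2 sets same_deg_dg[OF E1(1) v(1)] by auto
      have mc: "m \<le> c"
      proof (rule ccontr)
        assume "\<not> m \<le> c"
        then have "{x\<in>V. m \<le> dg E x} \<subseteq> {x\<in>V. c < dg E x}" by auto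
        then have "card {x\<in>V. m \<le> dg E x} \<le> card {x\<in>V. c < dg E x}" using fin by (intro card_mono) auto
        then show False using M c(1) by simp
      qed
      have cV: "2 * m + 2 \<le> card V" using M card_mono[OF fin, of "{v\<in>V. m \<le> dg E v}"] by auto
      show ?thesis
      proof (cases "card V = 2 * m + 2 \<or> m = c")
        case True
        then show ?thesis using pot_clique_flat[OF s _ mc c M] v by blast
      next
        case False
        obtain w where w: "w \<in> V" "\<forall>x\<in>V. dg E w \<le> dg E x" using ex_min_dg[OF fin \<open>V \<noteq> {}\<close>] by blast
        obtain E2 where E2: "same_deg V E E2" "\<forall>x\<in>nb E2 w. \<forall>y\<in>V-{w}-nb E2 w. dg E y \<le> dg E x"
          using lay_off_vertex[OF s w(1)] by blast
        have s2: "simple_graph (V, E2)" using same_deg_simple[OF E2(1)] .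
        \<comment> \<open>\<open>w\<close> has at most \<open>dg E v\<close> neighbours, but at
          least \<open>dg E v + 2\<close> vertices have degree at least \<open>c\<close>. Laid off
          to the top, \<open>w\<close> is therefore joined only to such vertices; since
          \<open>c > m\<close>, they keep degree at least \<open>m\<close> when \<open>w\<close> is
          deleted.\<close>
        have nbc: "c \<le> dg E x" if x: "x \<in> nb E2 w" for x
        proof (rule ccontr)
          assume no: "\<not> c \<le> dg E x"
          have "{y\<in>V. c \<le> dg E y} \<subseteq> insert w (nb E2 w - {x})"
          proof
            fix y assume y: "y \<in> {y\<in>V. c \<le> dg E y}"
            then have "\<not> dg E y \<le> dg E x" using no by auto
            then have "y \<notin> V - {w} - nb E2 w" using E2(2) x by blast
            then show "y \<in> insert w (nb E2 w - {x})" using y no by auto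
          qed
          then have "card {y\<in>V. c \<le> dg E y} \<le> card (insert w (nb E2 w - {x}))"
            using finite_nb[OF s2] by (intro card_mono) auto
          also have "\<dots> \<le> Suc (card (nb E2 w))" 
          proof -
            have "card (insert w (nb E2 w - {x})) \<le> Suc (card (nb E2 w - {x}))"
              using finite_nb[OF s2, of w] by (simp only: card_insert_if finite_Diff) simp
            then show ?thesis using card_Diff1_le[of "nb E2 w" x] by linarith
          qed
          also have "\<dots> \<le> Suc (dg E v)" using same_deg_dg[OF E2(1) w(1)] v w(1) by (simp add: dg_def)
          finally show False using c(2) by simp
        qed
        have "pot_clique (V - {w}) (del_vertex E2 w) (Suc m)"
        proof (rule less.hyps)
          show "card (V - {w}) < card V" using w(1) fin by (metis card_Diff1_less)
          show "simple_graph (V - {w}, del_vertex E2 w)" using simple_del_vertex[OF s2] .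
          have "{x\<in>V. m \<le> dg E x} - {w} \<subseteq> {x\<in>V - {w}. m \<le> dg (del_vertex E2 w) x}"
          proof
            fix x assume x: "x \<in> {x\<in>V. m \<le> dg E x} - {w}"
            have "m < dg E x" if "x \<in> nb E2 w" using nbc[OF that] mc False by simp
            then show "x \<in> {x\<in>V - {w}. m \<le> dg (del_vertex E2 w) x}"
              using dg_del_vertex[OF s2, of x w] same_deg_dg[OF E2(1), of x] x by (auto split: if_splits)
          qed
          then have "card ({x\<in>V. m \<le> dg E x} - {w}) \<le> card {x\<in>V - {w}. m \<le> dg (del_vertex E2 w) x}"
            using fin by (intro card_mono) auto
          moreover have "2 * m + 2 \<le> card ({x\<in>V. m \<le> dg E x} - {w})"
          \<comment> \<open>If the minimum degree is at least \<open>m\<close>, the loss of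
            \<open>w\<close> itself is affordable: all vertices count, and \<open>card V\<close>
            exceeds \<open>2 * m + 2\<close>.\<close>
          proof (cases "m \<le> dg E w")
            case True
            have cases: "2 * m + 2 < card V" using \<open>\<not> (card V = 2 * m + 2 \<or> m = c)\<close> cV by linarith
            have "{x\<in>V. m \<le> dg E x} = V" using True w by fastforce
            moreover have "card (V - {w}) = card V - 1" using w(1) fin by simp
            ultimately show ?thesis using cases by (simp only:)
          next
            case False
            then have "{x\<in>V. m \<le> dg E x} - {w} = {x\<in>V. m \<le> dg E x}" by auto
            then show ?thesis using M by simp
          qed
          ultimately show "2 * Suc m \<le> card {x\<in>V - {w}. Suc m \<le> dg (del_vertex E2 w) x + 1}" by simp
        qed
        then show ?thesis using pot_clique_same_deg[OF E2(1) pot_clique_del_vertex[OF s2 w(1)]] by blast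
      qed
    qed
  qed
qed

text \<open>The obstruction of \<open>extend_clique\<close> would supply \<open>2 * m + 2\<close>
  vertices of degree at least \<open>c \<ge> m\<close>, and then \<open>pot_clique_many_high\<close>
  applies. In the induction for trees this disposes of graphs with a large maximum degree.\<close>

lemma pot_clique_large_max:
  assumes s: "simple_graph (V, E)" and v: "v \<in> V" "\<forall>x\<in>V. dg E x \<le> dg E v"
    and top: "\<forall>x\<in>nb E v. \<forall>y\<in>V-{v}-nb E v. dg E y \<le> dg E x"
    and m: "Suc m \<le> card {x\<in>V. m \<le> dg E x}" "2 * m \<le> dg E v"
    and p: "pot_clique (V - {v}) (del_vertex E v) m"
  shows "pot_clique V E (Suc m)"
proof (rule ccontr)
  assume no: "\<not> ?thesis"
  have fin: "finite V" using simple_finite[OF s] .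
  obtain c where c: "card {x\<in>V. c < dg E x} \<le> m" "dg E v + 2 \<le> card {x\<in>V. c \<le> dg E x}"
    using extend_clique[OF s v top p] no by blast
  have "m \<le> c"
  proof (rule ccontr)
    assume "\<not> m \<le> c"
    then have "{x\<in>V. m \<le> dg E x} \<subseteq> {x\<in>V. c < dg E x}" by auto
    then have "card {x\<in>V. m \<le> dg E x} \<le> card {x\<in>V. c < dg E x}" using fin by (intro card_mono) auto
    then show False using m c(1) by simp
  qed
  then have "{x\<in>V. c \<le> dg E x} \<subseteq> {x\<in>V. m \<le> dg E x}" by auto
  then have "card {x\<in>V. c \<le> dg E x} \<le> card {x\<in>V. m \<le> dg E x}" using fin by (intro card_mono) auto
  then have "2 * Suc m \<le> card {x\<in>V. Suc m \<le> dg E x + 1}" using c(2) m(2) by simp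
  then show False using pot_clique_many_high[OF s] no by blast
qed

section \<open>Embedding forests into the complement\<close>

text \<open>Every subset of \<open>A\<close> induces a vertex of degree at most one; for finite \<open>A\<close> this says that \<open>Q\<close> is a forest on \<open>A\<close>.\<close>

definition forest_on :: "('a \<Rightarrow> 'a \<Rightarrow> bool) \<Rightarrow> 'a set \<Rightarrow> bool" where
  "forest_on Q A \<longleftrightarrow> (\<forall>B\<subseteq>A. B \<noteq> {} \<longrightarrow> (\<exists>x\<in>B. card {y\<in>B. Q x y} \<le> 1))"

lemma forest_on_vertex:
  assumes "forest_on Q A" "B \<subseteq> A" "B \<noteq> {}"
  obtains x where "x \<in> B" "card {y\<in>B. Q x y} \<le> 1"
proof -
  have "\<exists>x\<in>B. card {y\<in>B. Q x y} \<le> 1" using assms(1)[unfolded forest_on_def, rule_format, OF assms(2,3)] .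
  then show ?thesis using that by blast
qed

lemma forest_on_subset:
  assumes "forest_on Q A" "B \<subseteq> A"
  shows "forest_on Q B"
  unfolding forest_on_def
proof (intro allI impI)
  fix C assume "C \<subseteq> B" "C \<noteq> {}"
  then obtain x where "x \<in> C" "card {y\<in>C. Q x y} \<le> 1"
    using forest_on_vertex[OF assms(1), of C] assms(2) by blast
  then show "\<exists>x\<in>C. card {y\<in>C. Q x y} \<le> 1" by blast
qed

lemma emb_extend:
  assumes s: "simple_graph (V, E)" and Q: "\<And>x y. Q x y \<Longrightarrow> Q y x" and e: "emb False V E A Q f"
    and x: "x \<notin> A" and v: "v \<in> V" "v \<notin> f ` A" and n: "\<And>y. y \<in> A \<Longrightarrow> Q x y \<Longrightarrow> \<not> E v (f y)"
  shows "emb False V E (insert x A) Q (f(x := v))"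
  unfolding emb_def
proof (intro conjI ballI impI)
  show "inj_on (f(x := v)) (insert x A)" using e x v(2) by (auto simp: emb_def inj_on_def)
  show "(f(x := v)) ` insert x A \<subseteq> V" using e v(1) by (auto simp: emb_def)
  fix a b assume ab: "a \<in> insert x A" "b \<in> insert x A" "a \<noteq> b" "Q a b"
  have e': "\<not> E (f p) (f q)" if "p \<in> A" "q \<in> A" "p \<noteq> q" "Q p q" for p q
    using e that by (simp add: emb_def)
  consider "a = x" "b \<in> A" | "b = x" "a \<in> A" | "a \<in> A" "b \<in> A" using ab by blast
  then show "E ((f(x := v)) a) ((f(x := v)) b) = False"
  proof cases
    case 1
    then have "\<not> E v (f b)" using n ab(4) by simp
    then show ?thesis using 1 ab(3) by simp
  next
    case 2
    then have "\<not> E v (f a)" using n Q[OF ab(4)] by simp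
    then have "\<not> E (f a) v" using simple_sym[OF s] by blast
    then show ?thesis using 2 ab(3) by simp
  next
    case 3
    then have "a \<noteq> x" "b \<noteq> x" using x by auto
    then show ?thesis using e'[OF 3 ab(3,4)] by simp
  qed
qed

text \<open>A greedy embedding with a list \<open>L x\<close> of positions for each
  \<open>x\<close>. In a forest the vertices can be inserted so that each has at most one neighbour
  already placed. \<open>X\<close> stands for the occupied positions; those in \<open>L x\<close>
  come from vertices whose lists meet \<open>L x\<close>.\<close>

lemma greedy_forest:
  assumes s: "simple_graph (V, E)" and Q: "\<And>x y. Q x y \<Longrightarrow> Q y x" and fin: "finite A" and "forest_on Q A"
    and L: "\<And>x. x \<in> A \<Longrightarrow> L x \<subseteq> V"
    and room: "\<And>x y v X. x \<in> A \<Longrightarrow> y \<in> A \<Longrightarrow> x \<noteq> y \<Longrightarrow> Q x y \<Longrightarrow> v \<in> L y \<Longrightarrow> X \<subseteq> \<Union>(L ` A) \<Longrightarrow> 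
       card (X \<inter> L x) \<le> card {z\<in>A-{x}. L z \<inter> L x \<noteq> {}} \<Longrightarrow> \<not> L x \<subseteq> X \<union> nb E v"
    and room0: "\<And>x X. x \<in> A \<Longrightarrow> X \<subseteq> \<Union>(L ` A) \<Longrightarrow> 
       card (X \<inter> L x) \<le> card {z\<in>A-{x}. L z \<inter> L x \<noteq> {}} \<Longrightarrow> \<not> L x \<subseteq> X"
  shows "\<exists>f. emb False V E A Q f \<and> (\<forall>x\<in>A. f x \<in> L x)"
proof -
  have "\<exists>f. emb False V E B Q f \<and> (\<forall>x\<in>B. f x \<in> L x)" if "B \<subseteq> A" for B
  proof -
    have "finite B" using that fin finite_subset by blast
    then show ?thesis using that
    proof (induction B rule: finite_remove_induct)
      case empty
      then show ?case by (auto simp: emb_def)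
    next
      case (remove B)
      obtain x where x: "x \<in> B" "card {y\<in>B. Q x y} \<le> 1"
        using forest_on_vertex[OF assms(4) remove.prems remove.hyps(2)] .
      obtain f where f: "emb False V E (B - {x}) Q f" "\<forall>z\<in>B-{x}. f z \<in> L z"
        using remove.IH[OF x(1)] remove.prems by blast
      let ?X = "f ` (B - {x})"
      have XU: "?X \<subseteq> \<Union>(L ` A)" using f(2) remove.prems by blast
      have finA: "finite {z\<in>A-{x}. L z \<inter> L x \<noteq> {}}" using fin by simp
      have "?X \<inter> L x \<subseteq> f ` {z\<in>B-{x}. L z \<inter> L x \<noteq> {}}" using f(2) by blast
      then have "card (?X \<inter> L x) \<le> card (f ` {z\<in>B-{x}. L z \<inter> L x \<noteq> {}})"
        using remove.hyps(1) by (intro card_mono) auto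
      also have "\<dots> \<le> card {z\<in>B-{x}. L z \<inter> L x \<noteq> {}}" using remove.hyps(1) by (intro card_image_le) auto
      also have "\<dots> \<le> card {z\<in>A-{x}. L z \<inter> L x \<noteq> {}}" using remove.prems finA by (intro card_mono) auto
      finally have cX: "card (?X \<inter> L x) \<le> card {z\<in>A-{x}. L z \<inter> L x \<noteq> {}}" .
      have xA: "x \<in> A" using x remove.prems by blast
      obtain v where v: "v \<in> L x" "v \<notin> ?X" "\<And>y. y \<in> B - {x} \<Longrightarrow> Q x y \<Longrightarrow> \<not> E v (f y)"
      proof (cases "\<exists>y\<in>B-{x}. Q x y")
        case True
        then obtain y where y: "y \<in> B" "y \<noteq> x" "Q x y" by blast
        have uniq: "z = y" if "z \<in> B - {x}" "Q x z" for z
        proof (rule ccontr)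
          assume "z \<noteq> y"
          then have "card {z,y} = 2" by simp
          moreover have "card {z,y} \<le> card {y\<in>B. Q x y}" 
            using that y remove.hyps(1) by (intro card_mono) auto
          ultimately show False using x(2) by simp
        qed
        have "\<not> L x \<subseteq> ?X \<union> nb E (f y)"
          using room[OF xA _ _ y(3) _ XU cX] y f(2) remove.prems by blast
        then obtain v where v: "v \<in> L x" "v \<notin> ?X" "\<not> E (f y) v" unfolding nb_def by blast
        then have "\<not> E v (f y)" using simple_sym[OF s] by blast
        then show ?thesis using that[OF v(1,2)] uniq by blast
      next
        case False
        then show ?thesis using room0[OF xA XU cX] that by blast
      qed
      have "v \<in> V" using v(1) L[OF xA] by blast
      then have "emb False V E (insert x (B - {x})) Q (f(x := v))"
        using emb_extend[OF s Q f(1) _ _ v(2,3)] by blast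
      moreover have "insert x (B - {x}) = B" using x(1) by blast
      moreover have "\<forall>z\<in>B. (f(x := v)) z \<in> L z" using f(2) v(1) by simp
      ultimately show ?case by metis
    qed
  qed
  then show ?thesis by blast
qed

text \<open>The size of \<open>A\<close> leaves \<open>2 * s - 1\<close> vertices for the high ones.
  With fewer than \<open>s\<close> high vertices the low ones have room for the greedy embedding.
  Otherwise a vertex \<open>w\<close> of minimum degree, at most \<open>s - 2\<close>, is laid off
  to high vertices only; it is then compatible with every low vertex and can host one vertex of the
  forest.\<close>

lemma low_forest:
  assumes "simple_graph (V, E)" "\<not> pot_clique V E s" "2 \<le> s" "finite A" "forest_on Q A"
    and Q: "\<And>x y. Q x y \<Longrightarrow> Q y x" and "card A + 2 * s \<le> card V + 1"
  shows "\<exists>E' f. same_deg V E E' \<and> emb False V E' A Q f \<and> (\<forall>a\<in>A. dg E (f a) + 2 \<le> s)"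
  using assms(1,2,4,5,7)
proof (induction "card A" arbitrary: V E A)
  case 0
  then have "emb False V E A Q f" for f :: "'b \<Rightarrow> 'a" by (simp add: emb_def)
  then show ?case using same_deg_refl[OF 0(2)] 0 by auto
next
  case (Suc n)
  note s = Suc.prems(1)
  have fin: "finite V" using simple_finite[OF s] .
  define Hi where "Hi = {v\<in>V. s \<le> dg E v + 1}"
  define L where "L = V - Hi"
  have cHi: "card Hi < 2 * s" using pot_clique_many_high[OF s, of s] Suc.prems(2) unfolding Hi_def by linarith
  have HiV: "Hi \<subseteq> V" "finite Hi" using fin by (auto simp: Hi_def)
  have cL: "card L = card V - card Hi" "finite L" using HiV fin by (simp_all add: L_def card_Diff_subset)
  have Ldg: "dg E v + 2 \<le> s" if "v \<in> L" for v using that by (auto simp: L_def Hi_def)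
  show ?case
  proof (cases "card Hi < s")
    case True
    have L2: "card A + s \<le> card L" using cL Suc.prems(5) True by simp
    have "\<exists>f. emb False V E A Q f \<and> (\<forall>x\<in>A. f x \<in> L)"
    proof (rule greedy_forest[OF s Q Suc.prems(3,4)])
      fix x :: 'b and X assume x: "x \<in> A" and "card (X \<inter> L) \<le> card {z \<in> A - {x}. L \<inter> L \<noteq> {}}"
      moreover have "card {z \<in> A - {x}. L \<inter> L \<noteq> {}} \<le> card (A - {x})" using Suc.prems(3) by (intro card_mono) auto
      ultimately have cX: "card (X \<inter> L) < card A"
        using card_Diff1_less[OF Suc.prems(3) x] by linarith
      show "\<not> L \<subseteq> X"
      proof
        assume "L \<subseteq> X"
        then have "X \<inter> L = L" by blast
        then show False using cX L2 by simp
      qed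
      fix v assume v: "v \<in> L"
      show "\<not> L \<subseteq> X \<union> nb E v"
      proof
        assume "L \<subseteq> X \<union> nb E v"
        then have "L \<subseteq> (X \<inter> L) \<union> nb E v" by blast
        then have "card L \<le> card ((X \<inter> L) \<union> nb E v)" using cL(2) finite_nb[OF s] by (intro card_mono) auto
        also have "\<dots> \<le> card (X \<inter> L) + dg E v" unfolding dg_def by (rule card_Un_le)
        finally show False using cX L2 Ldg[OF v] by linarith
      qed
    qed (auto simp: L_def)
    then show ?thesis using same_deg_refl[OF s] Ldg by blast
  next
    case False
    have "card L > 0" using cL cHi Suc by simp
    then have "L \<noteq> {}" by fastforce
    then obtain l where l: "l \<in> L" by blast
    then have "V \<noteq> {}" by (auto simp: L_def)
    then obtain w where w: "w \<in> V" "\<forall>x\<in>V. dg E w \<le> dg E x" using ex_min_dg[OF fin] by blast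
    have wdg: "dg E w + 2 \<le> s" using w(2) l Ldg[OF l] by (auto simp: L_def)
    then have wL: "w \<in> L" using w by (auto simp: L_def Hi_def)
    obtain E1 where E1: "same_deg V E E1" "\<forall>x\<in>nb E1 w. \<forall>y\<in>V-{w}-nb E1 w. dg E y \<le> dg E x"
      using lay_off_vertex[OF s w(1)] by blast
    have s1: "simple_graph (V, E1)" using same_deg_simple[OF E1(1)] .
    have nbV: "nb E1 w \<subseteq> V - {w}" using nb_sub[OF s1] .
    have nbHi: "nb E1 w \<subseteq> Hi"
    proof (rule ccontr)
      assume "\<not> nb E1 w \<subseteq> Hi"
      then obtain x where x: "x \<in> nb E1 w" "x \<notin> Hi" by blast
      have "Hi \<subseteq> nb E1 w"
      proof
        fix y assume y: "y \<in> Hi"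
        have "x \<in> V" using x nbV by blast
        then have "\<not> dg E y \<le> dg E x" using x y by (auto simp: Hi_def)
        then have "y \<notin> V - {w} - nb E1 w" using E1(2) x(1) by blast
        moreover have "y \<noteq> w" using y wL by (auto simp: L_def)
        ultimately show "y \<in> nb E1 w" using y HiV by blast
      qed
      then have "card Hi \<le> dg E1 w" unfolding dg_def using finite_nb[OF s1] by (intro card_mono) auto
      then show False using False wdg same_deg_dg[OF E1(1) w(1)] by simp
    qed
    obtain x A' where x: "A = insert x A'" "x \<notin> A'" using Suc.hyps(2) card_eq_SucD[of A n] by metis
    have finA': "finite A'" using x Suc.prems(3) by simp
    have cA': "card A' = n" using x Suc.hyps(2) Suc.prems(3) by simp
    let ?E1 = "del_vertex E1 w"
    have sd: "simple_graph (V - {w}, ?E1)" using simple_del_vertex[OF s1] .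
    have np: "\<not> pot_clique (V - {w}) ?E1 s"
      using Suc.prems(2) pot_clique_same_deg[OF E1(1) pot_clique_del_vertex[OF s1 w(1)]] by blast
    have fA': "forest_on Q A'" using Suc.prems(4) x(1) forest_on_subset by blast
    have cVw: "card (V - {w}) = card V - 1" "card V > 0" using w(1) fin card_gt_0_iff by auto
    have ca: "card A' + 2 * s \<le> card (V - {w}) + 1" using Suc.prems(5) cVw cA' Suc.hyps(2) by simp
    obtain E2 f where E2: "same_deg (V - {w}) ?E1 E2" "emb False (V - {w}) E2 A' Q f" "\<forall>a\<in>A'. dg ?E1 (f a) + 2 \<le> s"
      using Suc.hyps(1)[OF cA'[symmetric] sd np finA' fA' ca] by blast
    \<comment> \<open>A high vertex joined to \<open>w\<close> may count as low in the smaller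
      graph, with degree exactly \<open>s - 2\<close> there. The embedding is relocated from such
      vertices to vertices of \<open>L - {w}\<close>, whose degrees are no larger.\<close>
    define Z where "Z = {y\<in>Hi. dg E2 y + 2 = s}"
    have dgE: "dg E y = dg ?E1 y + (if y \<in> nb E1 w then 1 else 0)" if "y \<in> V - {w}" for y
      using dg_del_vertex[OF s1, of y w] same_deg_dg[OF E1(1), of y] that by simp
    have "\<exists>E3 f'. same_deg (V - {w}) E2 E3 \<and> emb False (V - {w}) E3 A' Q f' \<and> f' ` A' \<subseteq> L - {w}"
    proof (rule relocate[OF same_deg_simple[OF E2(1)] E2(2) finA', where Z = Z])
      show "f ` A' \<subseteq> (L - {w}) \<union> Z"
      proof
        fix y assume "y \<in> f ` A'"
        then have y: "y \<in> V - {w}" "dg ?E1 y + 2 \<le> s" using E2(2,3) by (auto simp: emb_def)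
        show "y \<in> (L - {w}) \<union> Z"
        proof (cases "y \<in> Hi")
          case True
          then have "s \<le> dg E y + 1" by (simp add: Hi_def)
          then have "dg ?E1 y + 2 = s" using y dgE[OF y(1)] by (auto split: if_splits)
          then show ?thesis using True same_deg_dg[OF E2(1) y(1)] by (simp add: Z_def)
        qed (use y in \<open>auto simp: L_def\<close>)
      qed
      show "L - {w} \<union> Z \<subseteq> V - {w}" using wL HiV by (auto simp: L_def Z_def)
      show "card A' \<le> card (L - {w})" using wL cL cHi Suc.prems(5) cA' Suc.hyps(2) by simp
      have "dg E2 x \<le> dg E2 y" if "y \<in> Z" "x \<in> L - {w}" for x y
      proof -
        have xV: "x \<in> V - {w}" using that(2) by (auto simp: L_def)
        then have "dg E2 x + 2 \<le> s" using dgE[OF xV] same_deg_dg[OF E2(1) xV] Ldg[of x] that(2) by simp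
        then show ?thesis using that(1) by (auto simp: Z_def)
      qed
      then show "\<forall>y\<in>Z. \<forall>x\<in>L - {w}. if False then dg E2 y \<le> dg E2 x else dg E2 x \<le> dg E2 y" by simp
    qed
    then obtain E3 f' where E3: "same_deg (V - {w}) E2 E3" "emb False (V - {w}) E3 A' Q f'" "f' ` A' \<subseteq> L - {w}" by blast
    define E4 where "E4 = add_vertex E3 w (nb E1 w)"
    have E4: "same_deg V E1 E4" unfolding E4_def by (rule same_deg_add_vertex[OF s1 w(1) same_deg_trans[OF E2(1) E3(1)]])
    have e4: "emb False V E4 A' Q f'"
      unfolding emb_def
    proof (intro conjI ballI impI)
      show "inj_on f' A'" "f' ` A' \<subseteq> V" using E3(2) by (auto simp: emb_def)
      fix a b assume ab: "a \<in> A'" "b \<in> A'" "a \<noteq> b" "Q a b"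
      have "f' a \<noteq> w" "f' b \<noteq> w" using E3(3) ab by auto
      moreover have "\<not> E3 (f' a) (f' b)" using E3(2) ab by (simp add: emb_def)
      ultimately show "E4 (f' a) (f' b) = False" by (simp add: E4_def add_vertex_def)
    qed
    have e: "emb False V E4 (insert x A') Q (f'(x := w))"
    proof (rule emb_extend[OF same_deg_simple[OF E4] Q e4 x(2) w(1)])
      show "w \<notin> f' ` A'" using E3(3) by blast
      fix y assume y: "y \<in> A'" "Q x y"
      have "f' y \<notin> nb E1 w" "f' y \<noteq> w" using E3(3) nbHi y(1) by (auto simp: L_def simp del: in_nb)
      then show "\<not> E4 w (f' y)"
        using simple_in1[OF same_deg_simple[OF E3(1)], of w "f' y"] by (auto simp: E4_def add_vertex_def)
    qed
    have "\<forall>a\<in>insert x A'. dg E ((f'(x := w)) a) + 2 \<le> s" using E3(3) Ldg wL by auto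
    then show ?thesis using e same_deg_trans[OF E1(1) E4] x(1) by blast
  qed
qed

section \<open>Trees\<close>

text \<open>Put a vertex with at most one neighbour into \<open>I\<close> and discard that
  neighbour: at most two vertices are spent for each one gained.\<close>

lemma forest_independent:
  assumes "finite C" "forest_on Q C" and Q: "\<And>x y. Q x y \<Longrightarrow> Q y x" "\<And>x. \<not> Q x x"
  shows "\<exists>I\<subseteq>C. card C \<le> 2 * card I \<and> (\<forall>x\<in>I. \<forall>y\<in>I. \<not> Q x y)"
  using assms(1,2)
proof (induction "card C" arbitrary: C rule: less_induct)
  case less
  show ?case
  proof (cases "C = {}")
    case True then show ?thesis by auto
  next
    case False
    then obtain x where x: "x \<in> C" "card {y\<in>C. Q x y} \<le> 1" using forest_on_vertex[OF less.prems(2) order_refl] by blast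
    define C' where "C' = C - insert x {y\<in>C. Q x y}"
    have sub: "C' \<subseteq> C" "C' \<subset> C" using x by (auto simp: C'_def)
    have "card C' < card C" using sub less.prems(1) by (simp add: psubset_card_mono)
    moreover have "finite C'" using sub less.prems(1) finite_subset by blast
    ultimately obtain I where I: "I \<subseteq> C'" "card C' \<le> 2 * card I" "\<forall>x\<in>I. \<forall>y\<in>I. \<not> Q x y"
      using less.hyps[of C'] forest_on_subset[OF less.prems(2) sub(1)] by blast
    have xI: "x \<notin> I" using I(1) by (auto simp: C'_def)
    have finI: "finite I" using I(1) \<open>finite C'\<close> finite_subset by blast
    have "card (insert x {y\<in>C. Q x y}) \<le> 2" using x(2) less.prems(1) by (simp add: card_insert_if)
    moreover have "card C' = card C - card (insert x {y\<in>C. Q x y})"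
      unfolding C'_def using less.prems(1) x(1) by (intro card_Diff_subset) auto
    ultimately have "card C \<le> 2 * card (insert x I)" using I(2) xI finI by simp
    moreover have "\<forall>a\<in>insert x I. \<forall>b\<in>insert x I. \<not> Q a b"
    proof (intro ballI notI)
      fix a b assume ab: "a \<in> insert x I" "b \<in> insert x I" "Q a b"
      have no: "\<not> Q x y" if "y \<in> I" for y using that I(1) by (auto simp: C'_def)
      show False using ab no Q I(3) by (metis insertE)
    qed
    moreover have "insert x I \<subseteq> C" using x I(1) sub by blast
    ultimately show ?thesis by blast
  qed
qed

text \<open>All neighbours in \<open>B\<close> of the first vertex of a longest path in
  \<open>B\<close> lie on the path, and a second one closes a cycle.\<close>

lemma acyclic_forest:
  assumes s: "simple_graph (X, Q)" and acyc: "\<not> has_cycle (X, Q)"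
  shows "forest_on Q X"
  unfolding forest_on_def
proof (intro allI impI, rule ccontr)
  fix B assume B: "B \<subseteq> X" "B \<noteq> {}" and no: "\<not> (\<exists>x\<in>B. card {y\<in>B. Q x y} \<le> 1)"
  have finB: "finite B" using B simple_finite[OF s] finite_subset by blast
  define pth where "pth = (\<lambda>vs. vs \<noteq> [] \<and> distinct vs \<and> set vs \<subseteq> B \<and> (\<forall>i. Suc i < length vs \<longrightarrow> Q (vs ! i) (vs ! Suc i)))"
  obtain b where "b \<in> B" using B by blast
  then have p1: "pth [b]" by (simp add: pth_def)
  have p2: "length vs \<le> card B" if "pth vs" for vs
  proof -
    have "card (set vs) \<le> card B" using that finB by (intro card_mono) (auto simp: pth_def)
    then show ?thesis using that by (simp add: pth_def distinct_card)
  qed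
  then have "\<exists>vs. pth vs \<and> (\<forall>us. pth us \<longrightarrow> length us \<le> length vs)"
    using ex_has_greatest_nat[of pth "[b]" length "Suc (card B)"] p1 by (simp add: less_Suc_eq_le)
  then obtain vs where vs: "pth vs" "\<forall>us. pth us \<longrightarrow> length us \<le> length vs" by blast
  obtain v ws where vw: "vs = v # ws" using vs(1) by (cases vs) (auto simp: pth_def)
  have vB: "v \<in> B" using vs(1) vw by (simp add: pth_def)
  have inw: "y \<in> set ws" if y: "y \<in> B" "Q v y" for y
  proof (rule ccontr)
    assume nw: "y \<notin> set ws"
    have "y \<noteq> v" using y simple_irrefl[OF s, of v] by auto
    have "pth (y # vs)"
      unfolding pth_def
    proof (intro conjI allI impI)
      show "distinct (y # vs)" using vs(1) vw nw \<open>y \<noteq> v\<close> by (simp add: pth_def)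
      show "set (y # vs) \<subseteq> B" using vs(1) y by (simp add: pth_def)
      fix i assume i: "Suc i < length (y # vs)"
      show "Q ((y # vs) ! i) ((y # vs) ! Suc i)"
      proof (cases i)
        case 0 then show ?thesis using simple_sym[OF s y(2)] vw by simp
      next
        case (Suc j) then show ?thesis using vs(1) i by (simp add: pth_def)
      qed
    qed simp
    then show False using vs(2) by fastforce
  qed
  \<comment> \<open>For empty \<open>ws\<close> the value \<open>ws ! 0\<close> is unspecified,
    which is harmless: no singleton contains two neighbours.\<close>
  have "\<not> {y\<in>B. Q v y} \<subseteq> {ws ! 0}"
  proof
    assume "{y\<in>B. Q v y} \<subseteq> {ws ! 0}"
    then have "card {y\<in>B. Q v y} \<le> card {ws ! 0}" by (intro card_mono) auto
    then show False using no vB by auto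
  qed
  then obtain y where y: "y \<in> B" "Q v y" "y \<noteq> ws ! 0" by blast
  obtain k where k: "k < length ws" "ws ! k = y" using inw[OF y(1,2)] by (meson in_set_conv_nth)
  have k0: "0 < k" using k y(3) by (cases k) auto
  let ?c = "take (k + 2) vs"
  have len: "length ?c = k + 2" using k vw by simp
  have "has_cycle (X, Q)"
    unfolding has_cycle_def fst_conv snd_conv
  proof (intro exI[of _ ?c] conjI allI impI)
    show "3 \<le> length ?c" using len k0 by simp
    show "distinct ?c" using vs(1) by (simp add: pth_def)
    show "set ?c \<subseteq> X" using vs(1) B(1) set_take_subset[of "k+2" vs] by (auto simp: pth_def)
    show "Q (?c ! i) (?c ! Suc i)" if "Suc i < length ?c" for i
      using that vs(1) by (simp add: pth_def)
    have "?c \<noteq> []" using len by auto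
    then have "last ?c = ?c ! (k + 1)" using len by (simp add: last_conv_nth)
    then have "last ?c = y" using k vw by simp
    moreover have "hd ?c = v" using vw by simp
    ultimately show "Q (last ?c) (hd ?c)" using simple_sym[OF s y(2)] by simp
  qed
  then show False using acyc by blast
qed

section \<open>Degrees and leaves of a tree\<close>

locale tree_graph =
  fixes X :: "'a set" and Q :: "'a \<Rightarrow> 'a \<Rightarrow> bool"
  assumes tree: "is_tree (X, Q)"
begin

lemma simple: "simple_graph (X, Q)"
  using tree by (simp add: is_tree_def)

lemma finX: "finite X"
  using simple_finite[OF simple] .

lemma X_ne: "X \<noteq> {}"
  using tree by (simp add: is_tree_def connected_graph_def)

lemma sym: "Q x y \<Longrightarrow> Q y x"
  using simple_sym[OF simple] .

lemma irrefl: "\<not> Q x x"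
  using simple_irrefl[OF simple] .

lemma inX: "Q x y \<Longrightarrow> x \<in> X" "Q x y \<Longrightarrow> y \<in> X"
  using simple_in1[OF simple, of x y] simple_in2[OF simple, of x y] by simp_all

lemma fin_nb: "finite (nb Q x)"
  using finite_nb[OF simple] .

lemma forest: "forest_on Q X"
  using tree by (intro acyclic_forest) (auto simp: is_tree_def)

lemma connected: "x \<in> X \<Longrightarrow> y \<in> X \<Longrightarrow> Q\<^sup>*\<^sup>* x y"
  using tree by (simp add: is_tree_def connected_graph_def)

definition Lf where "Lf = {x\<in>X. dg Q x = 1}"

lemma leaves_Lf: "leaves (X, Q) = card Lf"
  by (simp add: leaves_def Lf_def gdegree_dg[OF simple])

lemma LfX: "Lf \<subseteq> X" "finite Lf"
  using finX by (auto simp: Lf_def)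

lemma dg_pos:
  assumes "2 \<le> card X" "x \<in> X"
  shows "1 \<le> dg Q x"
proof -
  have "X \<noteq> {x}" using assms(1) by auto
  then obtain y where y: "y \<in> X" "y \<noteq> x" using assms(2) by blast
  obtain z where "Q x z" using connected[OF assms(2) y(1)] y(2) by (metis converse_rtranclpE)
  then have "nb Q x \<noteq> {}" by (auto simp: nb_def)
  then have "card (nb Q x) \<noteq> 0" using fin_nb by simp
  then show ?thesis by (simp add: dg_def)
qed

text \<open>The sum counts each edge inside \<open>B\<close> twice, so this is the bound
  \<open>card B - 1\<close> for the edges of a forest, proved by removing a vertex with at most one
  neighbour.\<close>

lemma edge_bound:
  assumes "B \<subseteq> X" "B \<noteq> {}"
  shows "(\<Sum>x\<in>B. card {y\<in>B. Q x y}) + 2 \<le> 2 * card B"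
proof -
  have "finite B" using assms finX finite_subset by blast
  then show ?thesis using assms
  proof (induction "card B" arbitrary: B rule: less_induct)
    case less
    obtain x where x: "x \<in> B" "card {y\<in>B. Q x y} \<le> 1"
      using forest_on_vertex[OF forest less.prems(2,3)] .
    let ?C = "B - {x}"
    have finC: "finite ?C" using less.prems by simp
    have cB: "card B = Suc (card ?C)" using card.remove[OF less.prems(1) x(1)] .
    show ?case
    proof (cases "?C = {}")
      case True
      then have "B = {x}" using x(1) by blast
      then show ?thesis using irrefl by simp
    next
      case False
      have IH: "(\<Sum>z\<in>?C. card {y\<in>?C. Q z y}) + 2 \<le> 2 * card ?C"
        using less.hyps[of ?C] cB finC less.prems(2) False by auto
      have split: "card {y\<in>B. Q z y} = card {y\<in>?C. Q z y} + (if Q x z then 1 else 0)" for z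
      proof -
        have "{y\<in>B. Q z y} = (if Q x z then insert x {y\<in>?C. Q z y} else {y\<in>?C. Q z y})"
          using x(1) sym by auto
        then show ?thesis using finC by simp
      qed
      have "(\<Sum>z\<in>?C. if Q x z then 1 else (0::nat)) = card {z\<in>?C. Q x z}"
        using finC by (simp add: sum.If_cases Int_def)
      also have "\<dots> \<le> card {y\<in>B. Q x y}" using less.prems(1) by (intro card_mono) auto
      finally have 1: "(\<Sum>z\<in>?C. if Q x z then 1 else (0::nat)) \<le> 1" using x(2) by simp
      have "(\<Sum>z\<in>B. card {y\<in>B. Q z y}) = card {y\<in>B. Q x y} + (\<Sum>z\<in>?C. card {y\<in>B. Q z y})"
        using sum.remove[OF less.prems(1) x(1)] .
      also have "(\<Sum>z\<in>?C. card {y\<in>B. Q z y}) = (\<Sum>z\<in>?C. card {y\<in>?C. Q z y}) + (\<Sum>z\<in>?C. if Q x z then 1 else 0)"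
        by (simp add: split sum.distrib)
      finally show ?thesis using 1 IH x(2) cB by linarith
    qed
  qed
qed

text \<open>With truncated subtraction, \<open>2 + (dg Q x - 2)\<close> is the degree of
  \<open>x\<close>, plus one if \<open>x\<close> is a leaf. Summing and comparing with
  \<open>edge_bound\<close> shows that the leaves pay for all branching.\<close>

lemma excess:
  assumes "2 \<le> card X"
  shows "(\<Sum>x\<in>X. dg Q x - 2) + 2 \<le> card Lf"
proof -
  have nbX: "{y\<in>X. Q x y} = nb Q x" for x using inX by (auto simp: nb_def)
  have e: "(\<Sum>x\<in>X. dg Q x) + 2 \<le> 2 * card X"
    using edge_bound[OF order_refl X_ne] by (simp add: nbX dg_def)
  have "(\<Sum>x\<in>X. dg Q x + (if dg Q x = 1 then 1 else 0)) = (\<Sum>x\<in>X. 2 + (dg Q x - 2))"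
    by (rule sum.cong) (use dg_pos[OF assms] in force)+
  moreover have "(\<Sum>x\<in>X. if dg Q x = 1 then 1 else (0::nat)) = card Lf"
    using finX by (simp add: sum.If_cases Lf_def Int_def)
  ultimately show ?thesis using e unfolding sum.distrib by simp
qed

lemma sum_dg_le:
  assumes "2 \<le> card X" "W \<subseteq> X"
  shows "(\<Sum>x\<in>W. dg Q x) + 2 \<le> 2 * card W + card Lf"
proof -
  have finW: "finite W" using assms finX finite_subset by blast
  have "(\<Sum>x\<in>W. dg Q x) \<le> (\<Sum>x\<in>W. 2 + (dg Q x - 2))" by (intro sum_mono) auto
  also have "\<dots> = 2 * card W + (\<Sum>x\<in>W. dg Q x - 2)" unfolding sum.distrib by simp
  also have "(\<Sum>x\<in>W. dg Q x - 2) \<le> (\<Sum>x\<in>X. dg Q x - 2)" using assms(2) finX by (intro sum_mono2) auto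
  finally show ?thesis using excess[OF assms(1)] by linarith
qed

lemma card_branch:
  assumes "2 \<le> card X"
  shows "card {x\<in>X. 3 \<le> dg Q x} + 2 \<le> card Lf"
proof -
  have "card {x\<in>X. 3 \<le> dg Q x} = (\<Sum>x\<in>{x\<in>X. 3 \<le> dg Q x}. 1)" by simp
  also have "\<dots> \<le> (\<Sum>x\<in>{x\<in>X. 3 \<le> dg Q x}. dg Q x - 2)" by (intro sum_mono) auto
  also have "\<dots> \<le> (\<Sum>x\<in>X. dg Q x - 2)" using finX by (intro sum_mono2) auto
  finally show ?thesis using excess[OF assms] by linarith
qed

lemma leaf_neighbour:
  assumes "3 \<le> card X" "x \<in> Lf" "Q x y"
  shows "y \<notin> Lf"
proof
  assume y: "y \<in> Lf"
  obtain a where "nb Q x = {a}" using assms(2) by (auto simp: Lf_def dg_def card_1_singleton_iff)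
  then have nx: "nb Q x = {y}" using assms(3) by (auto simp: nb_def)
  obtain b where "nb Q y = {b}" using y by (auto simp: Lf_def dg_def card_1_singleton_iff)
  then have ny: "nb Q y = {x}" using sym[OF assms(3)] by (auto simp: nb_def)
  have "z \<in> {x,y}" if "Q\<^sup>*\<^sup>* x z" for z
    using that
  proof (induction rule: rtranclp_induct)
    case (step u v)
    then show ?case using nx ny by (auto simp: nb_def)
  qed simp
  then have "X \<subseteq> {x,y}" using connected assms(2) by (auto simp: Lf_def)
  then have "card X \<le> card {x,y}" by (intro card_mono) auto
  also have "\<dots> \<le> 2" by (simp add: card_insert_if)
  finally show False using assms(1) by simp
qed

text \<open>The vertices that may be placed elsewhere than on low vertices: no leaf depends on them,
  and only two neighbours constrain them.\<close>

definition Cd where "Cd = {x\<in>X. dg Q x = 2 \<and> nb Q x \<inter> Lf = {}}"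

text \<open>With \<open>l\<close> leaves, the vertices outside \<open>Cd\<close> are the leaves, at
  most \<open>l - 2\<close> branch vertices and at most \<open>l\<close> neighbours of
  leaves.\<close>

lemma card_Cd:
  assumes "2 \<le> card X"
  shows "card X + 2 \<le> card Cd + 3 * card Lf"
proof -
  let ?B = "{x\<in>X. 3 \<le> dg Q x}" and ?N = "\<Union>y\<in>Lf. nb Q y"
  have "X \<subseteq> Lf \<union> ?B \<union> Cd \<union> ?N"
  proof
    fix x assume x: "x \<in> X"
    then have "1 \<le> dg Q x" using dg_pos[OF assms] by simp
    then consider "dg Q x = 1" | "dg Q x = 2" | "3 \<le> dg Q x" by linarith
    then show "x \<in> Lf \<union> ?B \<union> Cd \<union> ?N" using x sym by cases (auto simp: Lf_def Cd_def)
  qed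
  moreover have "finite (Lf \<union> ?B \<union> Cd \<union> ?N)" using finX LfX fin_nb by (auto simp: Cd_def)
  ultimately have "card X \<le> card (Lf \<union> ?B \<union> Cd \<union> ?N)" by (intro card_mono) auto
  also have "\<dots> \<le> card Lf + card ?B + card Cd + card ?N"
    using card_Un_le[of "Lf \<union> ?B \<union> Cd" ?N] card_Un_le[of "Lf \<union> ?B" Cd] card_Un_le[of Lf ?B] by linarith
  also have "card ?N \<le> (\<Sum>y\<in>Lf. dg Q y)" unfolding dg_def using LfX by (intro card_UN_le) auto
  also have "\<dots> = card Lf" by (simp add: Lf_def)
  finally show ?thesis using card_branch[OF assms] by linarith
qed

lemma ex_independent:
  assumes "2 \<le> card X" "2 * r \<le> card Cd + 1"
  obtains I where "I \<subseteq> Cd" "card I = r" "\<And>x y. x \<in> I \<Longrightarrow> y \<in> I \<Longrightarrow> \<not> Q x y"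
proof -
  have "Cd \<subseteq> X" by (auto simp: Cd_def)
  then have "finite Cd" "forest_on Q Cd" using finX finite_subset forest forest_on_subset by blast+
  then obtain I where I: "I \<subseteq> Cd" "card Cd \<le> 2 * card I" "\<forall>x\<in>I. \<forall>y\<in>I. \<not> Q x y"
    using forest_independent[of Cd Q] sym irrefl by blast
  then have "r \<le> card I" using assms(2) by linarith
  then obtain J where "J \<subseteq> I" "card J = r" using obtain_subset_with_card_n by metis
  then show ?thesis using that[of J] I(1,3) by (meson subset_iff)
qed

text \<open>The image of the neighbour of a leaf forbids at most \<open>card V - card X\<close>
  vertices, and fewer than \<open>card X\<close> are occupied.\<close>

lemma leaf_extension:
  assumes s: "simple_graph (V, E)" and t: "3 \<le> card X" and e: "emb False V E (X - Lf) Q f"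
    and low: "\<And>q. q \<in> X - Lf \<Longrightarrow> nb Q q \<inter> Lf \<noteq> {} \<Longrightarrow> dg E (f q) + card X \<le> card V"
  shows "\<exists>g. emb False V E X Q g"
proof -
  have "\<exists>g. emb False V E ((X - Lf) \<union> B) Q g \<and> (\<forall>x\<in>X-Lf. g x = f x)" if "finite B" "B \<subseteq> Lf" for B
    using that
  proof (induction B rule: finite_induct)
    case empty
    then show ?case using e by auto
  next
    case (insert x B)
    then obtain g where g: "emb False V E ((X - Lf) \<union> B) Q g" "\<forall>x\<in>X-Lf. g x = f x" by auto
    have xL: "x \<in> Lf" "B \<subseteq> Lf" using insert.prems by auto
    obtain y where ny: "nb Q x = {y}" using xL by (auto simp: Lf_def dg_def card_1_singleton_iff)
    then have xy: "Q x y" by (auto simp: nb_def)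
    have y: "y \<in> X - Lf" using leaf_neighbour[OF t xL(1) xy] inX(2)[OF xy] by simp
    have "x \<in> nb Q y \<inter> Lf" using sym[OF xy] xL by simp
    then have "nb Q y \<inter> Lf \<noteq> {}" by blast
    then have d: "dg E (g y) + card X \<le> card V" using low[OF y] g(2) y by simp
    let ?A = "(X - Lf) \<union> B"
    have A: "?A \<subseteq> X - {x}" using xL insert.hyps LfX by auto
    have finA: "finite ?A" using A finX finite_subset by blast
    have "card (g ` ?A \<union> nb E (g y)) \<le> card (g ` ?A) + dg E (g y)" unfolding dg_def by (rule card_Un_le)
    also have "card (g ` ?A) \<le> card ?A" using finA by (rule card_image_le)
    also have "card ?A \<le> card (X - {x})" using A finX by (intro card_mono) auto
    also have "\<dots> < card X" using xL LfX finX by (intro card_Diff1_less) auto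
    finally have "card (g ` ?A \<union> nb E (g y)) < card V" using d by linarith
    then have "\<not> V \<subseteq> g ` ?A \<union> nb E (g y)"
      using card_mono[of "g ` ?A \<union> nb E (g y)" V] finA finite_nb[OF s] by fastforce
    then obtain v where v: "v \<in> V" "v \<notin> g ` ?A" "v \<notin> nb E (g y)" by blast
    have "emb False V E (insert x ?A) Q (g(x := v))"
    proof (rule emb_extend[OF s sym g(1) _ v(1,2)])
      show "x \<notin> ?A" using A by blast
      fix z assume "z \<in> ?A" "Q x z"
      then have "z \<in> nb Q x" by simp
      then have "z = y" using ny by blast
      then show "\<not> E v (g z)" using v(3) simple_sym[OF s, of v "g y"] by auto
    qed
    moreover have "\<forall>z\<in>X-Lf. (g(x := v)) z = f z" using g(2) xL by auto
    moreover have "insert x ?A = (X - Lf) \<union> insert x B" by blast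
    ultimately show ?case by metis
  qed
  from this[OF LfX(2) order_refl] show ?thesis using LfX by (metis Un_Diff_cancel2 Un_absorb2)
qed

end

section \<open>Embedding trees into the complement\<close>

context tree_graph
begin

lemma embed_many_leaves:
  assumes s: "simple_graph (V, E)" and cV: "card V + 2 = card X + s" and s3: "3 \<le> s"
    and np: "\<not> pot_clique V E s" and l: "s \<le> card Lf + 2"
    and or: "s + 1 \<le> card Lf \<or> 7 * (s - 2) < card X"
  shows "\<exists>E' f. same_deg V E E' \<and> emb False V E' X Q f"
proof -
  have lX: "card Lf \<le> card X" using LfX finX by (simp add: card_mono)
  have t: "3 \<le> card X" using or lX s3 by linarith
  \<comment> \<open>Chosen so that \<open>card Lf + r \<ge> s + 1\<close>: removing the leaves and
    \<open>r\<close> further vertices leaves at most \<open>card X - s - 1\<close> vertices, as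
    \<open>low_forest\<close> requires.\<close>
  define r where "r = s + 1 - card Lf"
  have "2 * r \<le> card Cd + 1"
  proof (cases "s + 1 \<le> card Lf")
    case True then show ?thesis by (simp add: r_def)
  next
    case False
    then show ?thesis using or card_Cd t s3 unfolding r_def by linarith
  qed
  then obtain I where I: "I \<subseteq> Cd" "card I = r" "\<And>x y. x \<in> I \<Longrightarrow> y \<in> I \<Longrightarrow> \<not> Q x y"
    using ex_independent[of r] t by auto
  have IX: "I \<subseteq> X - Lf" using I(1) by (auto simp: Cd_def Lf_def)
  have finI: "finite I" using IX finX finite_subset by blast
  define A where "A = X - Lf - I"
  have finA: "finite A" using finX by (simp add: A_def)
  have cA: "card A = card X - card Lf - r" 
    using IX finI finX LfX I(2) by (simp add: A_def card_Diff_subset)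
  have "card I \<le> card (X - Lf)" using IX finX by (intro card_mono) auto
  then have rle: "r + card Lf \<le> card X" using I(2) LfX lX finX by (simp add: card_Diff_subset)
  have A2: "card A + 2 * s \<le> card V + 1" using cA cV rle r_def by linarith
  have "A \<subseteq> X" by (auto simp: A_def)
  then have fA: "forest_on Q A" using forest_on_subset[OF forest] by blast
  have s2: "2 \<le> s" using s3 by simp
  obtain E' f where f: "same_deg V E E'" "emb False V E' A Q f" "\<forall>a\<in>A. dg E (f a) + 2 \<le> s"
    using low_forest[of V E s A Q, OF s np s2 finA fA sym A2] by blast
  have s': "simple_graph (V, E')" using same_deg_simple[OF f(1)] .
  have dE': "dg E' (f a) + 2 \<le> s" if "a \<in> A" for a
    using f that same_deg_dg[OF f(1), of "f a"] by (auto simp: emb_def)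
  have "\<exists>g. emb False V E' (A \<union> B) Q g \<and> (\<forall>a\<in>A. g a = f a)" if "finite B" "B \<subseteq> I" for B
    using that
  proof (induction B rule: finite_induct)
    case empty
    then show ?case using f(2) by auto
  next
    case (insert x B)
    then obtain g where g: "emb False V E' (A \<union> B) Q g" "\<forall>a\<in>A. g a = f a" by auto
    have xI: "x \<in> I" "B \<subseteq> I" using insert.prems by auto
    have nx: "nb Q x \<subseteq> A" using I(1,3) xI(1) inX by (auto simp: A_def Cd_def)
    have c2: "card (nb Q x) = 2" using I(1) xI(1) by (auto simp: Cd_def dg_def)
    let ?N = "\<Union>y\<in>nb Q x. nb E' (f y)"
    have "card ?N \<le> (\<Sum>y\<in>nb Q x. dg E' (f y))" unfolding dg_def using fin_nb by (intro card_UN_le) auto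
    also have "\<dots> \<le> (\<Sum>y\<in>nb Q x. s - 2)" using dE' nx by (intro sum_mono) fastforce
    also have "\<dots> = 2 * (s - 2)" using c2 by simp
    finally have N: "card ?N \<le> 2 * (s - 2)" .
    have finB: "finite (A \<union> B)" using finA insert.hyps by simp
    have cB: "card B < r" using psubset_card_mono[OF finI, of B] insert.prems insert.hyps(2) I(2) by auto
    have "card (g ` (A \<union> B)) \<le> card (A \<union> B)" using finB by (rule card_image_le)
    also have "\<dots> \<le> card A + card B" by (rule card_Un_le)
    finally have "card (g ` (A \<union> B) \<union> ?N) \<le> card A + card B + 2 * (s - 2)"
      using N card_Un_le[of "g ` (A \<union> B)" ?N] by linarith
    \<comment> \<open>At most \<open>card X - card Lf - 1\<close> vertices are occupied. Adding
      \<open>2 * (s - 2)\<close> stays below \<open>card X + s - 2\<close> exactly because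
      \<open>card Lf \<ge> s - 2\<close>.\<close>
    also have "\<dots> < card V" using cB cA cV rle r_def l s3 by linarith
    finally have "card (g ` (A \<union> B) \<union> ?N) < card V" .
    then have "\<not> V \<subseteq> g ` (A \<union> B) \<union> ?N"
      using card_mono[of "g ` (A \<union> B) \<union> ?N" V] finB finite_nb[OF s'] fin_nb by (metis finite_UN finite_UnI finite_imageI not_le)
    then obtain v where v: "v \<in> V" "v \<notin> g ` (A \<union> B)" "v \<notin> ?N" by blast
    have "emb False V E' (insert x (A \<union> B)) Q (g(x := v))"
    proof (rule emb_extend[OF s' sym g(1) _ v(1,2)])
      show "x \<notin> A \<union> B" using xI insert.hyps by (auto simp: A_def)
      fix z assume z: "z \<in> A \<union> B" "Q x z"
      then have "z \<in> nb Q x" by simp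
      then have "\<not> E' (f z) v" "z \<in> A" using v(3) nx by auto
      then show "\<not> E' v (g z)" using simple_sym[OF s', of v "f z"] g(2) by auto
    qed
    moreover have "\<forall>z\<in>A. (g(x := v)) z = f z" using g(2) xI by (auto simp: A_def)
    ultimately show ?case by (metis Un_insert_right)
  qed
  then obtain g where g: "emb False V E' (A \<union> I) Q g" "\<forall>a\<in>A. g a = f a" using finI by blast
  have AI: "A \<union> I = X - Lf" using IX by (auto simp: A_def)
  have "\<exists>h. emb False V E' X Q h"
  proof (rule leaf_extension[OF s' t g(1)[unfolded AI]])
    fix q assume q: "q \<in> X - Lf" "nb Q q \<inter> Lf \<noteq> {}"
    then have "q \<in> A" using I(1) by (auto simp: A_def Cd_def)
    then show "dg E' (g q) + card X \<le> card V" using dE'[of q] g(2) cV by simp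
  qed
  then show ?thesis using f(1) by blast
qed

text \<open>A conflict has an end \<open>x\<close> of degree at most two. Swapping \<open>x\<close> with the preimage of a suitable low vertex
  \<open>v\<close> creates no new conflict, and fewer than \<open>card L\<close> choices of \<open>v\<close> are bad.\<close>

lemma resolve_conflicts:
  assumes s: "simple_graph (V, E)" and t: "2 \<le> card X"
    and I: "I \<subseteq> X - Lf" and F: "I \<subseteq> F" "\<And>x. x \<in> I \<Longrightarrow> nb Q x \<subseteq> F" "\<And>x. x \<in> X - Lf \<Longrightarrow> 3 \<le> dg Q x \<Longrightarrow> x \<in> F"
    and L: "L \<subseteq> V" "\<And>v. v \<in> L \<Longrightarrow> dg E v \<le> k" and cL: "4 * k + card Lf < card L"
    and f: "inj_on f (X - Lf)" "f ` (X - Lf) \<subseteq> V" "\<And>x. x \<in> X - Lf - I \<Longrightarrow> f x \<in> L" "\<And>x. x \<in> I \<Longrightarrow> f x \<notin> L"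
    and F0: "\<And>x y. x \<in> F \<inter> (X - Lf) \<Longrightarrow> y \<in> F \<inter> (X - Lf) \<Longrightarrow> Q x y \<Longrightarrow> \<not> E (f x) (f y)"
  shows "\<exists>g. emb False V E (X - Lf) Q g \<and> (\<forall>x\<in>X-Lf-I. g x \<in> L)"
  using f F0
proof (induction "card {(x,y)\<in>(X-Lf)\<times>(X-Lf). Q x y \<and> E (f x) (f y)}" arbitrary: f rule: less_induct)
  case less
  let ?X = "X - Lf"
  define Cf where "Cf = (\<lambda>f. {(x,y)\<in>?X\<times>?X. Q x y \<and> E (f x) (f y)})"
  have finX': "finite ?X" using finX by simp
  have finCf: "finite (Cf f)" unfolding Cf_def by (rule finite_subset[of _ "?X \<times> ?X"]) (use finX' in auto)
  have symE: "E u v = E v u" for u v using simple_sym[OF s] by blast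
  show ?case
  proof (cases "Cf f = {}")
    case True
    then have "emb False V E ?X Q f" using less.prems(1,2) by (auto simp: emb_def Cf_def)
    then show ?thesis using less.prems(3) by blast
  next
    case False
    then obtain a b where ab: "a \<in> ?X" "b \<in> ?X" "Q a b" "E (f a) (f b)" by (auto simp: Cf_def)
    \<comment> \<open>There is no conflict inside \<open>F\<close>, so one end \<open>x\<close> lies
      outside; it has degree at most two and no neighbour in \<open>I\<close>, so its neighbours in
      \<open>N\<close> have low images.\<close>
    then have "a \<notin> F \<or> b \<notin> F" using less.prems(5)[of a b] by blast
    then obtain x y where x: "x \<in> ?X" "x \<notin> F" and y: "y \<in> ?X" and xy: "Q x y" "E (f x) (f y)"
    proof
      assume "a \<notin> F" then show ?thesis using that[of a b] ab by blast
    next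
      assume "b \<notin> F" then show ?thesis using that[of b a] ab sym[OF ab(3)] symE by blast
    qed
    have xI: "x \<notin> I" using x F(1) by blast
    have dx: "dg Q x \<le> 2" using F(3)[of x] x by fastforce
    define N where "N = nb Q x \<inter> ?X"
    have NI: "z \<notin> I" if "z \<in> N" for z
    proof
      assume "z \<in> I"
      moreover have "x \<in> nb Q z" using that sym by (auto simp: N_def)
      ultimately show False using F(2)[of z] x by blast
    qed
    have finN: "finite N" and cN: "card N \<le> 2"
      using fin_nb dx card_mono[of "nb Q x" N] by (auto simp: N_def dg_def)
    have NL: "f z \<in> L" if "z \<in> N" for z using less.prems(3)[of z] NI[OF that] that by (auto simp: N_def)
    \<comment> \<open>Bad choices of \<open>v\<close>: in \<open>S2\<close> the vertex
      \<open>x\<close> would conflict with a neighbour; in \<open>S3\<close> the vertex displaced to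
      \<open>f x\<close> would conflict with one of its neighbours; the images of \<open>N\<close>
      must stay fixed. Their numbers are at most \<open>2 * k\<close>,
      \<open>2 * k + card Lf - 2\<close> and \<open>2\<close>.\<close>
    define S2 where "S2 = (\<Union>z\<in>N. nb E (f z))"
    have "card S2 \<le> (\<Sum>z\<in>N. dg E (f z))" unfolding dg_def S2_def using finN by (intro card_UN_le) auto
    also have "\<dots> \<le> (\<Sum>z\<in>N. k)" using L(2) NL by (intro sum_mono) auto
    also have "\<dots> \<le> 2 * k" using cN by simp
    finally have c2: "card S2 \<le> 2 * k" .
    define W where "W = {w\<in>?X. E (f x) (f w)}"
    have fx: "f x \<in> L" using less.prems(3)[of x] x xI by blast
    have finW: "finite W" by (rule finite_subset[OF _ finX']) (auto simp: W_def)
    have "card W = card (f ` W)" using less.prems(1) by (intro card_image[symmetric]) (auto simp: W_def inj_on_def)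
    also have "\<dots> \<le> dg E (f x)" unfolding dg_def using finite_nb[OF s] by (intro card_mono) (auto simp: W_def)
    also have "\<dots> \<le> k" using L(2) fx by blast
    finally have cW: "card W \<le> k" .
    define S3 where "S3 = f ` (\<Union>w\<in>W. nb Q w)"
    have "card S3 \<le> card (\<Union>w\<in>W. nb Q w)" unfolding S3_def using finW fin_nb by (intro card_image_le) auto
    also have "\<dots> \<le> (\<Sum>w\<in>W. dg Q w)" unfolding dg_def using finW by (intro card_UN_le) auto
    finally have c3': "card S3 \<le> (\<Sum>w\<in>W. dg Q w)" .
    have c3: "card S3 + 2 \<le> 2 * k + card Lf"
    proof -
      have "W \<subseteq> X" by (auto simp: W_def)
      then show ?thesis using sum_dg_le[OF t, of W] cW c3' by linarith
    qed
    have c4: "card (f ` N) \<le> 2" using card_image_le[OF finN, of f] cN by linarith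
    have "card (S2 \<union> S3 \<union> f ` N) \<le> card S2 + card S3 + card (f ` N)"
      using card_Un_le[of "S2 \<union> S3" "f ` N"] card_Un_le[of S2 S3] by linarith
    then have "card (S2 \<union> S3 \<union> f ` N) < card L" using c2 c3 c4 cL by linarith
    moreover have "finite (S2 \<union> S3 \<union> f ` N)"
      using finN finW fin_nb finite_nb[OF s] by (auto simp: S2_def S3_def)
    ultimately have "\<not> L \<subseteq> S2 \<union> S3 \<union> f ` N" using card_mono by (metis not_le)
    then obtain v where v: "v \<in> L" "v \<notin> S2" "v \<notin> S3" "v \<notin> f ` N" by blast
    have "f x \<in> S2" using xy y symE by (auto simp: S2_def N_def)
    then have vfx: "v \<noteq> f x" using v(2) by blast
    \<comment> \<open>If \<open>v\<close> is not an image, only \<open>x\<close> moves. A displaced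
      vertex may belong to \<open>F\<close>, but as no conflict is created, \<open>F\<close> remains
      free of conflicts.\<close>
    define g where "g = (\<lambda>u. if u = x then v else if f u = v then f x else f u)"
    have inj: "f p = f q \<Longrightarrow> p \<in> ?X \<Longrightarrow> q \<in> ?X \<Longrightarrow> p = q" for p q using less.prems(1) by (auto simp: inj_on_def)
    have g1: "inj_on g ?X"
    proof (rule inj_onI)
      fix p q assume "p \<in> ?X" "q \<in> ?X" "g p = g q"
      then show "p = q" using inj[of p q] inj[of p x] inj[of x q] x(1) vfx unfolding g_def by (metis (full_types))
    qed
    have g2: "g ` ?X \<subseteq> V" using less.prems(2) v(1) L(1) x(1) by (auto simp: g_def)
    have g3: "g u \<in> L" if "u \<in> ?X - I" for u using less.prems(3)[OF that] v(1) fx by (auto simp: g_def)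
    have g4: "g u \<notin> L" if "u \<in> I" for u using less.prems(4)[OF that] v(1) xI that by (auto simp: g_def)
    have key: "E (f p) (f q) \<and> (p \<noteq> x \<and> q \<noteq> x)" if pq: "p \<in> ?X" "q \<in> ?X" "Q p q" "E (g p) (g q)" for p q
    proof -
      have nox: "\<not> E (g x) (g q)" if "q \<in> ?X" "Q x q" for q
      proof -
        have qN: "q \<in> N" using that by (simp add: N_def)
        then have "f q \<noteq> v" using v(4) by blast
        moreover have "q \<noteq> x" using that irrefl by blast
        ultimately have "g q = f q" by (simp add: g_def)
        moreover have "\<not> E (f q) v" using v(2) qN by (auto simp: S2_def)
        ultimately show ?thesis using symE by (simp add: g_def)
      qed
      have nov: "\<not> E (g p) (g q)" if h: "p \<in> ?X" "q \<in> ?X" "Q p q" "p \<noteq> x" "q \<noteq> x" "f p = v" for p q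
      proof
        assume e: "E (g p) (g q)"
        have "q \<noteq> p" using h(3) irrefl by blast
        then have "f q \<noteq> v" using inj[of p q] h by metis
        then have "g q = f q" "g p = f x" using h by (auto simp: g_def)
        then have "q \<in> W" using e h by (simp add: W_def)
        moreover have "p \<in> nb Q q" using sym[OF h(3)] by simp
        ultimately have "f p \<in> S3" unfolding S3_def by blast
        then show False using v(3) h(6) by simp
      qed
      have ne: "p \<noteq> x" "q \<noteq> x" using nox[of q] nox[of p] pq sym[OF pq(3)] symE by blast+
      have "f p \<noteq> v" using nov[OF pq(1-3) ne] pq(4) by blast
      moreover have "f q \<noteq> v" using nov[OF pq(2,1) sym[OF pq(3)] ne(2,1)] pq(4) symE by blast
      ultimately show ?thesis using ne pq(4) by (simp add: g_def)
    qed
    have sub: "Cf g \<subset> Cf f"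
    proof
      show "Cf g \<subseteq> Cf f" using key by (auto simp: Cf_def)
      have "(x,y) \<in> Cf f" using x y xy by (simp add: Cf_def)
      moreover have "(x,y) \<notin> Cf g" using key[of x y] by (auto simp: Cf_def)
      ultimately show "Cf g \<noteq> Cf f" by blast
    qed
    have "card (Cf g) < card (Cf f)" using sub finCf by (simp add: psubset_card_mono)
    moreover have "\<not> E (g p) (g q)" if "p \<in> F \<inter> ?X" "q \<in> F \<inter> ?X" "Q p q" for p q
      using key[of p q] less.prems(5)[OF that] that by blast
    ultimately show ?thesis using less.hyps[of g] g1 g2 g3 g4 unfolding Cf_def by blast
  qed
qed

lemma embed_few_leaves:
  assumes s: "simple_graph (V, E)" and cV: "card V + 2 = card X + s"
    and np: "\<not> pot_clique V E s" and few: "card Lf + 3 \<le> s" and t: "7 * (s - 2) < card X"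
    and mx: "s + card Lf < card {v\<in>V. s \<le> dg E v + 1} + 2 \<Longrightarrow> \<forall>v\<in>V. dg E v + 3 \<le> 2 * s"
  shows "\<exists>f. emb False V E X Q f"
proof -
  define k where "k = s - 2"
  define Hi where "Hi = {v\<in>V. s \<le> dg E v + 1}"
  define L where "L = V - Hi"
  let ?l = "card Lf"
  let ?X = "X - Lf"
  have t2: "2 \<le> card X" using t few by linarith
  have l2: "2 \<le> ?l" using excess[OF t2] by simp
  have sk: "s = k + 2" "?l + 1 \<le> k" "7 * k < card X" using few t by (simp_all add: k_def)
  have cVk: "card V = card X + k" using cV sk by simp
  have fin: "finite V" using simple_finite[OF s] .
  have Hi: "Hi \<subseteq> V" "finite Hi" using fin by (auto simp: Hi_def)
  have h: "card Hi \<le> 2 * k + 3"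
    using pot_clique_many_high[OF s, of s] np sk unfolding Hi_def by fastforce
  have cL: "card L + card Hi = card X + k" "finite L"
    using Hi fin cVk card_mono[OF fin Hi(1)] by (auto simp: L_def card_Diff_subset)
  have Ldg: "dg E v \<le> k" if "v \<in> L" for v using that sk by (auto simp: L_def Hi_def)
  \<comment> \<open>There are \<open>card X - card Lf\<close> non-leaves and
    \<open>card X + k - card Hi\<close> low vertices; \<open>r\<close> is the shortfall, to be
    placed on high vertices.\<close>
  define r where "r = card Hi - (k + ?l)"
  have hr: "card Hi \<le> r + k + ?l" "0 < r \<Longrightarrow> card Hi = r + k + ?l" "r + ?l \<le> k + 3"
    using h sk by (auto simp: r_def)
  have "2 * r \<le> card Cd + 1" using card_Cd[OF t2] hr sk by linarith
  then obtain I where I: "I \<subseteq> Cd" "card I = r" "\<And>x y. x \<in> I \<Longrightarrow> y \<in> I \<Longrightarrow> \<not> Q x y"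
    using ex_independent[OF t2, of r] by blast
  have IX: "I \<subseteq> ?X" using I(1) by (auto simp: Cd_def Lf_def)
  have finI: "finite I" using IX finX finite_subset by blast
  have mxI: "dg E v \<le> 2 * k + 1" if "x \<in> I" "v \<in> V" for x v
  proof -
    have "0 < r" using that(1) I(2) finI card_gt_0_iff by blast
    then show ?thesis using mx hr(2) sk that(2) unfolding Hi_def by fastforce
  qed
  \<comment> \<open>Swaps are made at vertices of degree at most two that have no neighbour in
    \<open>I\<close>. So the branch vertices and the neighbours of \<open>I\<close> are placed
    together with \<open>I\<close> in advance, free of conflicts.\<close>
  define Y where "Y = (\<Union>x\<in>I. nb Q x) \<union> {x\<in>X. 3 \<le> dg Q x}"
  define F where "F = I \<union> Y"
  have YI: "Y \<inter> I = {}" using I(1,3) by (auto simp: Y_def Cd_def)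
  have YX: "Y \<subseteq> ?X" using I(1) inX by (auto simp: Y_def Cd_def Lf_def)
  have finY: "finite Y" using YX finX finite_subset by blast
  have "card (\<Union>x\<in>I. nb Q x) \<le> (\<Sum>x\<in>I. dg Q x)" unfolding dg_def using finI by (intro card_UN_le) auto
  also have "\<dots> = (\<Sum>x\<in>I. 2)" using I(1) by (intro sum.cong) (auto simp: Cd_def)
  finally have "card (\<Union>x\<in>I. nb Q x) \<le> 2 * r" using I(2) by simp
  then have cY: "card Y + 2 \<le> 2 * r + ?l"
    using card_branch[OF t2] card_Un_le[of "\<Union>x\<in>I. nb Q x" "{x\<in>X. 3 \<le> dg Q x}"] unfolding Y_def by linarith
  have finF: "finite F" using finI finY by (simp add: F_def)
  have FX: "F \<subseteq> ?X" using IX YX by (auto simp: F_def)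
  have cF: "card F = r + card Y" using YI finI finY I(2) by (simp add: F_def card_Un_disjoint Int_commute)
  have fF: "forest_on Q F" using forest_on_subset[OF forest, of F] FX by blast
  \<comment> \<open>As \<open>Hi\<close> and \<open>L\<close> are disjoint, the vertices of
    \<open>I\<close> and those of \<open>Y\<close> do not compete for positions.\<close>
  define Lm where "Lm = (\<lambda>x. if x \<in> I then Hi else L)"
  have HiL: "Hi \<inter> L = {}" by (auto simp: L_def)
  have cX: "card (Z \<inter> Lm x) + 1 \<le> (if x \<in> I then r else card Y)"
    if x: "x \<in> F" and c: "card (Z \<inter> Lm x) \<le> card {z\<in>F-{x}. Lm z \<inter> Lm x \<noteq> {}}" for x Z
  proof (cases "x \<in> I")
    case True
    have "{z\<in>F-{x}. Lm z \<inter> Lm x \<noteq> {}} \<subseteq> I - {x}" using True HiL by (auto simp: Lm_def)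
    then have "card {z\<in>F-{x}. Lm z \<inter> Lm x \<noteq> {}} \<le> card (I - {x})" using finI by (intro card_mono) auto
    also have "\<dots> < card I" using finI True by (intro card_Diff1_less)
    finally show ?thesis using c True I(2) by simp
  next
    case False
    then have xY: "x \<in> Y" using x by (simp add: F_def)
    have "{z\<in>F-{x}. Lm z \<inter> Lm x \<noteq> {}} \<subseteq> Y - {x}" using False HiL by (auto simp: Lm_def F_def)
    then have "card {z\<in>F-{x}. Lm z \<inter> Lm x \<noteq> {}} \<le> card (Y - {x})" using finY by (intro card_mono) auto
    also have "\<dots> < card Y" using finY xY by (intro card_Diff1_less)
    finally show ?thesis using c False by simp
  qed
  have finLm: "finite (Lm x)" for x using Hi cL by (simp add: Lm_def)
  have "\<exists>f. emb False V E F Q f \<and> (\<forall>x\<in>F. f x \<in> Lm x)"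
  proof (rule greedy_forest[OF s sym finF fF])
    show "Lm x \<subseteq> V" for x using Hi by (auto simp: Lm_def L_def)
    fix x Z assume x: "x \<in> F" and Z: "card (Z \<inter> Lm x) \<le> card {z\<in>F-{x}. Lm z \<inter> Lm x \<noteq> {}}"
    note cZ = cX[OF x Z]
    have big: "card L \<ge> card Y + k" using cY cL hr h sk l2 by linarith
    show "\<not> Lm x \<subseteq> Z"
    proof
      assume "Lm x \<subseteq> Z"
      then have "Z \<inter> Lm x = Lm x" by blast
      then have "card (Lm x) + 1 \<le> (if x \<in> I then r else card Y)" using cZ by simp
      then show False using big hr(2) by (auto simp: Lm_def split: if_splits)
    qed
    fix y v assume y: "y \<in> F" "x \<noteq> y" "Q x y" and v: "v \<in> Lm y"
    show "\<not> Lm x \<subseteq> Z \<union> nb E v"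
    proof
      assume "Lm x \<subseteq> Z \<union> nb E v"
      then have "Lm x \<subseteq> (Z \<inter> Lm x) \<union> nb E v" by blast
      then have "card (Lm x) \<le> card ((Z \<inter> Lm x) \<union> nb E v)"
        using finLm finite_nb[OF s] by (intro card_mono) auto
      also have "\<dots> \<le> card (Z \<inter> Lm x) + dg E v" unfolding dg_def by (rule card_Un_le)
      finally have le: "card (Lm x) \<le> card (Z \<inter> Lm x) + dg E v" .
      show False
      proof (cases "x \<in> I")
        case True
        then have "y \<notin> I" using I(3) y(3) by blast
        then have "dg E v \<le> k" using v Ldg by (simp add: Lm_def)
        moreover have "card Hi + 1 \<le> r + dg E v" using le cZ True by (simp add: Lm_def)
        moreover have "0 < r" using cZ True by simp
        ultimately show False using hr(2) l2 by linarith
      next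
        case False
        then have l: "card L + 1 \<le> card Y + dg E v" using le cZ by (simp add: Lm_def)
        show False
        proof (cases "y \<in> I")
          case True
          \<comment> \<open>The place where the bound \<open>mx\<close> on the maximum degree
            enters: a high image forbids at most \<open>2 * k + 1\<close> of the low
            positions.\<close>
          then have "dg E v \<le> 2 * k + 1" using mxI[OF True, of v] v Hi by (auto simp: Lm_def)
          then show False using l cY cL hr(3) h sk l2 by linarith
        next
          case False
          then have "dg E v \<le> k" using v Ldg by (simp add: Lm_def)
          then show False using l big by linarith
        qed
      qed
    qed
  qed
  then obtain f where f: "emb False V E F Q f" "\<forall>x\<in>F. f x \<in> Lm x" by blast
  have fI: "f x \<in> Hi" if "x \<in> I" for x
  proof -
    have "x \<in> F" using that by (simp add: F_def)
    then have "f x \<in> Lm x" using f(2) by blast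
    then show ?thesis using that by (simp add: Lm_def)
  qed
  have fY: "f x \<in> L" if "x \<in> Y" for x
  proof -
    have "x \<in> F" "x \<notin> I" using that YI by (auto simp: F_def)
    then have "f x \<in> Lm x" using f(2) by blast
    then show ?thesis using \<open>x \<notin> I\<close> by (simp add: Lm_def)
  qed
  have cfY: "card (f ` Y) = card Y" "f ` Y \<subseteq> L"
    using f(1) fY by (auto simp: emb_def F_def intro!: card_image inj_on_subset[of f "I \<union> Y"])
  have lX: "card Lf \<le> card X" using LfX finX by (simp add: card_mono)
  have cXl: "card ?X + ?l = card X" using LfX finX lX by (simp add: card_Diff_subset)
  have "card (?X - F) + (r + card Y) = card ?X"
    using FX finX cF card_mono[of ?X F] finF by (simp add: card_Diff_subset)
  moreover have "card (L - f ` Y) + card Y = card L"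
    using cfY cL finY card_mono[of L "f ` Y"] by (simp add: card_Diff_subset)
  ultimately have "card (?X - F) \<le> card (L - f ` Y)" using cXl cL hr(1) by linarith
  moreover have "finite (?X - F)" "finite (L - f ` Y)" using finX cL by auto
  ultimately obtain g where g: "g ` (?X - F) \<subseteq> L - f ` Y" "inj_on g (?X - F)"
    using card_le_inj[of "?X - F" "L - f ` Y"] by blast
  define f0 where "f0 = (\<lambda>x. if x \<in> F then f x else g x)"
  have gL: "g x \<in> L" "g x \<notin> f ` Y" if "x \<in> ?X" "x \<notin> F" for x using g(1) that by auto
  have gF: "g x \<noteq> f y" if "x \<in> ?X" "x \<notin> F" "y \<in> F" for x y
    using gL[OF that(1,2)] that(3) fI[of y] HiL by (auto simp: F_def)
  have "\<exists>h. emb False V E ?X Q h \<and> (\<forall>x\<in>?X-I. h x \<in> L)"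
  proof (rule resolve_conflicts[OF s t2 IX, where F = F and L = L and k = k and f = f0])
    show "I \<subseteq> F" "\<And>x. x \<in> I \<Longrightarrow> nb Q x \<subseteq> F" "\<And>x. x \<in> ?X \<Longrightarrow> 3 \<le> dg Q x \<Longrightarrow> x \<in> F"
      by (auto simp: F_def Y_def)
    show "L \<subseteq> V" by (auto simp: L_def)
    show "\<And>v. v \<in> L \<Longrightarrow> dg E v \<le> k" by (rule Ldg)
    \<comment> \<open>From \<open>card Hi \<le> 2 * k + 3\<close> follows
      \<open>card L \<ge> card X - k - 3\<close>; moreover \<open>card Lf \<le> k - 1\<close>,
      \<open>card X > 7 * k\<close> and \<open>k \<ge> 3\<close>.\<close>
    show "4 * k + card Lf < card L" using cL h sk l2 by linarith
    show "inj_on f0 ?X"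
    proof (rule inj_onI)
      fix x y assume xy: "x \<in> ?X" "y \<in> ?X" "f0 x = f0 y"
      have fin: "inj_on f F" using f(1) by (simp add: emb_def)
      show "x = y"
      proof (cases "x \<in> F"; cases "y \<in> F")
        assume "x \<in> F" "y \<in> F" then show ?thesis using xy(3) inj_onD[OF fin, of x y] by (simp add: f0_def)
      next
        assume a: "x \<in> F" "y \<notin> F" then show ?thesis using xy gF[of y x] by (simp add: f0_def)
      next
        assume a: "x \<notin> F" "y \<in> F" then show ?thesis using xy gF[of x y] by (simp add: f0_def)
      next
        assume a: "x \<notin> F" "y \<notin> F" then show ?thesis using xy inj_onD[OF g(2), of x y] by (simp add: f0_def)
      qed
    qed
    show "f0 ` ?X \<subseteq> V" using f(1) gL by (auto simp: f0_def emb_def L_def)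
    show "f0 x \<in> L" if "x \<in> ?X - I" for x using that gL[of x] fY[of x] by (auto simp: f0_def F_def)
    show "f0 x \<notin> L" if "x \<in> I" for x using that fI[OF that] HiL by (auto simp: f0_def F_def)
    show "\<not> E (f0 x) (f0 y)" if "x \<in> F \<inter> ?X" "y \<in> F \<inter> ?X" "Q x y" for x y
      using that f(1) irrefl[of x] by (auto simp: f0_def emb_def)
  qed
  then obtain h where h: "emb False V E ?X Q h" "\<forall>x\<in>?X-I. h x \<in> L" by blast
  show ?thesis
  proof (rule leaf_extension[OF s _ h(1)])
    show "3 \<le> card X" using t few by linarith
    fix q assume q: "q \<in> ?X" "nb Q q \<inter> Lf \<noteq> {}"
    then have "q \<notin> I" using I(1) by (auto simp: Cd_def)
    then show "dg E (h q) + card X \<le> card V" using Ldg[of "h q"] h(2) q(1) cVk by simp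
  qed
qed

lemma emb_add_vertex:
  assumes s: "simple_graph (V, E)" and w: "w \<in> V" and e: "same_deg (V - {w}) (del_vertex E w) E'"
    and f: "emb False (V - {w}) E' A Q f"
  shows "emb False V (add_vertex E' w (nb E w)) A Q f"
  unfolding emb_def
proof (intro conjI ballI impI)
  show "inj_on f A" "f ` A \<subseteq> V" using f by (auto simp: emb_def)
  fix a b assume ab: "a \<in> A" "b \<in> A" "a \<noteq> b" "Q a b"
  have "f a \<noteq> w" "f b \<noteq> w" using f ab by (auto simp: emb_def)
  moreover have "\<not> E' (f a) (f b)" using f ab by (simp add: emb_def)
  ultimately show "add_vertex E' w (nb E w) (f a) (f b) = False" by (simp add: add_vertex_def)
qed

text \<open>Induction on \<open>s\<close> with the tree fixed. The induction hypothesis serves only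
  the case of few leaves, many high vertices and a large maximum degree: a vertex \<open>v\<close>
  of maximum degree is deleted, an embedded tree persists when \<open>v\<close> returns, and a
  clique extends by \<open>pot_clique_large_max\<close>.\<close>

theorem clique_or_tree:
  assumes "2 \<le> s" "s + 1 \<le> card Lf \<or> 7 * (s - 2) < card X"
    and "simple_graph (V, E)" "card V + 2 = card X + s"
  shows "pot_clique V E s \<or> (\<exists>E' f. same_deg V E E' \<and> emb False V E' X Q f)"
  using assms
proof (induction s arbitrary: V E rule: dec_induct)
  case base
  note s = base(2)
  have fin: "finite V" using simple_finite[OF s] .
  show ?case
  proof (cases "\<exists>u v. E u v")
    case True
    then obtain u v where uv: "E u v" by blast
    have "u \<noteq> v" "u \<in> V" "v \<in> V" using uv simple_irrefl[OF s] simple_in1[OF s uv] simple_in2[OF s uv] by auto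
    moreover have "E v u" using simple_sym[OF s uv] .
    ultimately have "{u,v} \<subseteq> V" "card {u,v} = 2" "\<forall>x\<in>{u,v}. \<forall>y\<in>{u,v}. x \<noteq> y \<longrightarrow> E x y" using uv by auto
    then show ?thesis unfolding pot_clique_def using same_deg_refl[OF s] by blast
  next
    case False
    obtain f where "f ` X \<subseteq> V" "inj_on f X" using card_le_inj[OF finX fin] base(3) by auto
    then have "emb False V E X Q f" using False by (simp add: emb_def)
    then show ?thesis using same_deg_refl[OF s] by blast
  qed
next
  case (step m)
  note s = step.prems(2)
  have fin: "finite V" using simple_finite[OF s] .
  show ?case
  proof (rule ccontr)
    assume no: "\<not> ?thesis"
    then have np: "\<not> pot_clique V E (Suc m)" by blast
    show False
    proof (cases "Suc m \<le> card Lf + 2")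
      case True
      then show False using embed_many_leaves[OF s step.prems(3) _ np True step.prems(1)] step.hyps no by fastforce
    next
      case few: False
      then have t: "7 * (Suc m - 2) < card X" using step.prems(1) by linarith
      let ?h = "card {v\<in>V. Suc m \<le> dg E v + 1}"
      show False
      proof (cases "Suc m + card Lf < ?h + 2 \<longrightarrow> (\<forall>v\<in>V. dg E v + 3 \<le> 2 * Suc m)")
        case True
        then have "\<exists>f. emb False V E X Q f"
          using embed_few_leaves[OF s step.prems(3) np _ t] few by simp
        then show False using no same_deg_refl[OF s] by blast
      next
        case False
        \<comment> \<open>These are the hypotheses of \<open>pot_clique_large_max\<close>: the
          degree of \<open>u\<close> is at least \<open>2 * m\<close>, and since a tree with an edge
          has at least two leaves, more than \<open>Suc m\<close> vertices have degree at least
          \<open>m\<close>.\<close>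
        then obtain u where h: "Suc m + card Lf < ?h + 2" and u: "u \<in> V" "2 * Suc m < dg E u + 3" by auto
        have t2: "2 \<le> card X" using t few by linarith
        have l2: "2 \<le> card Lf" using excess[OF t2] by simp
        obtain v where v: "v \<in> V" "\<forall>x\<in>V. dg E x \<le> dg E v" using ex_max_dg[OF fin] u by blast
        obtain E1 where E1: "same_deg V E E1" "\<forall>x\<in>nb E1 v. \<forall>y\<in>V-{v}-nb E1 v. dg E y \<le> dg E x"
          using lay_off_vertex[OF s v(1)] by blast
        have s1: "simple_graph (V, E1)" using same_deg_simple[OF E1(1)] .
        have dE: "dg E1 x = dg E x" if "x \<in> V" for x using same_deg_dg[OF E1(1) that] .
        have c1: "card (V - {v}) + 2 = card X + m" using step.prems(3) card.remove[OF fin v(1)] by linarith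
        have c2: "m + 1 \<le> card Lf \<or> 7 * (m - 2) < card X" using t by linarith
        from step.IH[OF c2 simple_del_vertex[OF s1] c1]
        consider "pot_clique (V - {v}) (del_vertex E1 v) m" |
          E' f where "same_deg (V - {v}) (del_vertex E1 v) E'" "emb False (V - {v}) E' X Q f"
          by blast
        then show False
        proof cases
          case 1
          have "pot_clique V E1 (Suc m)"
          proof (rule pot_clique_large_max[OF s1 v(1) _ _ _ _ 1])
            show "\<forall>x\<in>V. dg E1 x \<le> dg E1 v" using v dE by simp
            show "\<forall>x\<in>nb E1 v. \<forall>y\<in>V - {v} - nb E1 v. dg E1 y \<le> dg E1 x"
            proof (intro ballI)
              fix x y assume xy: "x \<in> nb E1 v" "y \<in> V - {v} - nb E1 v"
              then have "x \<in> V" "y \<in> V" using nb_sub[OF s1, of v] by blast+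
              then show "dg E1 y \<le> dg E1 x" using E1(2) xy dE by simp
            qed
            have "{x\<in>V. m \<le> dg E1 x} = {v\<in>V. Suc m \<le> dg E v + 1}" using dE by auto
            then show "Suc m \<le> card {x\<in>V. m \<le> dg E1 x}" using h l2 by simp
            show "2 * m \<le> dg E1 v" using dE[OF v(1)] v(2) u by fastforce
          qed
          then show False using np pot_clique_same_deg[OF E1(1)] by blast
        next
          case 2
          have "same_deg V E (add_vertex E' v (nb E1 v))"
            using same_deg_trans[OF E1(1) same_deg_add_vertex[OF s1 v(1) 2(1)]] .
          with emb_add_vertex[OF s1 v(1) 2]
          have "\<exists>E' f. same_deg V E E' \<and> emb False V E' X Q f" by (intro exI conjI)
          then show False using no by blast
        qed
      qed
    qed
  qed
qed

end

section \<open>Degree sequences\<close>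

lemma pot_clique_potentially_graphic:
  assumes g: "graphic d" and r: "realization E d" and p: "pot_clique {..<length d} E s"
  shows "potentially_graphic (complete_graph s) d"
proof -
  let ?N = "length d"
  have s: "simple_graph ({..<?N}, E)" using r by (simp add: realization_def)
  obtain E' K where E': "same_deg {..<?N} E E'" "K \<subseteq> {..<?N}" "card K = s" "\<forall>x\<in>K. \<forall>y\<in>K. x \<noteq> y \<longrightarrow> E' x y"
    using p unfolding pot_clique_def by blast
  have s': "simple_graph ({..<?N}, E')" using same_deg_simple[OF E'(1)] .
  have "realization E' d"
    using r s' same_deg_dg[OF E'(1)] by (simp add: realization_def gdegree_dg[OF s] gdegree_dg[OF s'])
  moreover have "contains_subgraph ({..<?N}, E') (complete_graph s)"
  proof -
    have "finite K" using E'(2) finite_subset by blast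
    then obtain f where "bij_betw f {0..<card K} K" using ex_bij_betw_nat_finite by blast
    then have f: "inj_on f {..<s}" "f ` {..<s} = K" using E'(3) by (auto simp: bij_betw_def lessThan_atLeast0)
    have "E' (f u) (f v)" if "u < s" "v < s" "u \<noteq> v" for u v
    proof -
      have "f u \<in> K" "f v \<in> K" "f u \<noteq> f v" using f that by (auto simp: inj_on_def)
      then show ?thesis using E'(4) by blast
    qed
    then show ?thesis
      unfolding contains_subgraph_def complete_graph_def using f E'(2) by (intro exI[of _ f]) auto
  qed
  ultimately show ?thesis unfolding potentially_graphic_def using g by blast
qed

lemma emb_potentially_graphic:
  assumes g: "graphic d" and r: "realization E d" and e: "same_deg {..<length d} E E'"
    and X: "simple_graph T" and f: "emb False {..<length d} E' (fst T) (snd T) f"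
  shows "potentially_graphic T (complementary_seq d)"
proof -
  define N where "N = length d"
  have s: "simple_graph ({..<N}, E)" using r by (simp add: realization_def N_def)
  have s': "simple_graph ({..<N}, E')" using same_deg_simple[OF e] by (simp add: N_def)
  have dE': "dg E' i = d ! i" if "i < N" for i
    using r same_deg_dg[OF e, of i] that gdegree_dg[OF s] by (simp add: realization_def N_def)
  \<comment> \<open>\<open>complementary_seq\<close> reverses the list to keep it nonincreasing, so
    the complement is relabelled by \<open>u \<mapsto> N - 1 - u\<close>.\<close>
  define C where "C = (\<lambda>u v. u < N \<and> v < N \<and> u \<noteq> v \<and> \<not> E' (N - 1 - u) (N - 1 - v))"
  have len: "length (complementary_seq d) = N" by (simp add: complementary_seq_def N_def)
  have sC: "simple_graph ({..<N}, C)"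
    by (rule simpleI) (use simple_sym[OF s'] in \<open>auto simp: C_def\<close>)
  have gC: "gdegree ({..<N}, C) i = complementary_seq d ! i" if i: "i < N" for i
  proof -
    let ?j = "N - 1 - i"
    have j: "?j < N" using i by simp
    have "{u \<in> {..<N}. C i u} = (\<lambda>u. N - 1 - u) ` ({..<N} - insert ?j (nb E' ?j))"
    proof (rule set_eqI)
      fix u
      show "u \<in> {u \<in> {..<N}. C i u} \<longleftrightarrow> u \<in> (\<lambda>u. N - 1 - u) ` ({..<N} - insert ?j (nb E' ?j))"
      proof
        assume "u \<in> {u \<in> {..<N}. C i u}"
        then have u: "u < N" "i \<noteq> u" "\<not> E' ?j (N - 1 - u)" by (auto simp: C_def)
        have "u = N - 1 - (N - 1 - u)" using u by simp
        moreover have "N - 1 - u \<in> {..<N} - insert ?j (nb E' ?j)" using u i by auto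
        ultimately show "u \<in> (\<lambda>u. N - 1 - u) ` ({..<N} - insert ?j (nb E' ?j))" by (rule image_eqI)
      next
        assume "u \<in> (\<lambda>u. N - 1 - u) ` ({..<N} - insert ?j (nb E' ?j))"
        then obtain w where w: "u = N - 1 - w" "w \<in> {..<N} - insert ?j (nb E' ?j)" by (rule imageE)
        then have w: "u = N - 1 - w" "w < N" "w \<noteq> ?j" "\<not> E' ?j w" by simp_all
        then have "N - 1 - u = w" "u < N" "i \<noteq> u" using i by auto
        then show "u \<in> {u \<in> {..<N}. C i u}" using w i by (simp add: C_def)
      qed
    qed
    moreover have "inj_on (\<lambda>u. N - 1 - u) ({..<N} - insert ?j (nb E' ?j))" by (auto simp: inj_on_def)
    ultimately have "gdegree ({..<N}, C) i = card ({..<N} - insert ?j (nb E' ?j))"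
      by (simp add: gdegree_def card_image)
    also have "\<dots> = card {..<N} - card (insert ?j (nb E' ?j))"
      using nb_sub[OF s', of ?j] finite_nb[OF s'] j by (intro card_Diff_subset) auto
    also have "card (insert ?j (nb E' ?j)) = Suc (dg E' ?j)"
      using finite_nb[OF s'] simple_irrefl[OF s', of ?j] by (simp add: dg_def)
    finally show ?thesis using dE'[OF j] i by (simp add: complementary_seq_def rev_nth N_def)
  qed
  have real: "realization C (complementary_seq d)"
    unfolding realization_def len using sC gC by blast
  have "sorted_wrt (\<ge>) d" using g by (simp add: graphic_def sorted_wrt_rev)
  then have "sorted_wrt (\<lambda>x y. N - 1 - x \<le> N - 1 - y) d" by (rule sorted_wrt_mono_rel[rotated]) auto
  then have "sorted (rev (complementary_seq d))"
    by (simp add: complementary_seq_def sorted_wrt_map N_def)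
  then have "graphic (complementary_seq d)" using real by (auto simp: graphic_def)
  moreover have "contains_subgraph ({..<N}, C) T"
    unfolding contains_subgraph_def fst_conv snd_conv
  proof (intro exI[of _ "\<lambda>x. N - 1 - f x"] conjI ballI impI)
    have fN: "f x < N" if "x \<in> fst T" for x using f that by (auto simp: emb_def N_def)
    show "inj_on (\<lambda>x. N - 1 - f x) (fst T)"
    proof (rule inj_onI)
      fix x y assume "x \<in> fst T" "y \<in> fst T" "N - 1 - f x = N - 1 - f y"
      then have "f x = f y" using fN[of x] fN[of y] by simp
      then show "x = y" using f \<open>x \<in> fst T\<close> \<open>y \<in> fst T\<close> by (auto simp: emb_def inj_on_def)
    qed
    show "(\<lambda>x. N - 1 - f x) ` fst T \<subseteq> {..<N}" using fN by fastforce
    fix u v assume uv: "u \<in> fst T" "v \<in> fst T" "snd T u v"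
    have "u \<noteq> v" using uv(3) X by (auto simp: simple_graph_def)
    then have "\<not> E' (f u) (f v)" "f u \<noteq> f v" using f uv by (auto simp: emb_def inj_on_def)
    moreover have "N - 1 - (N - 1 - f u) = f u" "N - 1 - (N - 1 - f v) = f v" using fN[OF uv(1)] fN[OF uv(2)] by auto
    moreover have "N - 1 - f u \<noteq> N - 1 - f v" using calculation by metis
    ultimately show "C (N - 1 - f u) (N - 1 - f v)" using fN[OF uv(1)] fN[OF uv(2)] by (simp add: C_def)
  qed
  ultimately show ?thesis unfolding potentially_graphic_def len using real by blast
qed

text \<open>The extremal graph is the join of a clique of order \<open>a = N + 1 - t\<close> and an independent set.\<close>

lemma lower_bound:
  assumes T: "is_tree T" and t: "card (fst T) = t" and s: "2 \<le> s" and N: "N + 2 < t + s"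
    and t1: "t = 1 \<Longrightarrow> s = 2"
  shows "\<exists>d. length d = N \<and> graphic d \<and> \<not> potentially_graphic (complete_graph s) d \<and>
     \<not> potentially_graphic T (complementary_seq d)"
proof -
  interpret tree_graph "fst T" "snd T" using T by unfold_locales simp
  \<comment> \<open>By truncation \<open>a = 0\<close> for \<open>N < t\<close>, and the graph is
    then empty. In all cases \<open>a \<le> s - 2\<close> and \<open>N - a < t\<close>.\<close>
  define a where "a = N + 1 - t"
  define d where "d = replicate a (N - 1) @ replicate (N - a) a"
  have t0: "1 \<le> t" using X_ne finX t card_gt_0_iff[of "fst T"] by fastforce
  have a: "a \<le> N" "a + 2 \<le> s" "N - a < t" using t0 N s by (auto simp: a_def)
  have len: "length d = N" using a by (simp add: d_def)
  have nth: "d ! i = (if i < a then N - 1 else a)" if "i < N" for i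
    using that a by (auto simp: d_def nth_append)
  have aN: "a \<le> N - 1" if "0 < N" using that t0 t1 N by (cases "t = 1") (auto simp: a_def)
  define E where "E = (\<lambda>u v. u < N \<and> v < N \<and> u \<noteq> v \<and> (u < a \<or> v < a))"
  have sE: "simple_graph ({..<N}, E)" by (rule simpleI) (auto simp: E_def)
  have "gdegree ({..<N}, E) i = d ! i" if i: "i < N" for i
  proof (cases "i < a")
    case True
    then have "{u\<in>{..<N}. E i u} = {..<N} - {i}" using i by (auto simp: E_def)
    then show ?thesis using True i nth by (simp add: gdegree_def)
  next
    case False
    then have "{u\<in>{..<N}. E i u} = {..<a}" using i a by (auto simp: E_def)
    then show ?thesis using False i nth by (simp add: gdegree_def)
  qed
  then have "realization E d" using sE len by (simp add: realization_def)
  moreover have "sorted (rev d)"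
  proof (cases "N = 0")
    case False
    then show ?thesis using aN by (auto simp: d_def sorted_append)
  qed (simp add: d_def a(1))
  ultimately have g: "graphic d" by (auto simp: graphic_def)
  have 1: "\<not> potentially_graphic (complete_graph s) d"
  proof
    assume "potentially_graphic (complete_graph s) d"
    then obtain E' f where E': "realization E' d" and f: "inj_on f {..<s}" "f ` {..<s} \<subseteq> {..<N}"
      "\<And>u v. u < s \<Longrightarrow> v < s \<Longrightarrow> u \<noteq> v \<Longrightarrow> E' (f u) (f v)"
      unfolding potentially_graphic_def contains_subgraph_def complete_graph_def len by auto
    have s': "simple_graph ({..<N}, E')" using E' len by (simp add: realization_def)
    \<comment> \<open>In any realization a vertex of the clique has degree at least
      \<open>s - 1 > a\<close>, so it is one of the \<open>a\<close> dominating vertices, too few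
      for \<open>s\<close>.\<close>
    have "f ` {..<s} \<subseteq> {..<a}"
    proof
      fix y assume "y \<in> f ` {..<s}"
      then obtain u where u: "u < s" "y = f u" by auto
      have "f ` ({..<s} - {u}) \<subseteq> nb E' y" using f(3) u by fastforce
      then have "card (f ` ({..<s} - {u})) \<le> dg E' y" unfolding dg_def using finite_nb[OF s'] by (intro card_mono) auto
      moreover have "card (f ` ({..<s} - {u})) = s - 1"
        using f(1) u by (subst card_image) (auto simp: inj_on_def)
      moreover have yN: "y < N" using f(2) u by auto
      moreover have "dg E' y = d ! y" using E' yN len gdegree_dg[OF s'] by (simp add: realization_def)
      ultimately have "s - 1 \<le> d ! y" by simp
      then show "y \<in> {..<a}" using nth[OF yN] a(2) by (auto split: if_splits)
    qed
    then have "card (f ` {..<s}) \<le> card {..<a}" by (intro card_mono) auto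
    then show False using f(1) a(2) by (simp add: card_image)
  qed
  have 2: "\<not> potentially_graphic T (complementary_seq d)"
  proof
    assume p: "potentially_graphic T (complementary_seq d)"
    have lenc: "length (complementary_seq d) = N" by (simp add: complementary_seq_def len)
    obtain E' f where E': "realization E' (complementary_seq d)" and f: "inj_on f (fst T)" "f ` fst T \<subseteq> {..<N}"
      "\<And>u v. snd T u v \<Longrightarrow> E' (f u) (f v)"
      using p inX unfolding potentially_graphic_def contains_subgraph_def lenc by auto
    have s': "simple_graph ({..<N}, E')" using E' lenc by (simp add: realization_def)
    \<comment> \<open>The dominating vertices are isolated in every realization of the complementary
      sequence, where the reversal puts them last.\<close>
    have "f ` fst T \<subseteq> {..<N - a}"
    proof
      fix y assume "y \<in> f ` fst T"
      then obtain u where u: "u \<in> fst T" "y = f u" by auto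
      have yN: "y < N" using f(2) u by auto
      show "y \<in> {..<N - a}"
      \<comment> \<open>A tree with one vertex could sit on an isolated vertex; here
        \<open>t = 1\<close> entails \<open>s = 2\<close> and thus \<open>N = 0\<close>.\<close>
      proof (cases "t = 1")
        case True
        then show ?thesis using t1 N yN by simp
      next
        case False
        then have "1 \<le> dg (snd T) u" using dg_pos[OF _ u(1)] t t0 by simp
        then have "nb (snd T) u \<noteq> {}" by (auto simp: dg_def)
        then obtain v where "snd T u v" by (auto simp: nb_def)
        then have "E' y (f v)" using f(3) u by simp
        then have "nb E' y \<noteq> {}" by (auto simp: nb_def)
        then have "dg E' y > 0" using finite_nb[OF s'] by (simp add: dg_def card_gt_0_iff)
        moreover have "dg E' y = complementary_seq d ! y"
          using E' yN lenc gdegree_dg[OF s'] by (simp add: realization_def)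
        moreover have "complementary_seq d ! y = N - 1 - d ! (N - 1 - y)"
          using yN len by (simp add: complementary_seq_def rev_nth)
        moreover have "d ! (N - 1 - y) = (if N - 1 - y < a then N - 1 else a)" using nth[of "N - 1 - y"] yN by simp
        ultimately have "\<not> N - 1 - y < a" by (auto split: if_splits)
        then show ?thesis using yN by simp
      qed
    qed
    then have "card (f ` fst T) \<le> card {..<N - a}" by (intro card_mono) auto
    then show False using f(1) a(3) t by (simp add: card_image)
  qed
  show ?thesis using len g 1 2 by blast
qed

theorem theorem6:
  fixes s t :: nat and T :: "'a graph"
  assumes "s \<ge> 2"
    and "is_tree T" and "card (fst T) = t"
    and "leaves T \<ge> s + 1 \<or> t > 7 * (s - 2)"
  shows "r_pot (complete_graph s) T = t + s - 2"
proof -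
  interpret tree_graph "fst T" "snd T" using assms(2) by unfold_locales simp
  have t0: "1 \<le> t" using X_ne finX assms(3) card_gt_0_iff[of "fst T"] by fastforce
  have lv: "leaves T = card Lf" using leaves_Lf by simp
  have lt: "card Lf \<le> t" using LfX finX assms(3) by (metis card_mono)
  have upper: "potentially_graphic (complete_graph s) d \<or> potentially_graphic T (complementary_seq d)"
    if d: "length d = t + s - 2" "graphic d" for d
  proof -
    obtain E where E: "realization E d" using d(2) by (auto simp: graphic_def)
    have sE: "simple_graph ({..<length d}, E)" using E by (simp add: realization_def)
    have "card {..<length d} + 2 = card (fst T) + s" using d(1) assms(1,3) t0 by simp
    from clique_or_tree[OF assms(1) _ sE this]
    consider "pot_clique {..<length d} E s" |
      E' f where "same_deg {..<length d} E E'" "emb False {..<length d} E' (fst T) (snd T) f"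
      using assms(3,4) lv by auto
    then show ?thesis
    proof cases
      case 1
      then show ?thesis using pot_clique_potentially_graphic[OF d(2) E] by blast
    next
      case 2
      have "simple_graph T" using simple by simp
      then show ?thesis using emb_potentially_graphic[OF d(2) E 2(1) _ 2(2)] by blast
    qed
  qed
  show ?thesis
    unfolding r_pot_def
  proof (rule Least_equality)
    show "\<forall>d. length d = t + s - 2 \<and> graphic d \<longrightarrow>
      potentially_graphic (complete_graph s) d \<or> potentially_graphic T (complementary_seq d)"
      using upper by blast
  next
    fix N assume N: "\<forall>d. length d = N \<and> graphic d \<longrightarrow>
      potentially_graphic (complete_graph s) d \<or> potentially_graphic T (complementary_seq d)"
    show "t + s - 2 \<le> N"
    proof (rule ccontr)
      assume "\<not> t + s - 2 \<le> N"
      then have "N + 2 < t + s" by simp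
      \<comment> \<open>One vertex cannot supply \<open>s + 1\<close> leaves, so the second
        alternative \<open>1 > 7 * (s - 2)\<close> holds.\<close>
      moreover have "s = 2" if "t = 1" using that assms(1,4) lv lt by auto
      ultimately obtain d where "length d = N" "graphic d" "\<not> potentially_graphic (complete_graph s) d"
        "\<not> potentially_graphic T (complementary_seq d)"
        using lower_bound[OF assms(2,3,1)] by blast
      then show False using N by blast
    qed
  qed
qed

end
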